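(* Let $(X,d)$ be a metric space with bounded geometry. Then $X$ has property A if and only if $X$ has the operator norm localization property (ONL).
   Context: Metric spaces are assumed nonempty. For $x\in X$ and $S>0$, $N(x,S)=\{y\in X : d(x,y)\le S\}$ denotes the closed ball. $(X,d)$ has bounded geometry if $\sup_{x\in X}|N(x,S)|<\infty$ for every $S>0$ (in particular $X$ is discrete). Property A: for every $R>0$ and $\epsilon>0$ there exist $S>0$ and finite subsets $A_x\subseteq X\times\mathbb{N}$ ($x\in X$) such that (i) if $d(y,z)\le R$, then $|A_y\bigtriangleup A_z|<\epsilon\,|A_y\cap A_z|$, where $\bigtriangleup$ is the symmetric difference; and (ii) $A_x\subseteq N(x,S)\times\mathbb{N}$ for every $x\in X$. Operator norm localization property (ONL): let $\mathcal{H}$ be a separable infinite-dimensional Hilbert space. Let $\nu$ be a positive (nonzero) locally finite Borel measure on $X$. A bounded operator $a$ on $L^2((X,\nu),\mathcal{H})=L^2(X,\nu)\otimes\mathcal{H}$ can be written, since $X$ is discrete, as a matrix $a=[a_{y,z}]$ indexed by the points $y,z\in X$ of positive $\nu$-measure, with entries $a_{y,z}\in\mathbb{B}(\mathcal{H})$; its propagation is $\sup\{d(y,z) : a_{y,z}\neq 0\}$ (equal to $0$ if $a=0$). For a function $f\colon\mathbb{N}\to\mathbb{N}$ and a constant $0<c\le 1$, $(X,\nu)$ has ONL relative to $f$ with constant $c$ if for every $R\in\mathbb{N}$ and every bounded operator $a$ on $L^2((X,\nu),\mathcal{H})$ of propagation at most $R$ there is a nonzero vector $\zeta\in L^2((X,\nu),\mathcal{H})$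 with $\mathrm{diam}(\mathrm{supp}(\zeta))\le f(R)$ and $c\,\|a\|\,\|\zeta\|\le\|a\zeta\|$. The space $X$ has ONL if there exist a constant $0<c\le1$ and a function $f\colon\mathbb{N}\to\mathbb{N}$ such that for every positive locally finite Borel measure $\nu$ on $X$, $(X,\nu)$ has ONL relative to $f$ with constant $c$. *)

theory Defs
  imports "HOL-Analysis.Analysis"
begin

section \<open>Complex Hilbert spaces\<close>

text \<open>A complex Hilbert space, together with its underlying real Hilbert space: the real inner
  product is the real part of the complex one, so the norm is the one induced by \<open>cinner\<close>. The
  complex inner product is linear in its first argument.\<close>

class complex_hilbert_space = real_inner + complete_space +
  fixes scaleC :: "complex \<Rightarrow> 'a \<Rightarrow> 'a" (infixr "*\<^sub>C" 75)
    and cinner :: "'a \<Rightarrow> 'a \<Rightarrow> complex"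
  assumes scaleC_add_right: "c *\<^sub>C (x + y) = c *\<^sub>C x + c *\<^sub>C y"
    and scaleC_add_left: "(b + c) *\<^sub>C x = b *\<^sub>C x + c *\<^sub>C x"
    and scaleC_scaleC: "b *\<^sub>C (c *\<^sub>C x) = (b * c) *\<^sub>C x"
    and scaleC_of_real: "complex_of_real r *\<^sub>C x = scaleR r x"
    and cinner_commute: "cinner x y = cnj (cinner y x)"
    and cinner_add_left: "cinner (x + y) z = cinner x z + cinner y z"
    and cinner_scaleC_left: "cinner (c *\<^sub>C x) y = c * cinner x y"
    and inner_eq_Re_cinner: "inner x y = Re (cinner x y)"

global_interpretation complex_vector:
  vector_space "scaleC :: complex \<Rightarrow> 'a \<Rightarrow> 'a::complex_hilbert_space"
proof
  fix x :: 'a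
  show "1 *\<^sub>C x = x"
    using scaleC_of_real[of 1 x] by simp
qed (simp_all add: scaleC_add_right scaleC_add_left scaleC_scaleC)

definition infinite_dimensional :: "'h::complex_hilbert_space itself \<Rightarrow> bool" where
  "infinite_dimensional _ \<longleftrightarrow>
     \<not> (\<exists>B :: 'h set. finite B \<and> complex_vector.span B = UNIV)"

section \<open>Bounded geometry and property A\<close>

definition bounded_geometry :: "'a::metric_space itself \<Rightarrow> bool" where
  "bounded_geometry _ \<longleftrightarrow>
     (\<forall>S>0. \<exists>N::nat. \<forall>x::'a. finite (cball x S) \<and> card (cball x S) \<le> N)"

definition property_A :: "'a::metric_space itself \<Rightarrow> bool" where
  "property_A _ \<longleftrightarrow>
     (\<forall>R>0. \<forall>\<epsilon>>0. \<exists>S>0. \<exists>A :: 'a \<Rightarrow> ('a \<times> nat) set.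
        (\<forall>x. finite (A x)) \<and>
        (\<forall>y z. dist y z \<le> R \<longrightarrow>
           real (card ((A y - A z) \<union> (A z - A y))) < \<epsilon> * real (card (A y \<inter> A z))) \<and>
        (\<forall>x. A x \<subseteq> cball x S \<times> UNIV))"

section \<open>Operators on Hilbert-space-valued square-integrable functions\<close>

definition locally_finite_borel :: "'a::metric_space measure \<Rightarrow> bool" where
  "locally_finite_borel \<nu> \<longleftrightarrow> sets \<nu> = sets borel \<and>
     (\<forall>x. \<exists>U. open U \<and> x \<in> U \<and> emeasure \<nu> U < \<infinity>)"

text \<open>Vectors of the \<open>L\<^sup>2\<close>-space are represented by functions; two functions represent the same
  vector iff they agree almost everywhere.\<close>

definition L2_fun :: "'a::metric_space measure \<Rightarrow> ('a \<Rightarrow> 'h::complex_hilbert_space) set" where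
  "L2_fun \<nu> = {\<zeta> \<in> borel_measurable \<nu>. integrable \<nu> (\<lambda>x. (norm (\<zeta> x))\<^sup>2)}"

definition L2_norm :: "'a::metric_space measure \<Rightarrow> ('a \<Rightarrow> 'h::complex_hilbert_space) \<Rightarrow> real" where
  "L2_norm \<nu> \<zeta> = sqrt (\<integral>x. (norm (\<zeta> x))\<^sup>2 \<partial>\<nu>)"

text \<open>Linearity is only required almost everywhere. Together with boundedness this makes the
  operator respect almost-everywhere equality, so that it is exactly (a lift to functions of) a
  bounded operator on the \<open>L\<^sup>2\<close>-space.\<close>

definition L2_bounded_operator ::
  "'a::metric_space measure \<Rightarrow> (('a \<Rightarrow> 'h::complex_hilbert_space) \<Rightarrow> ('a \<Rightarrow> 'h)) \<Rightarrow> bool" where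
  "L2_bounded_operator \<nu> a \<longleftrightarrow>
     (\<forall>\<zeta>\<in>L2_fun \<nu>. a \<zeta> \<in> L2_fun \<nu>) \<and>
     (\<forall>\<zeta>\<in>L2_fun \<nu>. \<forall>\<xi>\<in>L2_fun \<nu>. AE x in \<nu>. a (\<lambda>x. \<zeta> x + \<xi> x) x = a \<zeta> x + a \<xi> x) \<and>
     (\<forall>c. \<forall>\<zeta>\<in>L2_fun \<nu>. AE x in \<nu>. a (\<lambda>x. c *\<^sub>C \<zeta> x) x = c *\<^sub>C a \<zeta> x) \<and>
     (\<exists>C. \<forall>\<zeta>\<in>L2_fun \<nu>. L2_norm \<nu> (a \<zeta>) \<le> C * L2_norm \<nu> \<zeta>)"

definition L2_operator_norm ::
  "'a::metric_space measure \<Rightarrow> (('a \<Rightarrow> 'h::complex_hilbert_space) \<Rightarrow> ('a \<Rightarrow> 'h)) \<Rightarrow> real" where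
  "L2_operator_norm \<nu> a = (SUP \<zeta>\<in>{\<zeta>\<in>L2_fun \<nu>. L2_norm \<nu> \<zeta> \<le> 1}. L2_norm \<nu> (a \<zeta>))"

definition atoms :: "'a::metric_space measure \<Rightarrow> 'a set" where
  "atoms \<nu> = {x. emeasure \<nu> {x} > 0}"

text \<open>The entry at \<open>(y, z)\<close>, to be used for atoms \<open>y\<close> and \<open>z\<close> only, so that \<open>a \<zeta> y\<close> is the sum
  over the atoms \<open>z\<close> of the entries applied to \<open>\<zeta> z\<close>. Passing to the orthonormal system of
  normalized point masses rescales each entry by a positive factor, which does not affect which
  entries vanish.\<close>

definition matrix_entry ::
  "(('a \<Rightarrow> 'h::complex_hilbert_space) \<Rightarrow> ('a \<Rightarrow> 'h)) \<Rightarrow> 'a \<Rightarrow> 'a \<Rightarrow> 'h \<Rightarrow> 'h" where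
  "matrix_entry a y z h = a (\<lambda>x. if x = z then h else 0) y"

text \<open>Valued in \<open>ennreal\<close>: the propagation may be infinite, and the supremum of the empty set
  is \<open>0\<close>.\<close>

definition propagation ::
  "'a::metric_space measure \<Rightarrow> (('a \<Rightarrow> 'h::complex_hilbert_space) \<Rightarrow> ('a \<Rightarrow> 'h)) \<Rightarrow> ennreal" where
  "propagation \<nu> a =
     (SUP (y, z)\<in>{(y, z). y \<in> atoms \<nu> \<and> z \<in> atoms \<nu> \<and> matrix_entry a y z \<noteq> (\<lambda>h. 0)}.
        ennreal (dist y z))"

definition L2_supp :: "'a::metric_space measure \<Rightarrow> ('a \<Rightarrow> 'h::complex_hilbert_space) \<Rightarrow> 'a set" where
  "L2_supp \<nu> \<zeta> = {x \<in> atoms \<nu>. \<zeta> x \<noteq> 0}"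

section \<open>The operator norm localization property\<close>

text \<open>Boundedness of the support is required separately because \<open>diameter\<close> is a meaningless real
  number on unbounded sets.\<close>

definition ONL_relative ::
  "'h::complex_hilbert_space itself \<Rightarrow> 'a::metric_space measure \<Rightarrow> (nat \<Rightarrow> nat) \<Rightarrow> real \<Rightarrow> bool" where
  "ONL_relative _ \<nu> f c \<longleftrightarrow>
     (\<forall>R::nat. \<forall>a :: ('a \<Rightarrow> 'h) \<Rightarrow> ('a \<Rightarrow> 'h).
        L2_bounded_operator \<nu> a \<and> propagation \<nu> a \<le> of_nat R \<longrightarrow>
        (\<exists>\<zeta>\<in>L2_fun \<nu>. \<not> (AE x in \<nu>. \<zeta> x = 0) \<and>
           bounded (L2_supp \<nu> \<zeta>) \<and> diameter (L2_supp \<nu> \<zeta>) \<le> real (f R) \<and>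
           c * L2_operator_norm \<nu> a * L2_norm \<nu> \<zeta> \<le> L2_norm \<nu> (a \<zeta>)))"

definition has_ONL :: "'h::complex_hilbert_space itself \<Rightarrow> 'a::metric_space itself \<Rightarrow> bool" where
  "has_ONL H _ \<longleftrightarrow>
     (\<exists>c f. 0 < c \<and> c \<le> 1 \<and>
        (\<forall>\<nu> :: 'a measure. locally_finite_borel \<nu> \<and> emeasure \<nu> (space \<nu>) \<noteq> 0 \<longrightarrow>
           ONL_relative H \<nu> f c))"

end

theory Submission
  imports Defs
begin

text \<open>
  From property A to ONL: the normalised indicator functions of the sets \<open>A\<^sub>x\<close> give a quadratic
  partition of unity \<open>\<phi>\<^sub>w\<close> by functions of bounded support. If \<open>\<zeta>\<close> almost attains the norm of an
  operator \<open>a\<close> of small propagation, then the commutators of \<open>a\<close> with the \<open>\<phi>\<^sub>w\<close> are small by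
  bounded geometry, so one of the localized vectors \<open>\<phi>\<^sub>w \<zeta>\<close> witnesses at least half of the norm.

  From ONL to property A: property A follows once there are positive definite kernels \<open>k\<close>, each a
  locally finite sum of positive kernels supported on balls of a fixed radius, that are
  uniformly close to \<open>1\<close> on the band \<open>d(y, z) \<le> R\<close>. By compactness it suffices to find these on finite
  sets. There the duality of convex cones applies: an obstruction is a symmetric matrix \<open>m\<close> of
  propagation \<open>R\<close> that is nonnegative on all localized vectors while the sum of its entries is less
  than \<open>-\<delta>\<close> times its trace. After rescaling its diagonal to \<open>1\<close>, a multiple of the
  identity minus \<open>m\<close> is a positive operator whose norm is strictly larger than its norm on localized
  vectors, and a high power of it violates ONL.
\<close>

section \<open>Positive semidefinite kernels\<close>

text \<open>ONL comes with some constant \<open>c\<close>, possibly tiny, whereas the obstruction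
  matrix only produces the fixed gain (N + \<delta>) / N. Taking n-th powers makes this gain exceed
  1 / c, at a price: the propagation becomes n R, the localized vector has support of diameter up to
  f(n R), and applying k factors spreads it by a further k R. Hence S is chosen beyond f(n R) + n R.
  It depends on R, \<delta>, c and the ball bound N, but not on the finite set, which is what
  compactness requires. The number N enters through the Schur test: a band matrix with entries of
  modulus at most 1 and at most N entries per row has form bounded by N, so N minus it is positive.
  The trace appears because, after normalising the diagonal, it is the squared norm of the test
  vector. The separating matrix is not obtained from an abstract separation theorem: it is the
  gradient of a squared distance at a minimum, which makes it explicit and supported on the band. In
  the other direction the radius must not depend on the measure; the masses are absorbed into
  square-root weights, and only N and property A enter the estimates.\<close>

lemma nonneg_quadratic_discriminant:
  fixes a b c :: real
  assumes nonneg: "\<And>t. 0 \<le> a + 2 * t * b + t\<^sup>2 * c" and "0 \<le> c"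
  shows "b\<^sup>2 \<le> a * c"
proof (cases "c = 0")
  case True
  have "b = 0"
  proof (rule ccontr)
    assume "b \<noteq> 0"
    then show False
      using nonneg[of "- (a + 1) / (2 * b)"] True by (simp add: field_simps)
  qed
  then show ?thesis using True by simp
next
  case False
  with \<open>0 \<le> c\<close> have c: "c > 0" by simp
  have "0 \<le> (a + 2 * (-b/c) * b + (-b/c)\<^sup>2 * c) * c" using nonneg[of "-b/c"] c by simp
  also have "\<dots> = a * c - b\<^sup>2" using c by (simp add: field_simps power2_eq_square)
  finally show ?thesis by simp
qed

definition psd_on :: "'a set \<Rightarrow> ('a \<Rightarrow> 'a \<Rightarrow> real) \<Rightarrow> bool" where
  "psd_on Y k \<longleftrightarrow> (\<forall>y\<in>Y. \<forall>z\<in>Y. k y z = k z y) \<and>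
     (\<forall>c :: 'a \<Rightarrow> real. 0 \<le> (\<Sum>y\<in>Y. \<Sum>z\<in>Y. c y * c z * k y z))"

lemma psd_on_sym: "psd_on Y k \<Longrightarrow> y \<in> Y \<Longrightarrow> z \<in> Y \<Longrightarrow> k y z = k z y"
  by (simp add: psd_on_def)

lemma psd_on_nonneg:
  "psd_on Y k \<Longrightarrow> 0 \<le> (\<Sum>y\<in>Y. \<Sum>z\<in>Y. c y * c z * k y z)"
  by (simp add: psd_on_def)

lemma psd_on_subset:
  assumes "psd_on Y k" "Z \<subseteq> Y" "finite Y"
  shows "psd_on Z k"
  unfolding psd_on_def
proof (intro conjI allI)
  show "\<forall>y\<in>Z. \<forall>z\<in>Z. k y z = k z y" using assms by (auto simp: psd_on_def)
  fix c :: "'a \<Rightarrow> real"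
  let ?d = "\<lambda>y. if y \<in> Z then c y else 0"
  have "0 \<le> (\<Sum>y\<in>Y. \<Sum>z\<in>Y. ?d y * ?d z * k y z)"
    by (rule psd_on_nonneg[OF assms(1)])
  also have "\<dots> = (\<Sum>y\<in>Z. \<Sum>z\<in>Y. ?d y * ?d z * k y z)"
    using assms by (intro sum.mono_neutral_right) auto
  also have "\<dots> = (\<Sum>y\<in>Z. \<Sum>z\<in>Z. ?d y * ?d z * k y z)"
    using assms by (intro sum.cong sum.mono_neutral_right) auto
  finally show "0 \<le> (\<Sum>y\<in>Z. \<Sum>z\<in>Z. c y * c z * k y z)" by simp
qed

lemma psd_on_diag:
  assumes "psd_on Y k" "finite Y" "y \<in> Y"
  shows "0 \<le> k y y"
proof -
  have "psd_on {y} k" using assms psd_on_subset by fastforce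
  from psd_on_nonneg[OF this, of "\<lambda>_. 1"]
  show ?thesis by simp
qed

lemma psd_on_Cauchy_Schwarz:
  assumes "psd_on Y k" "finite Y" "y \<in> Y" "z \<in> Y"
  shows "(k y z)\<^sup>2 \<le> k y y * k z z"
proof (cases "y = z")
  case True
  then show ?thesis by (simp add: power2_eq_square)
next
  case False
  have psd: "psd_on {y, z} k" using assms psd_on_subset by fastforce
  show ?thesis
  proof (rule nonneg_quadratic_discriminant)
    fix t :: real
    let ?c = "\<lambda>w. if w = y then 1 else t"
    have "0 \<le> (\<Sum>u\<in>{y, z}. \<Sum>w\<in>{y, z}. ?c u * ?c w * k u w)"
      by (rule psd_on_nonneg[OF psd])
    also have "\<dots> = k y y + t * k y z + (t * k z y + t * t * k z z)"
      using False by simp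
    finally show "0 \<le> k y y + 2 * t * k y z + t\<^sup>2 * k z z"
      using psd_on_sym[OF assms(1,4,3)] by (simp add: power2_eq_square)
  qed (rule psd_on_diag[OF assms(1,2,4)])
qed

text \<open>Gaussian elimination: splitting off the rank-one kernel of the pivot \<open>p\<close>
  leaves a Schur complement that is positive semidefinite on the smaller set. The number
  \<open>card Y\<close> of squares matters later, where bounded geometry turns it into a uniform
  bound on an index.\<close>

lemma psd_on_sum_of_squares:
  fixes k :: "'a \<Rightarrow> 'a \<Rightarrow> real"
  assumes "finite Y" "psd_on Y k"
  shows "\<exists>v :: nat \<Rightarrow> 'a \<Rightarrow> real. \<forall>y\<in>Y. \<forall>z\<in>Y. k y z = (\<Sum>j<card Y. v j y * v j z)"
  using assms
proof (induction Y arbitrary: k rule: finite_induct)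
  case empty
  then show ?case by simp
next
  case (insert p Y)
  note psd = \<open>psd_on (insert p Y) k\<close>
  have fin: "finite (insert p Y)" using insert.hyps by simp
  \<comment> \<open>The reciprocal of the pivot, or 0 for a zero pivot; in the latter case
    Cauchy-Schwarz makes the whole row of \<open>p\<close> vanish, so \<open>kr\<close> holds either
    way.\<close>
  define r where "r = (if k p p = 0 then 0 else 1 / k p p)"
  have kpp: "0 \<le> k p p" using psd_on_diag[OF psd fin] by simp
  have r0: "0 \<le> r" and rr: "r * r * k p p = r" using kpp by (auto simp: r_def)
  have kr: "k p z * (r * k p p) = k p z" if "z \<in> insert p Y" for z
    using psd_on_Cauchy_Schwarz[OF psd fin, of p z] that by (auto simp: r_def)
  have sym: "k y z = k z y" if "y \<in> insert p Y" "z \<in> insert p Y" for y z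
    using psd_on_sym[OF psd that] .
  let ?k = "\<lambda>y z. k y z - k p y * k p z * r"
  have "psd_on Y ?k"
    unfolding psd_on_def
  proof (intro conjI allI)
    show "\<forall>y\<in>Y. \<forall>z\<in>Y. ?k y z = ?k z y" using sym by auto
    fix c :: "'a \<Rightarrow> real"
    define T where "T = (\<Sum>y\<in>Y. c y * k p y)"
    \<comment> \<open>This coefficient at \<open>p\<close> minimises the form in that coordinate,
      and the minimum is the form of the Schur complement.\<close>
    let ?c = "\<lambda>y. if y = p then - r * T else c y"
    have ne: "y \<noteq> p" if "y \<in> Y" for y using that insert.hyps by auto
    have inner: "(\<Sum>z\<in>insert p Y. ?c y * ?c z * k y z)
        = c y * k p y * (- r * T) + (\<Sum>z\<in>Y. c y * c z * k y z)" if "y \<in> Y" for y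
      using insert.hyps ne that sym[of p y] by (simp cong: sum.cong)
    have "0 \<le> (\<Sum>y\<in>insert p Y. \<Sum>z\<in>insert p Y. ?c y * ?c z * k y z)"
      by (rule psd_on_nonneg[OF psd])
    also have "\<dots> = (\<Sum>z\<in>insert p Y. ?c p * ?c z * k p z)
        + (\<Sum>y\<in>Y. c y * k p y * (- r * T) + (\<Sum>z\<in>Y. c y * c z * k y z))"
      using insert.hyps inner by (subst sum.insert) auto
    also have "(\<Sum>z\<in>insert p Y. ?c p * ?c z * k p z) = r * r * k p p * (T * T) + (- r * T) * T"
    proof -
      have "(\<Sum>z\<in>Y. ?c p * ?c z * k p z) = (\<Sum>z\<in>Y. (- r * T) * (c z * k p z))"
        by (intro sum.cong refl) (simp add: ne)
      also have "\<dots> = (- r * T) * T"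
        by (simp only: sum_distrib_left[symmetric] T_def[symmetric])
      finally have "(\<Sum>z\<in>Y. ?c p * ?c z * k p z) = (- r * T) * T" .
      then show ?thesis using insert.hyps by (simp add: mult_ac)
    qed
    also have "(\<Sum>y\<in>Y. c y * k p y * (- r * T) + (\<Sum>z\<in>Y. c y * c z * k y z))
        = T * (- r * T) + (\<Sum>y\<in>Y. \<Sum>z\<in>Y. c y * c z * k y z)"
      by (simp only: sum.distrib sum_distrib_right[symmetric] T_def[symmetric])
    finally have "0 \<le> (\<Sum>y\<in>Y. \<Sum>z\<in>Y. c y * c z * k y z) - r * (T * T)"
      by (simp only: rr) (simp add: algebra_simps)
    also have "\<dots> = (\<Sum>y\<in>Y. \<Sum>z\<in>Y. c y * c z * ?k y z)"
    proof -
      have TT: "T * T = (\<Sum>y\<in>Y. \<Sum>z\<in>Y. c y * k p y * (c z * k p z))"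
        unfolding T_def by (rule sum_product)
      have "r * (T * T) = (\<Sum>y\<in>Y. \<Sum>z\<in>Y. r * (c y * k p y * (c z * k p z)))"
        unfolding TT by (simp only: sum_distrib_left)
      also have "\<dots> = (\<Sum>y\<in>Y. \<Sum>z\<in>Y. c y * c z * (k p y * k p z * r))"
        by (intro sum.cong refl) (simp add: mult_ac)
      finally have "r * (T * T) = (\<Sum>y\<in>Y. \<Sum>z\<in>Y. c y * c z * (k p y * k p z * r))" .
      then show ?thesis by (simp add: right_diff_distrib sum_subtractf)
    qed
    finally show "0 \<le> (\<Sum>y\<in>Y. \<Sum>z\<in>Y. c y * c z * ?k y z)" .
  qed
  from insert.IH[OF this] obtain v where
    v: "\<And>y z. y \<in> Y \<Longrightarrow> z \<in> Y \<Longrightarrow> ?k y z = (\<Sum>j<card Y. v j y * v j z)"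
    by blast
  let ?v = "\<lambda>j y. if j = card Y then k p y * sqrt r else if y = p then 0 else v j y"
  have "k y z = (\<Sum>j<card (insert p Y). ?v j y * ?v j z)"
    if yz: "y \<in> insert p Y" "z \<in> insert p Y" for y z
  proof -
    have "(\<Sum>j<card (insert p Y). ?v j y * ?v j z)
        = k p y * k p z * r + (\<Sum>j<card Y. ?v j y * ?v j z)"
      using insert.hyps r0 by simp
    also have "(\<Sum>j<card Y. ?v j y * ?v j z) = ?k y z"
    proof (cases "y = p \<or> z = p")
      case True
      then have "k y z = k p y * k p z * r"
      proof
        assume "y = p"
        moreover have "k p p * k p z * r = k p z * (r * k p p)" by simp
        ultimately show ?thesis using kr[OF yz(2)] by metis
      next
        assume "z = p"
        moreover have "k p y * k p p * r = k p y * (r * k p p)" by simp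
        ultimately show ?thesis using kr[OF yz(1)] sym[OF yz] by metis
      qed
      then have "?k y z = 0" by simp
      moreover have "(\<Sum>j<card Y. ?v j y * ?v j z) = 0" using True by (intro sum.neutral) auto
      ultimately show ?thesis by simp
    next
      case False
      then have "?k y z = (\<Sum>j<card Y. v j y * v j z)" using yz by (intro v) auto
      also have "\<dots> = (\<Sum>j<card Y. ?v j y * ?v j z)"
        using False by (intro sum.cong) auto
      finally show ?thesis by simp
    qed
    finally show ?thesis by simp
  qed
  then show ?case by (intro exI[of _ ?v] ballI)
qed

section \<open>Property A from localized positive kernels\<close>

lemma bounded_geometry_finite_cball:
  fixes x :: "'a::metric_space"
  assumes "bounded_geometry TYPE('a)"
  shows "finite (cball x S)"
proof (cases "S > 0")
  case True
  then show ?thesis using assms unfolding bounded_geometry_def by blast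
next
  case False
  have "finite (cball x 1)" using assms zero_less_one unfolding bounded_geometry_def by blast
  then show ?thesis by (rule rev_finite_subset) (use False in auto)
qed

lemma bounded_geometry_card_cball:
  assumes "bounded_geometry TYPE('a::metric_space)"
  obtains N :: nat where "1 \<le> N" "\<And>x::'a. card (cball x S) \<le> N"
proof -
  obtain N where N: "\<And>x::'a. card (cball x (max S 1)) \<le> N"
    using assms unfolding bounded_geometry_def by (metis less_max_iff_disj zero_less_one)
  have "card (cball x S) \<le> Suc N" for x :: 'a
  proof -
    have "cball x S \<subseteq> cball x (max S 1)" by auto
    then have "card (cball x S) \<le> card (cball x (max S 1))"
      by (rule card_mono[OF bounded_geometry_finite_cball[OF assms]])
    then show ?thesis using N[of x] by simp
  qed
  then show ?thesis using that[of "Suc N"] by simp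
qed

text \<open>The lattice points under the graph of \<open>M * q\<close>. For nonnegative
  \<open>q\<close> their number is \<open>M\<close> times the sum of \<open>q\<close> up to an error
  of one per point of \<open>T\<close>, so a large \<open>M\<close> turns l1-estimates into
  estimates of cardinalities.\<close>

definition subgraph :: "real \<Rightarrow> 'p set \<Rightarrow> ('p \<Rightarrow> real) \<Rightarrow> ('p \<times> nat) set" where
  "subgraph M T q = (SIGMA p:T. {..<nat \<lfloor>M * q p\<rfloor>})"

lemma Sigma_eq_if_empty_outside:
  assumes "A \<subseteq> B" and "\<And>p. p \<notin> A \<Longrightarrow> C p = {}"
  shows "Sigma A C = Sigma B C"
  using assms by blast

text \<open>The fibre over \<open>p\<close> is the interval between two floors, and rounding
  lengthens it by at most 1.\<close>

lemma card_subgraph_symmetric_difference: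
  fixes q r :: "'p \<Rightarrow> real"
  assumes "finite T" "0 \<le> (M :: real)"
  shows "real (card ((subgraph M T q - subgraph M T r) \<union> (subgraph M T r - subgraph M T q)))
    \<le> M * (\<Sum>p\<in>T. \<bar>q p - r p\<bar>) + card T"
proof -
  let ?n = "\<lambda>u p. nat \<lfloor>M * u p\<rfloor>"
  have eq: "(subgraph M T q - subgraph M T r) \<union> (subgraph M T r - subgraph M T q)
     = (SIGMA p:T. {min (?n q p) (?n r p)..<max (?n q p) (?n r p)})"
    by (auto simp: subgraph_def)
  have "real (max (?n q p) (?n r p) - min (?n q p) (?n r p)) \<le> M * \<bar>q p - r p\<bar> + 1" for p
  proof -
    have "\<bar>M * q p - M * r p\<bar> = M * \<bar>q p - r p\<bar>"
      using assms(2) by (simp add: abs_mult flip: right_diff_distrib)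
    then show ?thesis by linarith
  qed
  then have "real (card (SIGMA p:T. {min (?n q p) (?n r p)..<max (?n q p) (?n r p)}))
      \<le> (\<Sum>p\<in>T. M * \<bar>q p - r p\<bar> + 1)"
    using assms(1) by (subst card_SigmaI) (auto intro!: sum_mono)
  then show ?thesis
    unfolding eq by (simp add: sum.distrib sum_distrib_left)
qed

text \<open>Fibrewise, min(x, y) is at least x - \<bar>x - y\<bar>, and the floor costs at most
  1.\<close>

lemma card_subgraph_Int:
  fixes q r :: "'p \<Rightarrow> real"
  assumes "finite T" "0 \<le> (M :: real)"
  shows "M * (\<Sum>p\<in>T. q p) - M * (\<Sum>p\<in>T. \<bar>q p - r p\<bar>) - card T
    \<le> real (card (subgraph M T q \<inter> subgraph M T r))"
proof -
  let ?n = "\<lambda>u p. nat \<lfloor>M * u p\<rfloor>"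
  have eq: "subgraph M T q \<inter> subgraph M T r = (SIGMA p:T. {..<min (?n q p) (?n r p)})"
    by (auto simp: subgraph_def)
  have "M * q p - M * \<bar>q p - r p\<bar> - 1 \<le> real (min (?n q p) (?n r p))" for p
  proof -
    have "\<bar>M * q p - M * r p\<bar> = M * \<bar>q p - r p\<bar>"
      using assms(2) by (simp add: abs_mult flip: right_diff_distrib)
    then show ?thesis by linarith
  qed
  then have "(\<Sum>p\<in>T. M * q p - M * \<bar>q p - r p\<bar> - 1)
      \<le> real (card (SIGMA p:T. {..<min (?n q p) (?n r p)}))"
    using assms(1) by (subst card_SigmaI) (auto intro!: sum_mono simp flip: of_nat_min)
  then show ?thesis
    unfolding eq by (simp add: sum_subtractf sum_distrib_left)
qed

text \<open>Summing only over centres within \<open>S\<close> of both points has the effect of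
  extending every \<open>\<kappa> x\<close> by zero outside its ball.\<close>

definition kernel_sum :: "real \<Rightarrow> ('a::metric_space \<Rightarrow> 'a \<Rightarrow> 'a \<Rightarrow> real) \<Rightarrow> 'a \<Rightarrow> 'a \<Rightarrow> real" where
  "kernel_sum S \<kappa> y z = (\<Sum>x\<in>cball y S \<inter> cball z S. \<kappa> x y z)"

text \<open>Concatenating Gram vectors of the kernels \<open>\<kappa> x\<close> over all centres
  \<open>x\<close> exhibits the total kernel as a Gram kernel. The coordinates are pairs of a centre
  near \<open>y\<close> and an index below \<open>N\<close>, so the vectors live on the kind of set
  that property A asks for.\<close>

lemma kernel_sum_vectors:
  fixes \<kappa> :: "'a::metric_space \<Rightarrow> 'a \<Rightarrow> 'a \<Rightarrow> real"
  assumes fin: "\<And>x::'a. finite (cball x S)" and N: "\<And>x::'a. card (cball x S) \<le> N"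
    and psd: "\<And>x. psd_on (cball x S) (\<kappa> x)"
  obtains \<xi> :: "'a \<Rightarrow> 'a \<times> nat \<Rightarrow> real"
  where "\<And>y p. p \<notin> cball y S \<times> {..<N} \<Longrightarrow> \<xi> y p = 0"
    and "\<And>y z T. finite T \<Longrightarrow> (cball y S \<inter> cball z S) \<times> {..<N} \<subseteq> T \<Longrightarrow>
      (\<Sum>p\<in>T. \<xi> y p * \<xi> z p) = kernel_sum S \<kappa> y z"
proof -
  have "\<forall>x. \<exists>v :: nat \<Rightarrow> 'a \<Rightarrow> real. \<forall>y\<in>cball x S. \<forall>z\<in>cball x S.
      \<kappa> x y z = (\<Sum>j<card (cball x S). v j y * v j z)"
    using psd_on_sum_of_squares[OF fin psd] by blast
  then obtain v :: "'a \<Rightarrow> nat \<Rightarrow> 'a \<Rightarrow> real" where v: "\<And>x y z. y \<in> cball x S \<Longrightarrow> z \<in> cball x S \<Longrightarrow>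
      \<kappa> x y z = (\<Sum>j<card (cball x S). v x j y * v x j z)"
    by metis
  define \<xi> where "\<xi> y p = (if fst p \<in> cball y S \<and> snd p < card (cball (fst p) S)
      then v (fst p) (snd p) y else 0)" for y and p :: "'a \<times> nat"
  show ?thesis
  proof
    show "\<xi> y p = 0" if "p \<notin> cball y S \<times> {..<N}" for y p
    proof -
      have "fst p \<notin> cball y S \<or> \<not> snd p < N" using that by (cases p) auto
      then show ?thesis using N[of "fst p"] by (auto simp: \<xi>_def)
    qed
  next
    fix y z :: 'a and T :: "('a \<times> nat) set"
    let ?I = "cball y S \<inter> cball z S"
    assume T: "finite T" "?I \<times> {..<N} \<subseteq> T"
    have "(\<Sum>p\<in>T. \<xi> y p * \<xi> z p) = (\<Sum>p\<in>?I \<times> {..<N}. \<xi> y p * \<xi> z p)"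
    proof (rule sum.mono_neutral_right[OF T], intro ballI)
      fix p assume "p \<in> T - ?I \<times> {..<N}"
      then have "fst p \<notin> cball y S \<or> fst p \<notin> cball z S \<or> \<not> snd p < N" by (cases p) auto
      then show "\<xi> y p * \<xi> z p = 0" using N[of "fst p"] by (auto simp: \<xi>_def)
    qed
    also have "\<dots> = (\<Sum>x\<in>?I. \<Sum>j<N. \<xi> y (x, j) * \<xi> z (x, j))"
      by (simp add: sum.cartesian_product)
    also have "\<dots> = (\<Sum>x\<in>?I. \<kappa> x y z)"
    proof (rule sum.cong[OF refl])
      fix x assume x: "x \<in> ?I"
      have "(\<Sum>j<N. \<xi> y (x, j) * \<xi> z (x, j)) = (\<Sum>j<card (cball x S). \<xi> y (x, j) * \<xi> z (x, j))"
        using N[of x] by (intro sum.mono_neutral_right) (auto simp: \<xi>_def)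
      also have "\<dots> = (\<Sum>j<card (cball x S). v x j y * v x j z)"
        using x by (intro sum.cong) (auto simp: \<xi>_def)
      also have "\<dots> = \<kappa> x y z" using x by (intro v[symmetric]) (auto simp: dist_commute)
      finally show "(\<Sum>j<N. \<xi> y (x, j) * \<xi> z (x, j)) = \<kappa> x y z" .
    qed
    finally show "(\<Sum>p\<in>T. \<xi> y p * \<xi> z p) = kernel_sum S \<kappa> y z"
      by (simp add: kernel_sum_def)
  qed
qed

text \<open>Each term factors as \<bar>u - w\<bar> * \<bar>u + w\<bar>. A termwise
  arithmetic-geometric inequality with weight \<open>t\<close> plays the role of Cauchy-Schwarz; its
  two parts contribute \<open>t\<close> and \<open>4 * t\<close>.\<close>

lemma sum_abs_diff_squares_le:
  fixes u w :: "'p \<Rightarrow> real"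
  assumes "0 < t" "t \<le> 1" and "(\<Sum>p\<in>T. (u p - w p)\<^sup>2) \<le> t\<^sup>2" and "(\<Sum>p\<in>T. (u p + w p)\<^sup>2) \<le> 8"
  shows "(\<Sum>p\<in>T. \<bar>(u p)\<^sup>2 - (w p)\<^sup>2\<bar>) \<le> 5 * t"
proof -
  have "\<bar>(u p)\<^sup>2 - (w p)\<^sup>2\<bar> \<le> (u p - w p)\<^sup>2 / t + t * (u p + w p)\<^sup>2 / 2" for p
  proof -
    let ?a = "\<bar>u p - w p\<bar>" and ?b = "\<bar>u p + w p\<bar>"
    have "0 \<le> (?a - t * ?b)\<^sup>2" by simp
    then have "2 * t * (?a * ?b) \<le> ?a\<^sup>2 + t\<^sup>2 * ?b\<^sup>2"
      by (simp only: power2_diff power_mult_distrib) (simp add: mult_ac)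
    then have "?a * ?b \<le> (?a\<^sup>2 + t\<^sup>2 * ?b\<^sup>2) / (2 * t)"
      using assms(1) by (simp add: field_simps)
    also have "\<dots> = ?a\<^sup>2 / (2 * t) + t * ?b\<^sup>2 / 2"
      using assms(1) by (simp add: field_simps power2_eq_square)
    also have "\<dots> \<le> ?a\<^sup>2 / t + t * ?b\<^sup>2 / 2"
      using assms(1) by (simp add: field_simps)
    finally show ?thesis
      by (simp add: power2_eq_square abs_mult algebra_simps flip: abs_mult)
  qed
  then have "(\<Sum>p\<in>T. \<bar>(u p)\<^sup>2 - (w p)\<^sup>2\<bar>) \<le> (\<Sum>p\<in>T. (u p - w p)\<^sup>2 / t + t * (u p + w p)\<^sup>2 / 2)"
    by (rule sum_mono)
  also have "\<dots> = (\<Sum>p\<in>T. (u p - w p)\<^sup>2) / t + t * (\<Sum>p\<in>T. (u p + w p)\<^sup>2) / 2"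
    by (simp add: sum.distrib sum_divide_distrib sum_distrib_left)
  also have "\<dots> \<le> t\<^sup>2 / t + t * 8 / 2"
    using assms by (intro add_mono divide_right_mono mult_left_mono) auto
  also have "\<dots> = 5 * t" using assms(1) by (simp add: power2_eq_square)
  finally show ?thesis .
qed

text \<open>The squared coordinates of the Gram vectors have sum close to 1 and, for points at
  distance at most \<open>R\<close>, are close in l1. The sets \<open>A y\<close> are their
  subgraphs at scale \<open>M\<close>.\<close>

lemma property_A_if_kernels:
  assumes bg: "bounded_geometry TYPE('a::metric_space)"
    and kernels: "\<And>R \<delta>. 0 < R \<Longrightarrow> 0 < \<delta> \<Longrightarrow>
      \<exists>S>0. \<exists>\<kappa> :: 'a \<Rightarrow> 'a \<Rightarrow> 'a \<Rightarrow> real. (\<forall>x. psd_on (cball x S) (\<kappa> x)) \<and>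
        (\<forall>y z. dist y z \<le> R \<longrightarrow> \<bar>kernel_sum S \<kappa> y z - 1\<bar> \<le> \<delta>)"
  shows "property_A TYPE('a)"
  unfolding property_A_def
proof (intro allI impI)
  fix R \<epsilon> :: real
  assume R: "0 < R" and "0 < \<epsilon>"
  define e where "e = min \<epsilon> 1"
  have e: "0 < e" "e \<le> 1" "e \<le> \<epsilon>" using \<open>0 < \<epsilon>\<close> by (auto simp: e_def)
  \<comment> \<open>Let P = N^2 + 1. With the values of \<open>t\<close> and \<open>M\<close>, the
    main term \<open>e * M * (3/4)\<close> is 15 P, the l1 error \<open>M * (5 * t)\<close> is 5/2
    P, and the rounding error is at most 2 N^2. Both errors occur once on each side, and 5 P + 4 N^2
    < 15 P. The choice of \<open>\<delta>\<close> bounds the squared distance of two Gram vectors,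
    built from three inner products with weights 1, 1, -2, by 4 \<delta> = t^2.\<close>
  define t where "t = e / 40"
  have t: "0 < t" "t \<le> 1" using e by (auto simp: t_def)
  define \<delta> where "\<delta> = t\<^sup>2 / 4"
  have \<delta>: "0 < \<delta>" "\<delta> \<le> 1/4" "4 * \<delta> = t\<^sup>2"
    using t power_mono[of t 1 2] by (auto simp: \<delta>_def)
  obtain S \<kappa> where S: "0 < S" and psd: "\<And>x::'a. psd_on (cball x S) (\<kappa> x)"
    and close: "\<And>y z. dist y z \<le> R \<Longrightarrow> \<bar>kernel_sum S \<kappa> y z - 1\<bar> \<le> \<delta>"
    using kernels[OF R \<delta>(1)] by blast
  note fin = bounded_geometry_finite_cball[OF bg]
  obtain N where N: "1 \<le> N" "\<And>x::'a. card (cball x S) \<le> N"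
    using bounded_geometry_card_cball[OF bg] by blast
  obtain \<xi> :: "'a \<Rightarrow> 'a \<times> nat \<Rightarrow> real" where
    \<xi>0: "\<And>y p. p \<notin> cball y S \<times> {..<N} \<Longrightarrow> \<xi> y p = 0" and
    \<xi>: "\<And>y z T. finite T \<Longrightarrow> (cball y S \<inter> cball z S) \<times> {..<N} \<subseteq> T \<Longrightarrow>
      (\<Sum>p\<in>T. \<xi> y p * \<xi> z p) = kernel_sum S \<kappa> y z"
    using kernel_sum_vectors[OF fin N(2) psd] by blast
  define q where "q y p = (\<xi> y p)\<^sup>2" for y p
  define M where "M = 20 * ((real N)\<^sup>2 + 1) / e"
  have M: "0 < M" using e by (simp add: M_def add_nonneg_pos)
  \<comment> \<open>The subgraph carries two natural numbers per centre, the Gram index and the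
    height; they are paired into one, while the centre is kept so that localization can be read
    off.\<close>
  define enc :: "('a \<times> nat) \<times> nat \<Rightarrow> 'a \<times> nat" where
    "enc = (\<lambda>((x, j), i). (x, prod_encode (j, i)))"
  have inj: "inj enc" by (auto simp: inj_def enc_def)
  define A where "A y = enc ` subgraph M (cball y S \<times> {..<N}) (q y)" for y
  \<comment> \<open>Comparing two sets \<open>A y\<close> and \<open>A z\<close> requires a common
    base. Enlarging the base is harmless since \<open>\<xi> y\<close> vanishes outside its
    own.\<close>
  have A_eq: "A y = enc ` subgraph M T (q y)" if "cball y S \<times> {..<N} \<subseteq> T" for y T
  proof -
    have "subgraph M (cball y S \<times> {..<N}) (q y) = subgraph M T (q y)"
      unfolding subgraph_def
    proof (rule Sigma_eq_if_empty_outside[OF that])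
      show "{..<nat \<lfloor>M * q y p\<rfloor>} = {}" if "p \<notin> cball y S \<times> {..<N}" for p
        using \<xi>0[OF that] by (simp add: q_def)
    qed
    then show ?thesis by (simp add: A_def)
  qed
  show "\<exists>S>0. \<exists>A :: 'a \<Rightarrow> ('a \<times> nat) set. (\<forall>x. finite (A x)) \<and>
        (\<forall>y z. dist y z \<le> R \<longrightarrow>
           real (card ((A y - A z) \<union> (A z - A y))) < \<epsilon> * real (card (A y \<inter> A z))) \<and>
        (\<forall>x. A x \<subseteq> cball x S \<times> UNIV)"
  proof (intro exI[of _ S] exI[of _ A] conjI allI impI S)
    show "finite (A x)" for x
      unfolding A_def subgraph_def using fin[of x S] by auto
    show "A x \<subseteq> cball x S \<times> UNIV" for x
      by (auto simp: A_def subgraph_def enc_def)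
    fix y z :: 'a
    assume yz: "dist y z \<le> R"
    define T where "T = (cball y S \<union> cball z S) \<times> {..<N}"
    have T: "finite T" using fin by (simp add: T_def)
    have Ay: "A y = enc ` subgraph M T (q y)" and Az: "A z = enc ` subgraph M T (q z)"
      by (rule A_eq; auto simp: T_def)+
    have "card (cball y S \<union> cball z S) \<le> N + N"
      by (rule order.trans[OF card_Un_le]) (intro add_mono N)
    then have "card T \<le> (N + N) * N"
      by (simp add: T_def card_cartesian_product)
    then have "real (card T) \<le> real ((N + N) * N)" by (simp only: of_nat_le_iff)
    then have cT: "real (card T) \<le> 2 * (real N)\<^sup>2" by (simp add: power2_eq_square algebra_simps)
    have yy: "\<bar>(\<Sum>p\<in>T. (\<xi> y p)\<^sup>2) - 1\<bar> \<le> \<delta>"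
    proof -
      have "(\<Sum>p\<in>T. \<xi> y p * \<xi> y p) = kernel_sum S \<kappa> y y"
        by (rule \<xi>[OF T]) (auto simp: T_def)
      then show ?thesis using close[of y y] R by (simp add: power2_eq_square)
    qed
    have zz: "\<bar>(\<Sum>p\<in>T. (\<xi> z p)\<^sup>2) - 1\<bar> \<le> \<delta>"
    proof -
      have "(\<Sum>p\<in>T. \<xi> z p * \<xi> z p) = kernel_sum S \<kappa> z z"
        by (rule \<xi>[OF T]) (auto simp: T_def)
      then show ?thesis using close[of z z] R by (simp add: power2_eq_square)
    qed
    have "(\<Sum>p\<in>T. \<xi> y p * \<xi> z p) = kernel_sum S \<kappa> y z"
      by (rule \<xi>[OF T]) (auto simp: T_def)
    then have yz': "\<bar>(\<Sum>p\<in>T. \<xi> y p * \<xi> z p) - 1\<bar> \<le> \<delta>"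
      using close[OF yz] by simp
    have "(\<Sum>p\<in>T. (\<xi> y p - \<xi> z p)\<^sup>2)
        = (\<Sum>p\<in>T. (\<xi> y p)\<^sup>2) + (\<Sum>p\<in>T. (\<xi> z p)\<^sup>2) - 2 * (\<Sum>p\<in>T. \<xi> y p * \<xi> z p)"
      by (simp add: power2_diff sum.distrib sum_subtractf sum_distrib_left mult.assoc)
    then have 1: "(\<Sum>p\<in>T. (\<xi> y p - \<xi> z p)\<^sup>2) \<le> t\<^sup>2" using yy zz yz' \<delta>(3) by linarith
    have "(\<Sum>p\<in>T. (\<xi> y p + \<xi> z p)\<^sup>2)
        = (\<Sum>p\<in>T. (\<xi> y p)\<^sup>2) + (\<Sum>p\<in>T. (\<xi> z p)\<^sup>2) + 2 * (\<Sum>p\<in>T. \<xi> y p * \<xi> z p)"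
      by (simp add: power2_sum sum.distrib sum_distrib_left mult.assoc)
    then have 2: "(\<Sum>p\<in>T. (\<xi> y p + \<xi> z p)\<^sup>2) \<le> 8" using yy zz yz' \<delta>(2) by linarith
    have L1: "(\<Sum>p\<in>T. \<bar>q y p - q z p\<bar>) \<le> 5 * t"
      unfolding q_def by (rule sum_abs_diff_squares_le[OF t 1 2])
    have qy: "3/4 \<le> (\<Sum>p\<in>T. q y p)" using yy \<delta>(2) unfolding q_def by linarith
    have "real (card ((A y - A z) \<union> (A z - A y)))
        = real (card ((subgraph M T (q y) - subgraph M T (q z)) \<union> (subgraph M T (q z) - subgraph M T (q y))))"
      unfolding Ay Az image_set_diff[OF inj, symmetric] image_Un[symmetric]
      using inj by (subst card_image) (auto intro: inj_on_subset)
    also have "\<dots> \<le> M * (\<Sum>p\<in>T. \<bar>q y p - q z p\<bar>) + card T"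
      using M by (intro card_subgraph_symmetric_difference T) simp
    also have "\<dots> \<le> M * (5 * t) + 2 * (real N)\<^sup>2"
      using L1 cT M by (intro add_mono mult_left_mono) auto
    also have "\<dots> < e * (M * (3/4) - M * (5 * t) - 2 * (real N)\<^sup>2)"
    proof -
      \<comment> \<open>The products are abstracted into variables, which makes the comparison
        linear.\<close>
      have arith: "X + 2 * Z < Y * (3/4) - V - 2 * W"
        if "X = 20 * (Z + 1) / 8" "Y = 20 * (Z + 1)" "V \<le> X" "W \<le> Z" "0 \<le> Z" for X Y V W Z :: real
        using that by argo
      have "M * (5 * t) + 2 * (real N)\<^sup>2
          < (M * e) * (3/4) - e * (M * (5 * t)) - 2 * (e * (real N)\<^sup>2)"
      proof (rule arith)
        show "M * (5 * t) = 20 * ((real N)\<^sup>2 + 1) / 8" "M * e = 20 * ((real N)\<^sup>2 + 1)"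
          using e by (simp_all add: M_def t_def)
        show "e * (M * (5 * t)) \<le> M * (5 * t)" "e * (real N)\<^sup>2 \<le> (real N)\<^sup>2"
          using e M t by (simp_all add: mult_left_le_one_le)
      qed simp
      also have "\<dots> = e * (M * (3/4) - M * (5 * t) - 2 * (real N)\<^sup>2)"
        by (simp add: algebra_simps)
      finally show ?thesis .
    qed
    also have "\<dots> \<le> e * (M * (\<Sum>p\<in>T. q y p) - M * (\<Sum>p\<in>T. \<bar>q y p - q z p\<bar>) - card T)"
      using L1 cT M qy e by (intro mult_left_mono diff_mono) auto
    also have "\<dots> \<le> e * real (card (subgraph M T (q y) \<inter> subgraph M T (q z)))"
      using card_subgraph_Int[OF T, of M "q y" "q z"] M e by (intro mult_left_mono) auto
    also have "\<dots> = e * real (card (A y \<inter> A z))"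
      unfolding Ay Az image_Int[OF inj, symmetric]
      using inj by (subst card_image) (auto intro: inj_on_subset)
    also have "\<dots> \<le> \<epsilon> * real (card (A y \<inter> A z))"
      using e by (intro mult_right_mono) auto
    finally show "real (card ((A y - A z) \<union> (A z - A y))) < \<epsilon> * real (card (A y \<inter> A z))" .
  qed
qed

section \<open>Square-integrable functions on a discrete space\<close>

text \<open>Finite balls make every singleton open, so every set is open and measurability questions
  disappear.\<close>

lemma bounded_geometry_sets_borel:
  assumes "bounded_geometry TYPE('a::metric_space)"
  shows "sets (borel :: 'a measure) = UNIV"
proof -
  have open_singleton: "open {x}" for x :: 'a
  proof -
    have "finite (ball x 1 - {x})"
      by (rule finite_subset[OF _ bounded_geometry_finite_cball[OF assms, of x 1]]) auto
    then have "open (ball x 1 - (ball x 1 - {x}))"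
      by (intro open_Diff finite_imp_closed) auto
    moreover have "ball x 1 - (ball x 1 - {x}) = {x}" by auto
    ultimately show ?thesis by simp
  qed
  have "A \<in> sets borel" for A :: "'a set"
  proof -
    have "open (\<Union>x\<in>A. {x})" using open_singleton by blast
    then show ?thesis by simp
  qed
  then show ?thesis by blast
qed

lemma bounded_geometry_countable:
  assumes "bounded_geometry TYPE('a::metric_space)"
  shows "countable (UNIV :: 'a set)"
proof -
  fix x :: 'a
  have "(UNIV :: 'a set) = (\<Union>n. cball x (real n))"
  proof -
    have "\<exists>n. y \<in> cball x (real n)" for y :: 'a
      using real_arch_simple[of "dist x y"] by auto
    then show ?thesis by blast
  qed
  also have "countable \<dots>"
    using bounded_geometry_finite_cball[OF assms] by (intro countable_UN) (auto intro: countable_finite)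
  finally show ?thesis .
qed

text \<open>What a locally finite Borel measure on a space of bounded geometry amounts to: local
  finiteness survives as finiteness of the point masses.\<close>

locale discrete_measure =
  fixes \<nu> :: "'a::metric_space measure"
  assumes countable: "countable (UNIV :: 'a set)"
    and sets_eq: "sets \<nu> = UNIV"
    and finite_singleton: "emeasure \<nu> {x} < \<infinity>"
begin

lemma space_eq [simp]: "space \<nu> = UNIV"
  using sets.sets_into_space[of UNIV \<nu>] by (auto simp: sets_eq)

lemma in_sets [simp, measurable]: "A \<in> sets \<nu>"
  by (simp add: sets_eq)

lemma borel_measurable_all [simp, measurable]: "f \<in> borel_measurable \<nu>"
  by (rule measurableI) auto

text \<open>The non-atoms form a countable union of null singletons. Identities that hold only
  almost everywhere thereby become pointwise identities at the atoms.\<close>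

lemma AE_iff_atoms: "(AE x in \<nu>. P x) \<longleftrightarrow> (\<forall>x\<in>atoms \<nu>. P x)"
proof
  assume "AE x in \<nu>. P x"
  then have null: "{x. \<not> P x} \<in> null_sets \<nu>"
    by (simp add: AE_iff_null)
  show "\<forall>x\<in>atoms \<nu>. P x"
  proof (rule ballI, rule ccontr)
    fix x assume "x \<in> atoms \<nu>" "\<not> P x"
    then have "emeasure \<nu> {x} \<le> emeasure \<nu> {x. \<not> P x}"
      by (intro emeasure_mono) auto
    then show False using null \<open>x \<in> atoms \<nu>\<close> by (auto simp: atoms_def)
  qed
next
  assume P: "\<forall>x\<in>atoms \<nu>. P x"
  have "(\<Union>x\<in>{x. \<not> P x}. {x}) \<in> null_sets \<nu>"
  proof (rule null_sets_UN')
    show "countable {x. \<not> P x}" using countable by (rule countable_subset[rotated]) auto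
    show "{x} \<in> null_sets \<nu>" if "x \<in> {x. \<not> P x}" for x
      using that P by (auto simp: atoms_def null_sets_def not_gr_zero)
  qed
  then show "AE x in \<nu>. P x"
    by (rule AE_I') auto
qed

lemma atom_measure_pos: "x \<in> atoms \<nu> \<Longrightarrow> 0 < measure \<nu> {x}"
  using finite_singleton[of x] by (auto simp: atoms_def measure_def enn2real_positive_iff)

lemma L2_fun_iff: "\<zeta> \<in> L2_fun \<nu> \<longleftrightarrow> integrable \<nu> (\<lambda>x. (norm (\<zeta> x))\<^sup>2)"
  by (simp add: L2_fun_def)

lemma L2_norm_nonneg [simp]: "0 \<le> L2_norm \<nu> \<zeta>"
  by (simp add: L2_norm_def)

lemma L2_norm_power2: "(L2_norm \<nu> \<zeta>)\<^sup>2 = (\<integral>x. (norm (\<zeta> x))\<^sup>2 \<partial>\<nu>)"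
  by (simp add: L2_norm_def)

lemma L2_norm_cong:
  assumes "\<And>x. x \<in> atoms \<nu> \<Longrightarrow> \<zeta> x = \<xi> x"
  shows "L2_norm \<nu> \<zeta> = L2_norm \<nu> \<xi>"
  unfolding L2_norm_def
  by (rule arg_cong[where f = sqrt], rule integral_cong_AE) (auto simp: AE_iff_atoms assms)

lemma finite_support_L2:
  fixes \<zeta> :: "'a \<Rightarrow> 'h::complex_hilbert_space"
  assumes "finite G" and "\<And>x. x \<in> atoms \<nu> \<Longrightarrow> x \<notin> G \<Longrightarrow> \<zeta> x = 0"
  shows "\<zeta> \<in> L2_fun \<nu>"
    and "(L2_norm \<nu> \<zeta>)\<^sup>2 = (\<Sum>x\<in>G. measure \<nu> {x} * (norm (\<zeta> x))\<^sup>2)"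
proof -
  have int1: "integrable \<nu> (\<lambda>x. (norm (\<zeta> g))\<^sup>2 * indicator {g} x)" for g
    using finite_singleton by (intro integrable_mult_right integrable_real_indicator) auto
  have ae: "AE x in \<nu>. (norm (\<zeta> x))\<^sup>2 = (\<Sum>g\<in>G. (norm (\<zeta> g))\<^sup>2 * indicator {g} x)"
    unfolding AE_iff_atoms
  proof
    fix x assume x: "x \<in> atoms \<nu>"
    have "(\<Sum>g\<in>G. (norm (\<zeta> g))\<^sup>2 * indicator {g} x) = (\<Sum>g\<in>G. if g = x then (norm (\<zeta> x))\<^sup>2 else 0)"
      by (intro sum.cong) (auto simp: indicator_def)
    then show "(norm (\<zeta> x))\<^sup>2 = (\<Sum>g\<in>G. (norm (\<zeta> g))\<^sup>2 * indicator {g} x)"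
      using assms x by simp
  qed
  have "integrable \<nu> (\<lambda>x. \<Sum>g\<in>G. (norm (\<zeta> g))\<^sup>2 * indicator {g} x)"
    by (intro Bochner_Integration.integrable_sum int1)
  then show "\<zeta> \<in> L2_fun \<nu>"
    unfolding L2_fun_iff using ae by (subst integrable_cong_AE) auto
  have "(L2_norm \<nu> \<zeta>)\<^sup>2 = (\<integral>x. (\<Sum>g\<in>G. (norm (\<zeta> g))\<^sup>2 * indicator {g} x) \<partial>\<nu>)"
    unfolding L2_norm_power2 using ae by (intro integral_cong_AE) auto
  also have "\<dots> = (\<Sum>g\<in>G. \<integral>x. (norm (\<zeta> g))\<^sup>2 * indicator {g} x \<partial>\<nu>)"
    by (intro Bochner_Integration.integral_sum int1)
  also have "\<dots> = (\<Sum>x\<in>G. measure \<nu> {x} * (norm (\<zeta> x))\<^sup>2)"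
    by (intro sum.cong refl) (simp add: mult.commute)
  finally show "(L2_norm \<nu> \<zeta>)\<^sup>2 = (\<Sum>x\<in>G. measure \<nu> {x} * (norm (\<zeta> x))\<^sup>2)" .
qed

lemma norm_add_power2_le:
  fixes u v :: "'h::real_inner"
  shows "(norm (u + v))\<^sup>2 \<le> 2 * (norm u)\<^sup>2 + 2 * (norm v)\<^sup>2"
proof -
  have "(norm (u + v))\<^sup>2 \<le> (norm u + norm v)\<^sup>2"
    by (intro power_mono norm_triangle_ineq) auto
  also have "\<dots> \<le> 2 * (norm u)\<^sup>2 + 2 * (norm v)\<^sup>2"
    using sum_squares_bound[of "norm u" "norm v"] by (simp add: power2_sum)
  finally show ?thesis .
qed

text \<open>The factor 2 is cruder than the triangle inequality, but it comes directly from a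
  pointwise bound, and the constants chosen later leave room for it.\<close>

lemma L2_fun_add:
  fixes \<zeta> \<xi> :: "'a \<Rightarrow> 'h::complex_hilbert_space"
  assumes "\<zeta> \<in> L2_fun \<nu>" "\<xi> \<in> L2_fun \<nu>"
  shows "(\<lambda>x. \<zeta> x + \<xi> x) \<in> L2_fun \<nu>"
    and "(L2_norm \<nu> (\<lambda>x. \<zeta> x + \<xi> x))\<^sup>2 \<le> 2 * (L2_norm \<nu> \<zeta>)\<^sup>2 + 2 * (L2_norm \<nu> \<xi>)\<^sup>2"
proof -
  have int: "integrable \<nu> (\<lambda>x. 2 * (norm (\<zeta> x))\<^sup>2 + 2 * (norm (\<xi> x))\<^sup>2)"
    using assms by (simp add: L2_fun_iff)
  then have int': "integrable \<nu> (\<lambda>x. (norm (\<zeta> x + \<xi> x))\<^sup>2)"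
    by (rule Bochner_Integration.integrable_bound)
      (auto intro!: AE_I2 norm_add_power2_le)
  then show "(\<lambda>x. \<zeta> x + \<xi> x) \<in> L2_fun \<nu>" by (simp add: L2_fun_iff)
  have "(L2_norm \<nu> (\<lambda>x. \<zeta> x + \<xi> x))\<^sup>2 \<le> (\<integral>x. 2 * (norm (\<zeta> x))\<^sup>2 + 2 * (norm (\<xi> x))\<^sup>2 \<partial>\<nu>)"
    unfolding L2_norm_power2 by (rule integral_mono[OF int' int]) (rule norm_add_power2_le)
  also have "\<dots> = 2 * (L2_norm \<nu> \<zeta>)\<^sup>2 + 2 * (L2_norm \<nu> \<xi>)\<^sup>2"
    unfolding L2_norm_power2 using assms by (subst Bochner_Integration.integral_add) (auto simp: L2_fun_iff)
  finally show "(L2_norm \<nu> (\<lambda>x. \<zeta> x + \<xi> x))\<^sup>2 \<le> 2 * (L2_norm \<nu> \<zeta>)\<^sup>2 + 2 * (L2_norm \<nu> \<xi>)\<^sup>2" .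
qed

lemma L2_norm_scaleR: "L2_norm \<nu> (\<lambda>x. r *\<^sub>R \<zeta> x) = \<bar>r\<bar> * L2_norm \<nu> \<zeta>"
  by (simp add: L2_norm_def power_mult_distrib real_sqrt_mult)

definition restrict0 :: "'a set \<Rightarrow> ('a \<Rightarrow> 'h::zero) \<Rightarrow> 'a \<Rightarrow> 'h" where
  "restrict0 B \<zeta> x = (if x \<in> B then \<zeta> x else 0)"

lemma L2_fun_restrict0:
  fixes \<zeta> :: "'a \<Rightarrow> 'h::complex_hilbert_space"
  assumes "\<zeta> \<in> L2_fun \<nu>"
  shows "restrict0 B \<zeta> \<in> L2_fun \<nu>"
  using assms unfolding L2_fun_iff
  by (rule Bochner_Integration.integrable_bound) (auto simp: restrict0_def)

lemma L2_norm_restrict0_le: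
  fixes \<zeta> :: "'a \<Rightarrow> 'h::complex_hilbert_space"
  assumes "\<zeta> \<in> L2_fun \<nu>"
  shows "L2_norm \<nu> (restrict0 B \<zeta>) \<le> L2_norm \<nu> \<zeta>"
  unfolding L2_norm_def
  using assms L2_fun_restrict0[OF assms, of B]
  by (intro real_sqrt_le_mono integral_mono) (auto simp: L2_fun_iff restrict0_def)

text \<open>Dominated convergence along the balls of integer radius about \<open>x0\<close>, which
  are finite and exhaust the space.\<close>

lemma L2_norm_tail_small:
  fixes \<zeta> :: "'a \<Rightarrow> 'h::complex_hilbert_space"
  assumes fin: "\<And>S. finite (cball x0 S :: 'a set)" and \<zeta>: "\<zeta> \<in> L2_fun \<nu>" and "0 < e"
  obtains B where "finite B" "L2_norm \<nu> (restrict0 (- B) \<zeta>) < e"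
proof -
  let ?B = "\<lambda>n. cball x0 (real n)"
  have "(\<lambda>n. \<integral>x. (norm (restrict0 (- ?B n) \<zeta> x))\<^sup>2 \<partial>\<nu>) \<longlonglongrightarrow> (\<integral>x. 0 \<partial>\<nu>)"
  proof (rule integral_dominated_convergence[where w = "\<lambda>x. (norm (\<zeta> x))\<^sup>2"])
    show "integrable \<nu> (\<lambda>x. (norm (\<zeta> x))\<^sup>2)" using \<zeta> by (simp add: L2_fun_iff)
    show "AE x in \<nu>. norm ((norm (restrict0 (- ?B n) \<zeta> x))\<^sup>2) \<le> (norm (\<zeta> x))\<^sup>2" for n
      by (auto simp: restrict0_def)
    show "AE x in \<nu>. (\<lambda>n. (norm (restrict0 (- ?B n) \<zeta> x))\<^sup>2) \<longlonglongrightarrow> 0"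
    proof (rule AE_I2)
      fix x
      have "\<forall>\<^sub>F n in sequentially. dist x0 x \<le> real n"
        using real_arch_simple eventually_sequentiallyI
        by (metis dual_order.trans of_nat_le_iff)
      then have "\<forall>\<^sub>F n in sequentially. (norm (restrict0 (- ?B n) \<zeta> x))\<^sup>2 = 0"
        by eventually_elim (simp add: restrict0_def)
      then show "(\<lambda>n. (norm (restrict0 (- ?B n) \<zeta> x))\<^sup>2) \<longlonglongrightarrow> 0"
        by (rule tendsto_eventually)
    qed
  qed auto
  then have "(\<lambda>n. L2_norm \<nu> (restrict0 (- ?B n) \<zeta>)) \<longlonglongrightarrow> 0"
    unfolding L2_norm_def using tendsto_real_sqrt by fastforce
  then have "\<forall>\<^sub>F n in sequentially. L2_norm \<nu> (restrict0 (- ?B n) \<zeta>) < e"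
    using \<open>0 < e\<close> by (rule order_tendstoD)
  then obtain n where "L2_norm \<nu> (restrict0 (- ?B n) \<zeta>) < e"
    using eventually_happens trivial_limit_sequentially by blast
  then show ?thesis using that[of "?B n"] fin by auto
qed

end

section \<open>Bounded operators and their matrix entries\<close>

context discrete_measure
begin

lemma L2_operator_norm_bdd:
  assumes "L2_bounded_operator \<nu> (a :: ('a \<Rightarrow> 'h::complex_hilbert_space) \<Rightarrow> 'a \<Rightarrow> 'h)"
  shows "bdd_above ((\<lambda>\<zeta>. L2_norm \<nu> (a \<zeta>)) ` {\<zeta> \<in> L2_fun \<nu>. L2_norm \<nu> \<zeta> \<le> 1})"
proof -
  obtain C where C: "\<And>\<zeta>. \<zeta> \<in> L2_fun \<nu> \<Longrightarrow> L2_norm \<nu> (a \<zeta>) \<le> C * L2_norm \<nu> \<zeta>"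
    using assms unfolding L2_bounded_operator_def by blast
  have "L2_norm \<nu> (a \<zeta>) \<le> \<bar>C\<bar>" if "\<zeta> \<in> L2_fun \<nu>" "L2_norm \<nu> \<zeta> \<le> 1" for \<zeta>
  proof -
    have "C * L2_norm \<nu> \<zeta> \<le> \<bar>C\<bar> * 1" using that by (intro mult_mono) auto
    then show ?thesis using C[OF that(1)] by linarith
  qed
  then show ?thesis by (intro bdd_aboveI[where M = "\<bar>C\<bar>"]) auto
qed

lemma zero_in_L2_fun: "(\<lambda>x. 0) \<in> L2_fun \<nu>"
  by (simp add: L2_fun_iff)

lemma L2_operator_norm_nonneg:
  assumes "L2_bounded_operator \<nu> (a :: ('a \<Rightarrow> 'h::complex_hilbert_space) \<Rightarrow> 'a \<Rightarrow> 'h)"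
  shows "0 \<le> L2_operator_norm \<nu> a"
  unfolding L2_operator_norm_def
  by (rule cSUP_upper2[OF L2_operator_norm_bdd[OF assms], of "\<lambda>x. 0"])
    (auto simp: zero_in_L2_fun L2_norm_def)

lemma L2_op_scaleR:
  assumes a: "L2_bounded_operator \<nu> (a :: ('a \<Rightarrow> 'h::complex_hilbert_space) \<Rightarrow> 'a \<Rightarrow> 'h)"
    and "\<zeta> \<in> L2_fun \<nu>" "y \<in> atoms \<nu>"
  shows "a (\<lambda>x. r *\<^sub>R \<zeta> x) y = r *\<^sub>R a \<zeta> y"
proof -
  have "AE x in \<nu>. a (\<lambda>x. complex_of_real r *\<^sub>C \<zeta> x) x = complex_of_real r *\<^sub>C a \<zeta> x"
    using a assms(2) unfolding L2_bounded_operator_def by blast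
  then show ?thesis using assms(3) by (simp add: AE_iff_atoms scaleC_of_real)
qed

lemma L2_norm_op_le:
  assumes a: "L2_bounded_operator \<nu> (a :: ('a \<Rightarrow> 'h::complex_hilbert_space) \<Rightarrow> 'a \<Rightarrow> 'h)"
    and \<zeta>: "\<zeta> \<in> L2_fun \<nu>"
  shows "L2_norm \<nu> (a \<zeta>) \<le> L2_operator_norm \<nu> a * L2_norm \<nu> \<zeta>"
proof (cases "L2_norm \<nu> \<zeta> = 0")
  case True
  \<comment> \<open>A null vector cannot be normalised; here the boundedness constant shows directly
    that its image is null.\<close>
  obtain C where "L2_norm \<nu> (a \<zeta>) \<le> C * L2_norm \<nu> \<zeta>"
    using assms unfolding L2_bounded_operator_def by blast
  then show ?thesis using True by simp
next
  case False
  define r where "r = L2_norm \<nu> \<zeta>"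
  have r: "0 < r" using False L2_norm_nonneg[of \<zeta>] by (simp add: r_def less_le)
  let ?\<xi> = "\<lambda>x. (1 / r) *\<^sub>R \<zeta> x"
  have \<xi>: "?\<xi> \<in> L2_fun \<nu>" using \<zeta> by (simp add: L2_fun_iff power_divide)
  have "L2_norm \<nu> ?\<xi> \<le> 1" using r unfolding L2_norm_scaleR by (simp add: r_def)
  then have "L2_norm \<nu> (a ?\<xi>) \<le> L2_operator_norm \<nu> a"
    unfolding L2_operator_norm_def using \<xi> by (intro cSUP_upper L2_operator_norm_bdd[OF a]) auto
  also have "L2_norm \<nu> (a ?\<xi>) = L2_norm \<nu> (\<lambda>x. (1 / r) *\<^sub>R a \<zeta> x)"
    by (rule L2_norm_cong) (rule L2_op_scaleR[OF a \<zeta>])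
  also have "\<dots> = L2_norm \<nu> (a \<zeta>) / r" using r unfolding L2_norm_scaleR by simp
  finally show ?thesis using r by (simp add: r_def field_simps)
qed

lemma L2_operator_norm_attained_approx:
  assumes a: "L2_bounded_operator \<nu> (a :: ('a \<Rightarrow> 'h::complex_hilbert_space) \<Rightarrow> 'a \<Rightarrow> 'h)"
    and "b < L2_operator_norm \<nu> a"
  obtains \<zeta> where "\<zeta> \<in> L2_fun \<nu>" "L2_norm \<nu> \<zeta> \<le> 1" "b < L2_norm \<nu> (a \<zeta>)"
proof -
  have "{\<zeta> \<in> L2_fun \<nu>. L2_norm \<nu> \<zeta> \<le> 1} \<noteq> ({} :: ('a \<Rightarrow> 'h) set)"
    using zero_in_L2_fun by (auto simp: L2_norm_def intro!: exI[of _ "\<lambda>x. 0"])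
  then show ?thesis
    using assms(2) less_cSUP_iff[OF _ L2_operator_norm_bdd[OF a], of b] that
    unfolding L2_operator_norm_def by auto
qed

lemma L2_op_add:
  assumes "L2_bounded_operator \<nu> (a :: ('a \<Rightarrow> 'h::complex_hilbert_space) \<Rightarrow> 'a \<Rightarrow> 'h)"
    and "\<zeta> \<in> L2_fun \<nu>" "\<xi> \<in> L2_fun \<nu>" "y \<in> atoms \<nu>"
  shows "a (\<lambda>x. \<zeta> x + \<xi> x) y = a \<zeta> y + a \<xi> y"
proof -
  have "AE x in \<nu>. a (\<lambda>x. \<zeta> x + \<xi> x) x = a \<zeta> x + a \<xi> x"
    using assms(1-3) unfolding L2_bounded_operator_def by blast
  then show ?thesis using assms(4) by (simp add: AE_iff_atoms)
qed

lemma op_sum: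
  assumes a: "L2_bounded_operator \<nu> (a :: ('a \<Rightarrow> 'h::complex_hilbert_space) \<Rightarrow> 'a \<Rightarrow> 'h)"
    and "finite E" "\<And>z. z \<in> E \<Longrightarrow> F z \<in> L2_fun \<nu>" and y: "y \<in> atoms \<nu>"
  shows "(\<lambda>x. \<Sum>z\<in>E. F z x) \<in> L2_fun \<nu> \<and> a (\<lambda>x. \<Sum>z\<in>E. F z x) y = (\<Sum>z\<in>E. a (F z) y)"
  using assms(2,3)
proof (induction E rule: finite_induct)
  case empty
  show ?case using L2_op_scaleR[OF a zero_in_L2_fun y, of 0] zero_in_L2_fun by simp
next
  case (insert w E)
  have w: "F w \<in> L2_fun \<nu>" and E: "(\<lambda>x. \<Sum>z\<in>E. F z x) \<in> L2_fun \<nu>" using insert by auto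
  have "a (\<lambda>x. F w x + (\<Sum>z\<in>E. F z x)) y = a (F w) y + a (\<lambda>x. \<Sum>z\<in>E. F z x) y"
    by (rule L2_op_add[OF a w E y])
  then show ?case using insert y L2_fun_add(1)[OF w E] by simp
qed

lemma op_finite_support:
  assumes a: "L2_bounded_operator \<nu> (a :: ('a \<Rightarrow> 'h::complex_hilbert_space) \<Rightarrow> 'a \<Rightarrow> 'h)"
    and "finite E" "\<And>x. x \<notin> E \<Longrightarrow> \<zeta> x = 0" and y: "y \<in> atoms \<nu>"
  shows "a \<zeta> y = (\<Sum>z\<in>E. matrix_entry a y z (\<zeta> z))"
proof -
  have "\<zeta> = (\<lambda>x. \<Sum>z\<in>E. if x = z then \<zeta> z else 0)"
    using assms(2,3) by (auto simp: fun_eq_iff)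
  then have "a \<zeta> y = a (\<lambda>x. \<Sum>z\<in>E. if x = z then \<zeta> z else 0) y" by simp
  also have "\<dots> = (\<Sum>z\<in>E. matrix_entry a y z (\<zeta> z))"
    unfolding matrix_entry_def
  proof (rule op_sum[OF a \<open>finite E\<close> _ y, THEN conjunct2])
    show "(\<lambda>x. if x = z then \<zeta> z else 0) \<in> L2_fun \<nu>" for z
      by (rule finite_support_L2(1)[of "{z}"]) auto
  qed
  finally show ?thesis .
qed

lemma matrix_entry_scaleR:
  assumes a: "L2_bounded_operator \<nu> (a :: ('a \<Rightarrow> 'h::complex_hilbert_space) \<Rightarrow> 'a \<Rightarrow> 'h)"
    and "y \<in> atoms \<nu>"
  shows "matrix_entry a y z (r *\<^sub>R h) = r *\<^sub>R matrix_entry a y z h"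
proof -
  have "(\<lambda>x. if x = z then r *\<^sub>R h else 0) = (\<lambda>x. r *\<^sub>R (if x = z then h else 0))" by auto
  moreover have "(\<lambda>x. if x = z then h else 0) \<in> L2_fun \<nu>"
    by (rule finite_support_L2(1)[of "{z}"]) auto
  ultimately show ?thesis
    unfolding matrix_entry_def using L2_op_scaleR[OF a _ assms(2)] by metis
qed

text \<open>The square roots of the masses are the norms of the point masses: at atoms this is the
  bound of an entry by the operator norm, taken in the orthonormalised system. In this form it holds
  also for points of mass zero.\<close>

lemma norm_matrix_entry_le:
  assumes a: "L2_bounded_operator \<nu> (a :: ('a \<Rightarrow> 'h::complex_hilbert_space) \<Rightarrow> 'a \<Rightarrow> 'h)"
  shows "sqrt (measure \<nu> {y}) * norm (matrix_entry a y z h)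
    \<le> L2_operator_norm \<nu> a * (sqrt (measure \<nu> {z}) * norm h)"
proof -
  let ?\<zeta> = "\<lambda>x. if x = z then h else 0"
  have \<zeta>: "?\<zeta> \<in> L2_fun \<nu>" "(L2_norm \<nu> ?\<zeta>)\<^sup>2 = measure \<nu> {z} * (norm h)\<^sup>2"
    using finite_support_L2[of "{z}" ?\<zeta>] by auto
  have a\<zeta>: "a ?\<zeta> \<in> L2_fun \<nu>" using a \<zeta>(1) unfolding L2_bounded_operator_def by blast
  have "(L2_norm \<nu> (restrict0 {y} (a ?\<zeta>)))\<^sup>2 = measure \<nu> {y} * (norm (matrix_entry a y z h))\<^sup>2"
    using finite_support_L2(2)[of "{y}" "restrict0 {y} (a ?\<zeta>)"] by (simp add: restrict0_def matrix_entry_def)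
  then have "sqrt (measure \<nu> {y}) * norm (matrix_entry a y z h) = L2_norm \<nu> (restrict0 {y} (a ?\<zeta>))"
    using real_sqrt_unique L2_norm_nonneg by (metis norm_ge_zero real_sqrt_abs real_sqrt_mult abs_of_nonneg)
  also have "\<dots> \<le> L2_norm \<nu> (a ?\<zeta>)" by (rule L2_norm_restrict0_le[OF a\<zeta>])
  also have "\<dots> \<le> L2_operator_norm \<nu> a * L2_norm \<nu> ?\<zeta>" by (rule L2_norm_op_le[OF a \<zeta>(1)])
  also have "L2_norm \<nu> ?\<zeta> = sqrt (measure \<nu> {z}) * norm h"
    using \<zeta>(2) by (metis L2_norm_nonneg norm_ge_zero real_sqrt_abs real_sqrt_mult abs_of_nonneg)
  finally show ?thesis .
qed

end

lemma matrix_entry_nonzero_dist_le: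
  fixes \<nu> :: "'a::metric_space measure" and a :: "('a::metric_space \<Rightarrow> 'h::complex_hilbert_space) \<Rightarrow> 'a::metric_space \<Rightarrow> 'h::complex_hilbert_space"
  assumes "propagation \<nu> a \<le> of_nat R" "y \<in> atoms \<nu>" "z \<in> atoms \<nu>" "matrix_entry a y z h \<noteq> 0"
  shows "dist y z \<le> real R"
proof -
  have "ennreal (dist y z) \<le> propagation \<nu> a"
    unfolding propagation_def using assms by (intro SUP_upper2[of "(y, z)"]) auto
  also have "\<dots> \<le> ennreal (real R)" using assms(1) by (simp add: ennreal_of_nat_eq_real_of_nat)
  finally show ?thesis by simp
qed

section \<open>Property A implies norm localization\<close>

text \<open>The functions w \<mapsto> \<phi> w y are normalised indicators of \<open>A y\<close>.
  Their squared distance is 2 minus twice \<bar>A y \<inter> A z\<bar> / sqrt(\<bar>A y\<bar>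
  \<bar>A z\<bar>), and each cardinality is at most (1 + \<eta>/2) times that of the intersection.
  Sums run over any finite \<open>W\<close> large enough to contain the supports.\<close>

lemma property_A_unit_vectors:
  fixes R \<eta> :: real
  assumes "property_A TYPE('a::metric_space)" and "0 < R" "0 < \<eta>"
  obtains S and A :: "'a::metric_space \<Rightarrow> ('a \<times> nat) set" and \<phi> :: "'a \<times> nat \<Rightarrow> 'a \<Rightarrow> real"
  where "0 < S" "\<And>y. finite (A y)"
    and "\<And>w y. \<phi> w y \<noteq> 0 \<Longrightarrow> dist (fst w) y \<le> S"
    and "\<And>W y. finite W \<Longrightarrow> A y \<subseteq> W \<Longrightarrow> (\<Sum>w\<in>W. (\<phi> w y)\<^sup>2) = 1"
    and "\<And>W y z. finite W \<Longrightarrow> A y \<subseteq> W \<Longrightarrow> A z \<subseteq> W \<Longrightarrow> dist y z \<le> R \<Longrightarrow>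
      (\<Sum>w\<in>W. (\<phi> w z - \<phi> w y)\<^sup>2) \<le> \<eta>"
proof -
  obtain S and A :: "'a \<Rightarrow> ('a \<times> nat) set" where S: "0 < S" and fin: "\<And>x. finite (A x)"
    and near: "\<And>y z. dist y z \<le> R \<Longrightarrow>
      real (card ((A y - A z) \<union> (A z - A y))) < \<eta> / 2 * real (card (A y \<inter> A z))"
    and loc: "\<And>x. A x \<subseteq> cball x S \<times> UNIV"
  proof -
    have "0 < \<eta> / 2" using \<open>0 < \<eta>\<close> by simp
    then have "\<exists>S>0. \<exists>A :: 'a \<Rightarrow> ('a \<times> nat) set.
        (\<forall>x. finite (A x)) \<and>
        (\<forall>y z. dist y z \<le> R \<longrightarrow>
           real (card ((A y - A z) \<union> (A z - A y))) < \<eta> / 2 * real (card (A y \<inter> A z))) \<and>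
        (\<forall>x. A x \<subseteq> cball x S \<times> UNIV)"
      using assms(1) \<open>0 < R\<close> unfolding property_A_def by blast
    then show ?thesis using that by blast
  qed
  \<comment> \<open>For equal points the strict inequality of property A reads 0 < \<eta>/2 *
    \<bar>A y\<bar>, so \<open>A y\<close> is nonempty.\<close>
  have ne: "0 < card (A y)" for y
    using near[of y y] \<open>0 < R\<close> \<open>0 < \<eta>\<close> by (simp add: zero_less_mult_iff)
  define \<phi> where "\<phi> w y = (if w \<in> A y then 1 / sqrt (real (card (A y))) else 0)" for w y
  have unit: "(\<Sum>w\<in>W. (\<phi> w y)\<^sup>2) = 1" if "finite W" "A y \<subseteq> W" for W y
  proof -
    have "(\<Sum>w\<in>W. (\<phi> w y)\<^sup>2) = (\<Sum>w\<in>A y. (\<phi> w y)\<^sup>2)"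
      using that by (intro sum.mono_neutral_right) (auto simp: \<phi>_def)
    also have "\<dots> = 1" using ne[of y] by (simp add: \<phi>_def power_divide)
    finally show ?thesis .
  qed
  have close: "(\<Sum>w\<in>W. (\<phi> w z - \<phi> w y)\<^sup>2) \<le> \<eta>"
    if W: "finite W" "A y \<subseteq> W" "A z \<subseteq> W" and yz: "dist y z \<le> R" for W y z
  proof -
    let ?I = "real (card (A y \<inter> A z))" and ?p = "sqrt (real (card (A y)))" and ?q = "sqrt (real (card (A z)))"
    have cards: "real (card (A u)) \<le> (1 + \<eta> / 2) * ?I" if "u \<in> {y, z}" for u
    proof -
      have "A u \<subseteq> (A y \<inter> A z) \<union> ((A y - A z) \<union> (A z - A y))" using that by auto
      then have "card (A u) \<le> card ((A y \<inter> A z) \<union> ((A y - A z) \<union> (A z - A y)))"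
        using fin by (intro card_mono) auto
      also have "\<dots> \<le> card (A y \<inter> A z) + card ((A y - A z) \<union> (A z - A y))" by (rule card_Un_le)
      finally show ?thesis using near[OF yz] by (simp add: algebra_simps)
    qed
    have "?p * ?q \<le> sqrt ((1 + \<eta> / 2) * ?I) * sqrt ((1 + \<eta> / 2) * ?I)"
      using cards \<open>0 < \<eta>\<close> by (intro mult_mono real_sqrt_le_mono) auto
    also have "\<dots> = (1 + \<eta> / 2) * ?I" using \<open>0 < \<eta>\<close> by simp
    finally have pq: "?p * ?q \<le> (1 + \<eta> / 2) * ?I" .
    have pos: "0 < ?p * ?q" using ne by simp
    have "(\<Sum>w\<in>W. \<phi> w z * \<phi> w y) = (\<Sum>w\<in>A y \<inter> A z. \<phi> w z * \<phi> w y)"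
      using W by (intro sum.mono_neutral_right) (auto simp: \<phi>_def)
    also have "\<dots> = ?I / (?p * ?q)" by (simp add: \<phi>_def)
    finally have cross: "(\<Sum>w\<in>W. \<phi> w z * \<phi> w y) = ?I / (?p * ?q)" .
    have "(\<Sum>w\<in>W. (\<phi> w z - \<phi> w y)\<^sup>2)
        = (\<Sum>w\<in>W. (\<phi> w z)\<^sup>2) + (\<Sum>w\<in>W. (\<phi> w y)\<^sup>2) - 2 * (\<Sum>w\<in>W. \<phi> w z * \<phi> w y)"
      by (simp add: power2_diff sum.distrib sum_subtractf sum_distrib_left mult.assoc)
    also have "\<dots> = 2 - 2 * (?I / (?p * ?q))" using unit W cross by simp
    also have "\<dots> \<le> \<eta>"
    proof -
      \<comment> \<open>The point is (2 - \<eta>)(1 + \<eta>/2) = 2 - \<eta>^2/2 \<le> 2; for \<eta>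
        > 2 the left side is not positive.\<close>
      have "(2 - \<eta>) * (?p * ?q) \<le> 2 * ?I"
      proof (cases "\<eta> \<le> 2")
        case True
        have "(2 - \<eta>) * (?p * ?q) \<le> (2 - \<eta>) * ((1 + \<eta> / 2) * ?I)"
          using True pq by (intro mult_left_mono) auto
        also have "\<dots> = (2 - \<eta>\<^sup>2 / 2) * ?I" by (simp add: field_simps power2_eq_square)
        also have "\<dots> \<le> 2 * ?I" by (intro mult_right_mono) auto
        finally show ?thesis .
      next
        case False
        then have "(2 - \<eta>) * (?p * ?q) \<le> 0" using pos by (intro mult_nonpos_nonneg) auto
        then show ?thesis by (simp add: order.trans)
      qed
      then have "2 - \<eta> \<le> 2 * ?I / (?p * ?q)" using pos by (simp add: pos_le_divide_eq)
      then show ?thesis by simp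
    qed
    finally show ?thesis .
  qed
  show ?thesis
  proof (rule that[OF S fin _ unit close])
    show "dist (fst w) y \<le> S" if "\<phi> w y \<noteq> 0" for w y
      using that loc[of y] by (cases w) (auto simp: \<phi>_def dist_commute split: if_splits)
  qed auto
qed

text \<open>Cauchy-Schwarz over the at most \<open>N\<close> relevant entries of a row gives one
  factor \<open>N\<close>. Summing over \<open>w\<close> before \<open>z\<close> makes \<eta>
  appear, and each column is then counted at most \<open>N\<close> times.\<close>

lemma sum_sum_norm_band_le:
  fixes u :: "'a::metric_space \<Rightarrow> 'a \<Rightarrow> 'h::real_inner" and d :: "'w \<Rightarrow> 'a \<Rightarrow> 'a \<Rightarrow> real"
  assumes fin: "finite E" "finite G" and "0 \<le> K"
    and u: "\<And>y z. y \<in> G \<Longrightarrow> z \<in> E \<Longrightarrow> norm (u y z) \<le> K * g z"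
    and u0: "\<And>y z. y \<in> G \<Longrightarrow> z \<in> E \<Longrightarrow> \<not> dist y z \<le> R \<Longrightarrow> u y z = 0"
    and near: "\<And>y z. y \<in> G \<Longrightarrow> z \<in> E \<Longrightarrow> dist y z \<le> R \<Longrightarrow> (\<Sum>w\<in>W. (d w y z)\<^sup>2) \<le> \<eta>"
    and NE: "\<And>y. card {z \<in> E. dist y z \<le> R} \<le> N" and NG: "\<And>z. card {y \<in> G. dist y z \<le> R} \<le> N"
    and "0 \<le> \<eta>"
  shows "(\<Sum>w\<in>W. \<Sum>y\<in>G. (norm (\<Sum>z\<in>E. d w y z *\<^sub>R u y z))\<^sup>2) \<le> (real N)\<^sup>2 * \<eta> * K\<^sup>2 * (\<Sum>z\<in>E. (g z)\<^sup>2)"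
proof -
  let ?E = "\<lambda>y. {z \<in> E. dist y z \<le> R}"
  have pointwise: "(norm (\<Sum>z\<in>E. d w y z *\<^sub>R u y z))\<^sup>2 \<le> real N * (\<Sum>z\<in>?E y. (d w y z)\<^sup>2 * (K * g z)\<^sup>2)"
    if y: "y \<in> G" for w y
  proof -
    have "(\<Sum>z\<in>E. d w y z *\<^sub>R u y z) = (\<Sum>z\<in>?E y. d w y z *\<^sub>R u y z)"
      using fin u0[OF y] by (intro sum.mono_neutral_right) auto
    then have "norm (\<Sum>z\<in>E. d w y z *\<^sub>R u y z) \<le> (\<Sum>z\<in>?E y. \<bar>d w y z\<bar> * (K * g z))"
      using u[OF y] by (auto intro!: sum_norm_le mult_left_mono)
    then have "(norm (\<Sum>z\<in>E. d w y z *\<^sub>R u y z))\<^sup>2 \<le> (\<Sum>z\<in>?E y. \<bar>d w y z\<bar> * (K * g z))\<^sup>2"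
      by (intro power_mono) auto
    also have "\<dots> \<le> real (card (?E y)) * (\<Sum>z\<in>?E y. (\<bar>d w y z\<bar> * (K * g z))\<^sup>2)"
      using sum_squared_le_sum_of_squares[of "\<lambda>z. \<bar>d w y z\<bar> * (K * g z)" "?E y"] by (simp only: mult.commute)
    also have "\<dots> \<le> real N * (\<Sum>z\<in>?E y. (\<bar>d w y z\<bar> * (K * g z))\<^sup>2)"
      using NE[of y] by (intro mult_right_mono sum_nonneg) auto
    finally show ?thesis by (simp add: power_mult_distrib)
  qed
  have "(\<Sum>w\<in>W. \<Sum>y\<in>G. (norm (\<Sum>z\<in>E. d w y z *\<^sub>R u y z))\<^sup>2)
      \<le> (\<Sum>w\<in>W. \<Sum>y\<in>G. real N * (\<Sum>z\<in>?E y. (d w y z)\<^sup>2 * (K * g z)\<^sup>2))"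
    using pointwise by (intro sum_mono) auto
  also have "\<dots> = (\<Sum>y\<in>G. \<Sum>w\<in>W. real N * (\<Sum>z\<in>?E y. (d w y z)\<^sup>2 * (K * g z)\<^sup>2))"
    by (rule sum.swap)
  also have "\<dots> = (\<Sum>y\<in>G. real N * (\<Sum>z\<in>?E y. (\<Sum>w\<in>W. (d w y z)\<^sup>2) * (K * g z)\<^sup>2))"
  proof (rule sum.cong[OF refl])
    fix y
    have "(\<Sum>w\<in>W. real N * (\<Sum>z\<in>?E y. (d w y z)\<^sup>2 * (K * g z)\<^sup>2))
        = real N * (\<Sum>w\<in>W. \<Sum>z\<in>?E y. (d w y z)\<^sup>2 * (K * g z)\<^sup>2)"
      by (rule sum_distrib_left[symmetric])
    also have "(\<Sum>w\<in>W. \<Sum>z\<in>?E y. (d w y z)\<^sup>2 * (K * g z)\<^sup>2)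
        = (\<Sum>z\<in>?E y. \<Sum>w\<in>W. (d w y z)\<^sup>2 * (K * g z)\<^sup>2)"
      by (rule sum.swap)
    also have "\<dots> = (\<Sum>z\<in>?E y. (\<Sum>w\<in>W. (d w y z)\<^sup>2) * (K * g z)\<^sup>2)"
      by (simp only: sum_distrib_right)
    finally show "(\<Sum>w\<in>W. real N * (\<Sum>z\<in>?E y. (d w y z)\<^sup>2 * (K * g z)\<^sup>2))
        = real N * (\<Sum>z\<in>?E y. (\<Sum>w\<in>W. (d w y z)\<^sup>2) * (K * g z)\<^sup>2)" .
  qed
  also have "\<dots> \<le> (\<Sum>y\<in>G. real N * (\<Sum>z\<in>?E y. \<eta> * (K * g z)\<^sup>2))"
    using near by (intro sum_mono mult_left_mono mult_right_mono) auto
  also have "\<dots> = real N * (\<Sum>y\<in>G. \<Sum>z\<in>E. if dist y z \<le> R then \<eta> * (K * g z)\<^sup>2 else 0)"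
    using fin by (simp add: sum_distrib_left sum.inter_filter)
  also have "(\<Sum>y\<in>G. \<Sum>z\<in>E. if dist y z \<le> R then \<eta> * (K * g z)\<^sup>2 else 0)
      = (\<Sum>z\<in>E. \<Sum>y\<in>G. if dist y z \<le> R then \<eta> * (K * g z)\<^sup>2 else 0)"
    by (rule sum.swap)
  also have "\<dots> = (\<Sum>z\<in>E. real (card {y \<in> G. dist y z \<le> R}) * (\<eta> * (K * g z)\<^sup>2))"
    using fin by (simp flip: sum.inter_filter)
  also have "real N * \<dots> \<le> real N * (\<Sum>z\<in>E. real N * (\<eta> * (K * g z)\<^sup>2))"
    using NG \<open>0 \<le> \<eta>\<close> by (intro mult_left_mono sum_mono mult_right_mono) auto
  also have "\<dots> = (real N)\<^sup>2 * \<eta> * K\<^sup>2 * (\<Sum>z\<in>E. (g z)\<^sup>2)"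
    by (simp add: sum_distrib_left power_mult_distrib power2_eq_square mult_ac)
  finally show ?thesis .
qed

text \<open>The double sums run over the squared norms of the vectors \<open>a (\<phi>\<^sub>w \<zeta>)\<close>, \<open>\<phi>\<^sub>w (a \<zeta>)\<close> and
  \<open>[a, \<phi>\<^sub>w] \<zeta>\<close>; here \<open>u y z\<close> plays the role of \<open>a\<^bsub>y,z\<^esub> \<zeta> z\<close>.\<close>

lemma partition_localization:
  fixes u :: "'a::metric_space \<Rightarrow> 'a \<Rightarrow> 'h::real_inner" and \<phi> :: "'w \<Rightarrow> 'a \<Rightarrow> real"
  assumes fin: "finite E" "finite G" "finite W" and K: "0 < K"
    and u: "\<And>y z. y \<in> G \<Longrightarrow> z \<in> E \<Longrightarrow> norm (u y z) \<le> K * g z"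
    and u0: "\<And>y z. y \<in> G \<Longrightarrow> z \<in> E \<Longrightarrow> \<not> dist y z \<le> R \<Longrightarrow> u y z = 0"
    and unit: "\<And>y. y \<in> G \<union> E \<Longrightarrow> (\<Sum>w\<in>W. (\<phi> w y)\<^sup>2) = 1"
    and near: "\<And>y z. y \<in> G \<Longrightarrow> z \<in> E \<Longrightarrow> dist y z \<le> R \<Longrightarrow> (\<Sum>w\<in>W. (\<phi> w z - \<phi> w y)\<^sup>2) \<le> \<eta>"
    and NE: "\<And>y. card {z \<in> E. dist y z \<le> R} \<le> N" and NG: "\<And>z. card {y \<in> G. dist y z \<le> R} \<le> N"
    and \<eta>: "0 \<le> \<eta>" "(real N)\<^sup>2 * \<eta> \<le> 1 / 100"
    and g: "(\<Sum>z\<in>E. (g z)\<^sup>2) \<le> 1"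
    and big: "(6 / 10 * K)\<^sup>2 \<le> (\<Sum>y\<in>G. (norm (\<Sum>z\<in>E. u y z))\<^sup>2)"
  obtains w where "w \<in> W" "0 < (\<Sum>z\<in>E. (\<phi> w z * g z)\<^sup>2)"
    "(K / 2)\<^sup>2 * (\<Sum>z\<in>E. (\<phi> w z * g z)\<^sup>2) \<le> (\<Sum>y\<in>G. (norm (\<Sum>z\<in>E. \<phi> w z *\<^sub>R u y z))\<^sup>2)"
proof -
  define B where "B w = (\<Sum>y\<in>G. (norm (\<Sum>z\<in>E. \<phi> w z *\<^sub>R u y z))\<^sup>2)" for w
  define D where "D w = (\<Sum>z\<in>E. (\<phi> w z * g z)\<^sup>2)" for w
  define P where "P = (\<lambda>(w, y). norm (\<Sum>z\<in>E. \<phi> w z *\<^sub>R u y z))"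
  define Q where "Q = (\<lambda>(w, y). norm (\<Sum>z\<in>E. (\<phi> w z - \<phi> w y) *\<^sub>R u y z))"
  define T where "T = (\<lambda>(w, y). norm (\<phi> w y *\<^sub>R (\<Sum>z\<in>E. u y z)))"
  \<comment> \<open>This is the identity \<phi> a = a \<phi> - [a, \<phi>] at \<open>y\<close>. The
    triangle inequality is then taken in the l2-norm over all pairs \<open>(w, y)\<close> at
    once.\<close>
  have TPQ: "T p \<le> P p + Q p" for p
  proof (cases p)
    case (Pair w y)
    have "\<phi> w y *\<^sub>R (\<Sum>z\<in>E. u y z) = (\<Sum>z\<in>E. \<phi> w z *\<^sub>R u y z) - (\<Sum>z\<in>E. (\<phi> w z - \<phi> w y) *\<^sub>R u y z)"
      by (simp add: scaleR_left_diff_distrib sum_subtractf scaleR_sum_right)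
    then have "norm (\<phi> w y *\<^sub>R (\<Sum>z\<in>E. u y z))
        \<le> norm (\<Sum>z\<in>E. \<phi> w z *\<^sub>R u y z) + norm (\<Sum>z\<in>E. (\<phi> w z - \<phi> w y) *\<^sub>R u y z)"
      by (simp only: norm_triangle_ineq4)
    then show ?thesis using Pair by (simp add: P_def Q_def T_def del: norm_scaleR)
  qed
  have nonneg: "0 \<le> P p" "0 \<le> Q p" "0 \<le> T p" for p by (simp_all add: P_def Q_def T_def split: prod.split)
  have "L2_set T (W \<times> G) \<le> L2_set (\<lambda>p. P p + Q p) (W \<times> G)"
    by (rule L2_set_mono) (use TPQ nonneg in auto)
  also have "\<dots> \<le> L2_set P (W \<times> G) + L2_set Q (W \<times> G)" by (rule L2_set_triangle_ineq)
  finally have tri: "L2_set T (W \<times> G) \<le> L2_set P (W \<times> G) + L2_set Q (W \<times> G)" .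
  have "(\<Sum>p\<in>W \<times> G. (Q p)\<^sup>2) = (\<Sum>w\<in>W. \<Sum>y\<in>G. (norm (\<Sum>z\<in>E. (\<phi> w z - \<phi> w y) *\<^sub>R u y z))\<^sup>2)"
    by (simp add: sum.cartesian_product Q_def case_prod_beta)
  also have "\<dots> \<le> (real N)\<^sup>2 * \<eta> * K\<^sup>2 * (\<Sum>z\<in>E. (g z)\<^sup>2)"
    by (rule sum_sum_norm_band_le[where d = "\<lambda>w y z. \<phi> w z - \<phi> w y" and R = R])
      (use assms in auto)
  also have "\<dots> \<le> (1 / 100) * K\<^sup>2 * 1"
    using \<eta> g by (intro mult_mono) (auto intro: sum_nonneg)
  also have "\<dots> = (K / 10)\<^sup>2" by (simp add: power_divide)
  finally have "L2_set Q (W \<times> G) \<le> K / 10"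
    unfolding L2_set_def using K by (intro real_le_lsqrt) auto
  moreover have "6 / 10 * K \<le> L2_set T (W \<times> G)"
  proof -
    have "(\<Sum>p\<in>W \<times> G. (T p)\<^sup>2) = (\<Sum>w\<in>W. \<Sum>y\<in>G. (\<phi> w y)\<^sup>2 * (norm (\<Sum>z\<in>E. u y z))\<^sup>2)"
      by (simp add: sum.cartesian_product T_def case_prod_beta power_mult_distrib)
    also have "\<dots> = (\<Sum>y\<in>G. \<Sum>w\<in>W. (\<phi> w y)\<^sup>2 * (norm (\<Sum>z\<in>E. u y z))\<^sup>2)"
      by (rule sum.swap)
    also have "\<dots> = (\<Sum>y\<in>G. (norm (\<Sum>z\<in>E. u y z))\<^sup>2)"
      using unit by (simp flip: sum_distrib_right)
    finally show ?thesis using real_le_rsqrt[OF big] by (simp only: L2_set_def)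
  qed
  \<comment> \<open>The partition preserves the norm 6/10 K of \<open>a \<zeta>\<close>, and the
    commutators cost K / 10.\<close>
  ultimately have "K / 2 \<le> L2_set P (W \<times> G)" using tri by simp
  then have "(K / 2)\<^sup>2 \<le> (L2_set P (W \<times> G))\<^sup>2" using K by (intro power_mono) auto
  also have "\<dots> = (\<Sum>w\<in>W. B w)"
    by (simp add: L2_set_def sum_nonneg B_def sum.cartesian_product P_def case_prod_beta)
  finally have sumB: "(K / 2)\<^sup>2 \<le> (\<Sum>w\<in>W. B w)" .
  have "(\<Sum>w\<in>W. D w) = (\<Sum>z\<in>E. \<Sum>w\<in>W. (\<phi> w z)\<^sup>2 * (g z)\<^sup>2)"
    unfolding D_def power_mult_distrib by (rule sum.swap)
  also have "\<dots> = (\<Sum>z\<in>E. (g z)\<^sup>2)" using unit by (simp flip: sum_distrib_right)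
  finally have sumD: "(\<Sum>w\<in>W. D w) \<le> 1" using g by simp
  have D0: "0 \<le> D w" for w by (simp add: D_def sum_nonneg)
  have B_zero: "B w = 0" if "D w = 0" for w
  proof -
    have zero: "\<phi> w z * g z = 0" if "z \<in> E" for z
      using \<open>D w = 0\<close> fin that by (simp add: D_def sum_nonneg_eq_0_iff)
    have "\<phi> w z *\<^sub>R u y z = 0" if "y \<in> G" "z \<in> E" for y z
      using u[OF that] zero[OF that(2)] by auto
    then have "(\<Sum>z\<in>E. \<phi> w z *\<^sub>R u y z) = 0" if "y \<in> G" for y
      using that by (intro sum.neutral) auto
    then show ?thesis by (simp add: B_def)
  qed
  \<comment> \<open>An averaging argument: the \<open>B w\<close> sum to at least (K/2)^2 and the
    \<open>D w\<close> to at most 1, so (K/2)^2 \<open>D w\<close> cannot exceed \<open>B w\<close>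
    everywhere. Since \<open>B w\<close> vanishes with \<open>D w\<close>, the index found carries a
    nonzero vector.\<close>
  have "\<exists>w\<in>W. 0 < D w \<and> (K / 2)\<^sup>2 * D w \<le> B w"
  proof (rule ccontr)
    assume "\<not> ?thesis"
    then have less: "B w < (K / 2)\<^sup>2 * D w" if "w \<in> W" "0 < D w" for w using that by auto
    have le: "B w \<le> (K / 2)\<^sup>2 * D w" if "w \<in> W" for w
      using less[OF that] B_zero[of w] D0[of w] by (cases "D w = 0") auto
    have "0 < (\<Sum>w\<in>W. B w)" using sumB K by (metis less_le_trans zero_less_divide_iff zero_less_numeral zero_less_power)
    then obtain w where w: "w \<in> W" "B w \<noteq> 0" by (metis less_irrefl sum.neutral)
    then have "0 < D w" using B_zero D0[of w] by (metis less_le)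
    then have "(\<Sum>w\<in>W. B w) < (\<Sum>w\<in>W. (K / 2)\<^sup>2 * D w)"
      using w le less fin by (intro sum_strict_mono_ex1) auto
    also have "\<dots> \<le> (K / 2)\<^sup>2 * 1"
      using sumD by (simp only: sum_distrib_left[symmetric]) (intro mult_left_mono; simp)
    finally show False using sumB by simp
  qed
  then show ?thesis using that unfolding B_def D_def by blast
qed

text \<open>An almost maximal vector is cut down to a finite set \<open>E\<close> of atoms, which
  makes all sums finite, and is then localized by one of the functions \<open>\<phi> w\<close>,
  whose support lies in a ball about \<open>p w\<close>.\<close>

lemma (in discrete_measure) ONL_vector:
  fixes a :: "('a \<Rightarrow> 'h::complex_hilbert_space) \<Rightarrow> 'a \<Rightarrow> 'h" and \<phi> :: "'w \<Rightarrow> 'a \<Rightarrow> real"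
  assumes a: "L2_bounded_operator \<nu> a" and propag: "propagation \<nu> a \<le> of_nat R"
    and K: "0 < L2_operator_norm \<nu> a"
    and fin: "\<And>(x :: 'a) S. finite (cball x S)" and N: "\<And>x :: 'a. card (cball x (real R)) \<le> N"
    and A: "\<And>y. finite (A y)"
    and loc: "\<And>w y. \<phi> w y \<noteq> 0 \<Longrightarrow> dist (p w) y \<le> S"
    and unit: "\<And>W y. finite W \<Longrightarrow> A y \<subseteq> W \<Longrightarrow> (\<Sum>w\<in>W. (\<phi> w y)\<^sup>2) = 1"
    and near: "\<And>W y z. finite W \<Longrightarrow> A y \<subseteq> W \<Longrightarrow> A z \<subseteq> W \<Longrightarrow> dist y z \<le> real R \<Longrightarrow>
      (\<Sum>w\<in>W. (\<phi> w z - \<phi> w y)\<^sup>2) \<le> \<eta>"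
    and \<eta>: "0 \<le> \<eta>" "(real N)\<^sup>2 * \<eta> \<le> 1 / 100"
  obtains \<zeta> x where "\<zeta> \<in> L2_fun \<nu>" "0 < L2_norm \<nu> \<zeta>" "\<And>y. \<zeta> y \<noteq> 0 \<Longrightarrow> dist x y \<le> S"
    "1 / 2 * L2_operator_norm \<nu> a * L2_norm \<nu> \<zeta> \<le> L2_norm \<nu> (a \<zeta>)"
proof -
  define K where "K = L2_operator_norm \<nu> a"
  have K0: "0 < K" using K by (simp add: K_def)
  \<comment> \<open>The factor 9/10 and the tail 1/10 are matched to the crude factor 2: with x =
    (norm of \<open>a \<zeta>\<close> / K)^2 they give 81/100 \<le> 2 x + 2/100, hence x \<ge>
    36/100.\<close>
  obtain \<zeta>0 where \<zeta>0: "\<zeta>0 \<in> L2_fun \<nu>" "L2_norm \<nu> \<zeta>0 \<le> 1" "9 / 10 * K < L2_norm \<nu> (a \<zeta>0)"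
    using L2_operator_norm_attained_approx[OF a, of "9 / 10 * K"] K0 by (auto simp: K_def)
  obtain B where B: "finite B" "L2_norm \<nu> (restrict0 (- B) \<zeta>0) < 1 / 10"
    using L2_norm_tail_small[OF fin \<zeta>0(1), of "1 / 10"] by auto
  define E where "E = B \<inter> atoms \<nu>"
  have E: "finite E" "E \<subseteq> atoms \<nu>" using B by (auto simp: E_def)
  define \<zeta> where "\<zeta> = restrict0 E \<zeta>0"
  define \<zeta>1 where "\<zeta>1 = restrict0 (- E) \<zeta>0"
  have \<zeta>: "\<zeta> \<in> L2_fun \<nu>" and \<zeta>1: "\<zeta>1 \<in> L2_fun \<nu>"
    using \<zeta>0(1) by (simp_all add: \<zeta>_def \<zeta>1_def L2_fun_restrict0)
  have supp\<zeta>: "\<zeta> x = 0" if "x \<notin> E" for x using that by (simp add: \<zeta>_def restrict0_def)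
  have "L2_norm \<nu> \<zeta>1 = L2_norm \<nu> (restrict0 (- B) \<zeta>0)"
    by (rule L2_norm_cong) (simp add: \<zeta>1_def restrict0_def E_def)
  then have "K * L2_norm \<nu> \<zeta>1 \<le> K * (1 / 10)" using B(2) K0 by (intro mult_left_mono) auto
  then have "L2_norm \<nu> (a \<zeta>1) \<le> K / 10"
    using L2_norm_op_le[OF a \<zeta>1] by (simp add: K_def)
  then have small: "(L2_norm \<nu> (a \<zeta>1))\<^sup>2 \<le> (K / 10)\<^sup>2" by (intro power_mono) auto
  have a\<zeta>: "a \<zeta> \<in> L2_fun \<nu>" "a \<zeta>1 \<in> L2_fun \<nu>"
    using a \<zeta> \<zeta>1 unfolding L2_bounded_operator_def by blast+
  have "(\<lambda>x. \<zeta> x + \<zeta>1 x) = \<zeta>0" by (auto simp: \<zeta>_def \<zeta>1_def restrict0_def)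
  then have "L2_norm \<nu> (a \<zeta>0) = L2_norm \<nu> (\<lambda>x. a \<zeta> x + a \<zeta>1 x)"
    using L2_op_add[OF a \<zeta> \<zeta>1] by (intro L2_norm_cong) simp
  then have sq: "(L2_norm \<nu> (a \<zeta>0))\<^sup>2 \<le> 2 * (L2_norm \<nu> (a \<zeta>))\<^sup>2 + 2 * (L2_norm \<nu> (a \<zeta>1))\<^sup>2"
    using L2_fun_add(2)[OF a\<zeta>] by simp
  have sq0: "(9 / 10 * K)\<^sup>2 \<le> (L2_norm \<nu> (a \<zeta>0))\<^sup>2" using \<zeta>0(3) K0 by (intro power_mono) auto
  have big: "(6 / 10 * K)\<^sup>2 \<le> (L2_norm \<nu> (a \<zeta>))\<^sup>2"
  proof -
    have "81 / 100 * K\<^sup>2 \<le> 2 * (L2_norm \<nu> (a \<zeta>))\<^sup>2 + 2 / 100 * K\<^sup>2"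
      using sq sq0 small by (simp add: power_mult_distrib power_divide)
    then have "36 / 100 * K\<^sup>2 \<le> (L2_norm \<nu> (a \<zeta>))\<^sup>2" using zero_le_power2[of K] by argo
    then show ?thesis by (simp add: power_mult_distrib power_divide)
  qed
  \<comment> \<open>Bounded propagation confines \<open>a \<xi>\<close> to the
    \<open>R\<close>-neighbourhood of \<open>E\<close> for every \<xi> supported in
    \<open>E\<close>.\<close>
  define G where "G = atoms \<nu> \<inter> (\<Union>z\<in>E. cball z (real R))"
  have G: "finite G" "G \<subseteq> atoms \<nu>" using E fin by (auto simp: G_def)
  have band: "dist y z \<le> real R" if "y \<in> atoms \<nu>" "z \<in> E" "matrix_entry a y z h \<noteq> 0" for y z h
    by (rule matrix_entry_nonzero_dist_le[OF propag that(1) _ that(3)]) (use that E in auto)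
  have a_app: "a \<xi> y = (\<Sum>z\<in>E. matrix_entry a y z (\<xi> z))"
    if "y \<in> atoms \<nu>" "\<And>x. x \<notin> E \<Longrightarrow> \<xi> x = 0" for \<xi> y
    by (rule op_finite_support[OF a E(1) that(2,1)])
  have a_norm: "(L2_norm \<nu> (a \<xi>))\<^sup>2
      = (\<Sum>y\<in>G. (norm (\<Sum>z\<in>E. sqrt (measure \<nu> {y}) *\<^sub>R matrix_entry a y z (\<xi> z)))\<^sup>2)"
    if \<xi>: "\<And>x. x \<notin> E \<Longrightarrow> \<xi> x = 0" for \<xi>
  proof -
    have zero: "a \<xi> y = 0" if "y \<in> atoms \<nu>" "y \<notin> G" for y
    proof -
      have "matrix_entry a y z (\<xi> z) = 0" if "z \<in> E" for z
      proof (rule ccontr)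
        assume "matrix_entry a y z (\<xi> z) \<noteq> 0"
        then have "y \<in> cball z (real R)"
          using band[OF \<open>y \<in> atoms \<nu>\<close> that] by (simp add: dist_commute)
        then show False using \<open>y \<notin> G\<close> \<open>y \<in> atoms \<nu>\<close> that by (auto simp: G_def)
      qed
      then show ?thesis using a_app[OF that(1) \<xi>] by simp
    qed
    have "(L2_norm \<nu> (a \<xi>))\<^sup>2 = (\<Sum>y\<in>G. measure \<nu> {y} * (norm (a \<xi> y))\<^sup>2)"
      by (rule finite_support_L2(2)[OF G(1) zero])
    also have "\<dots> = (\<Sum>y\<in>G. (norm (\<Sum>z\<in>E. sqrt (measure \<nu> {y}) *\<^sub>R matrix_entry a y z (\<xi> z)))\<^sup>2)"
      using G(2) by (intro sum.cong refl) (auto simp: a_app[OF _ \<xi>] power_mult_distrib simp flip: scaleR_sum_right)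
    finally show ?thesis .
  qed
  \<comment> \<open>The square-root weights turn norms with respect to \<open>\<nu>\<close> into
    unweighted sums, so no bound involving \<nu> enters the localization argument.\<close>
  define u where "u y z = sqrt (measure \<nu> {y}) *\<^sub>R matrix_entry a y z (\<zeta> z)" for y z
  define g where "g z = sqrt (measure \<nu> {z}) * norm (\<zeta> z)" for z
  define W where "W = (\<Union>y\<in>G \<union> E. A y)"
  have W: "finite W" using G E A by (simp add: W_def)
  have W_sub: "A y \<subseteq> W" if "y \<in> G \<union> E" for y using that by (auto simp: W_def)
  have cards: "card {z \<in> F. dist y z \<le> real R} \<le> N" for F and y :: 'a
    using card_mono[OF fin[of y "real R"], of "{z \<in> F. dist y z \<le> real R}"] N[of y] by force
  have norm_\<phi>\<zeta>: "(L2_norm \<nu> (\<lambda>x. b x *\<^sub>R \<zeta> x))\<^sup>2 = (\<Sum>z\<in>E. (b z * g z)\<^sup>2)" for b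
  proof -
    have "(L2_norm \<nu> (\<lambda>x. b x *\<^sub>R \<zeta> x))\<^sup>2 = (\<Sum>z\<in>E. measure \<nu> {z} * (norm (b z *\<^sub>R \<zeta> z))\<^sup>2)"
      by (rule finite_support_L2(2)[OF E(1)]) (simp add: supp\<zeta>)
    then show ?thesis by (simp add: g_def power_mult_distrib mult_ac)
  qed
  obtain w where w: "0 < (\<Sum>z\<in>E. (\<phi> w z * g z)\<^sup>2)"
    "(K / 2)\<^sup>2 * (\<Sum>z\<in>E. (\<phi> w z * g z)\<^sup>2) \<le> (\<Sum>y\<in>G. (norm (\<Sum>z\<in>E. \<phi> w z *\<^sub>R u y z))\<^sup>2)"
  proof (rule partition_localization[where E = E and G = G and W = W and K = K and R = "real R" and u = u and g = g and \<phi> = \<phi> and \<eta> = \<eta> and N = N])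
    show "norm (u y z) \<le> K * g z" for y z
      using norm_matrix_entry_le[OF a] by (simp add: u_def g_def K_def)
    show "u y z = 0" if "y \<in> G" "z \<in> E" "\<not> dist y z \<le> real R" for y z
      using band[of y z "\<zeta> z"] that G(2) by (auto simp: u_def)
    show "(\<Sum>w\<in>W. (\<phi> w y)\<^sup>2) = 1" if "y \<in> G \<union> E" for y by (rule unit[OF W W_sub[OF that]])
    show "(\<Sum>w\<in>W. (\<phi> w z - \<phi> w y)\<^sup>2) \<le> \<eta>" if "y \<in> G" "z \<in> E" "dist y z \<le> real R" for y z
      by (rule near[OF W W_sub W_sub that(3)]) (use that in auto)
    show "card {y \<in> G. dist y z \<le> real R} \<le> N" for z
      using cards[of G z] by (simp add: dist_commute)
    have "(\<Sum>z\<in>E. (g z)\<^sup>2) = (L2_norm \<nu> \<zeta>)\<^sup>2" using norm_\<phi>\<zeta>[of "\<lambda>_. 1"] by simp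
    moreover have "L2_norm \<nu> \<zeta> \<le> 1"
      using L2_norm_restrict0_le[OF \<zeta>0(1), of E] \<zeta>0(2) by (simp add: \<zeta>_def)
    ultimately show "(\<Sum>z\<in>E. (g z)\<^sup>2) \<le> 1" by (simp add: power_le_one)
    show "(6 / 10 * K)\<^sup>2 \<le> (\<Sum>y\<in>G. (norm (\<Sum>z\<in>E. u y z))\<^sup>2)"
      using big a_norm[OF supp\<zeta>] by (simp add: u_def)
  qed (use W E G K0 \<eta> cards that in auto)
  define \<xi> where "\<xi> x = \<phi> w x *\<^sub>R \<zeta> x" for x
  have \<xi>2: "(L2_norm \<nu> \<xi>)\<^sup>2 = (\<Sum>z\<in>E. (\<phi> w z * g z)\<^sup>2)"
    unfolding \<xi>_def by (rule norm_\<phi>\<zeta>)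
  have \<xi>0: "\<xi> x = 0" if "x \<notin> E" for x using that by (simp add: \<xi>_def supp\<zeta>)
  have "(L2_norm \<nu> (a \<xi>))\<^sup>2 = (\<Sum>y\<in>G. (norm (\<Sum>z\<in>E. \<phi> w z *\<^sub>R u y z))\<^sup>2)"
  proof (subst a_norm)
    have "sqrt (measure \<nu> {y}) *\<^sub>R matrix_entry a y z (\<xi> z) = \<phi> w z *\<^sub>R u y z" if "y \<in> G" for y z
      using that G(2) by (auto simp: u_def \<xi>_def matrix_entry_scaleR[OF a] mult.commute)
    then show "(\<Sum>y\<in>G. (norm (\<Sum>z\<in>E. sqrt (measure \<nu> {y}) *\<^sub>R matrix_entry a y z (\<xi> z)))\<^sup>2)
        = (\<Sum>y\<in>G. (norm (\<Sum>z\<in>E. \<phi> w z *\<^sub>R u y z))\<^sup>2)"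
      by simp
  qed (rule \<xi>0)
  then have "(K / 2 * L2_norm \<nu> \<xi>)\<^sup>2 \<le> (L2_norm \<nu> (a \<xi>))\<^sup>2"
    using w(2) by (simp only: power_mult_distrib[of "K / 2"] \<xi>2)
  then have "K / 2 * L2_norm \<nu> \<xi> \<le> L2_norm \<nu> (a \<xi>)"
    by (rule power2_le_imp_le) simp
  then have ineq: "1 / 2 * L2_operator_norm \<nu> a * L2_norm \<nu> \<xi> \<le> L2_norm \<nu> (a \<xi>)" by (simp add: K_def)
  have pos: "0 < L2_norm \<nu> \<xi>"
    using w(1) L2_norm_nonneg[of \<xi>] unfolding \<xi>2[symmetric] by (metis less_le power_zero_numeral)
  have "\<xi> \<in> L2_fun \<nu>" by (rule finite_support_L2(1)[OF E(1) \<xi>0])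
  then show ?thesis
    by (rule that[OF _ pos _ ineq]) (use loc in \<open>auto simp: \<xi>_def\<close>)
qed

section \<open>Uniformity over measures and operators\<close>

lemma infinite_dimensional_unit_vector:
  assumes "infinite_dimensional TYPE('h::complex_hilbert_space)"
  obtains h :: "'h::complex_hilbert_space" where "norm h = 1"
proof -
  have "\<exists>h :: 'h. h \<noteq> 0"
  proof (rule ccontr)
    assume "\<not> ?thesis"
    then have "complex_vector.span ({} :: 'h set) = UNIV" by (auto simp: complex_vector.span_empty)
    then show False using assms unfolding infinite_dimensional_def by blast
  qed
  then obtain h :: 'h where "h \<noteq> 0" by blast
  then have "norm ((1 / norm h) *\<^sub>R h) = 1" by simp
  then show ?thesis using that by blast
qed

lemma bounded_geometry_discrete_measure:
  assumes "bounded_geometry TYPE('a::metric_space)" and "locally_finite_borel (\<nu> :: 'a measure)"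
  shows "discrete_measure \<nu>"
proof
  show "countable (UNIV :: 'a set)" by (rule bounded_geometry_countable[OF assms(1)])
  show sets: "sets \<nu> = UNIV"
    using assms(2) bounded_geometry_sets_borel[OF assms(1)] by (simp add: locally_finite_borel_def)
  fix x
  obtain U where "x \<in> U" "emeasure \<nu> U < \<infinity>"
    using assms(2) unfolding locally_finite_borel_def by blast
  moreover have "emeasure \<nu> {x} \<le> emeasure \<nu> U"
    using \<open>x \<in> U\<close> by (intro emeasure_mono) (auto simp: sets)
  ultimately show "emeasure \<nu> {x} < \<infinity>" by simp
qed

lemma diameter_le_of_center:
  assumes "\<And>y. y \<in> A \<Longrightarrow> dist x y \<le> S" and "0 \<le> S"
  shows "bounded A" "diameter A \<le> 2 * S"
proof -
  have sub: "A \<subseteq> cball x S" using assms by auto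
  then show "bounded A" using bounded_cball bounded_subset by blast
  have "dist y z \<le> 2 * S" if "y \<in> A" "z \<in> A" for y z
    using assms(1)[OF that(1)] assms(1)[OF that(2)] dist_triangle3[of y z x] by simp
  then show "diameter A \<le> 2 * S"
    using \<open>0 \<le> S\<close> unfolding diameter_def by (auto intro!: cSUP_least)
qed

proposition property_A_imp_ONL:
  assumes "infinite_dimensional TYPE('h::complex_hilbert_space)"
    and bg: "bounded_geometry TYPE('a::metric_space)" and A: "property_A TYPE('a)"
  shows "has_ONL TYPE('h) TYPE('a)"
proof -
  obtain h0 :: 'h where h0: "norm h0 = 1" using infinite_dimensional_unit_vector[OF assms(1)] .
  note fin = bounded_geometry_finite_cball[OF bg]
  \<comment> \<open>The measure and the operator are quantified inside \<open>Q\<close>, so that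
    choosing \<open>s\<close> for each \<open>R\<close> yields a function \<open>f\<close>
    independent of both.\<close>
  define Q where "Q R s \<longleftrightarrow> (\<forall>(\<nu> :: 'a measure) (a :: ('a \<Rightarrow> 'h) \<Rightarrow> 'a \<Rightarrow> 'h). discrete_measure \<nu> \<longrightarrow>
      L2_bounded_operator \<nu> a \<longrightarrow> propagation \<nu> a \<le> of_nat R \<longrightarrow> 0 < L2_operator_norm \<nu> a \<longrightarrow>
      (\<exists>\<zeta>\<in>L2_fun \<nu>. 0 < L2_norm \<nu> \<zeta> \<and> bounded (L2_supp \<nu> \<zeta>) \<and> diameter (L2_supp \<nu> \<zeta>) \<le> real s \<and>
        1 / 2 * L2_operator_norm \<nu> a * L2_norm \<nu> \<zeta> \<le> L2_norm \<nu> (a \<zeta>)))" for R s :: nat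
  have "\<exists>s. Q R s" for R
  proof -
    obtain N where N: "1 \<le> N" "\<And>x::'a. card (cball x (real R)) \<le> N"
      using bounded_geometry_card_cball[OF bg] by blast
    define \<eta> where "\<eta> = 1 / (100 * (real N)\<^sup>2)"
    have \<eta>: "0 < \<eta>" "(real N)\<^sup>2 * \<eta> \<le> 1 / 100" using N(1) by (simp_all add: \<eta>_def)
    \<comment> \<open>Property A speaks of positive distances only, while the propagation bound may
      be 0.\<close>
    have Rpos: "0 < real R + 1" by simp
    obtain S and A :: "'a \<Rightarrow> ('a \<times> nat) set" and \<phi> :: "'a \<times> nat \<Rightarrow> 'a \<Rightarrow> real"
      where S: "0 < S" and A: "\<And>y. finite (A y)"
        and loc: "\<And>w y. \<phi> w y \<noteq> 0 \<Longrightarrow> dist (fst w) y \<le> S"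
        and unit: "\<And>W y. finite W \<Longrightarrow> A y \<subseteq> W \<Longrightarrow> (\<Sum>w\<in>W. (\<phi> w y)\<^sup>2) = 1"
        and near: "\<And>W y z. finite W \<Longrightarrow> A y \<subseteq> W \<Longrightarrow> A z \<subseteq> W \<Longrightarrow> dist y z \<le> real R + 1 \<Longrightarrow>
          (\<Sum>w\<in>W. (\<phi> w z - \<phi> w y)\<^sup>2) \<le> \<eta>"
      by (rule property_A_unit_vectors[OF A Rpos \<eta>(1)]) (rule that)
    show ?thesis unfolding Q_def
    proof (intro exI[of _ "nat \<lceil>2 * S\<rceil>"] allI impI)
      fix \<nu> :: "'a measure" and a :: "('a \<Rightarrow> 'h) \<Rightarrow> 'a \<Rightarrow> 'h"
      assume "discrete_measure \<nu>" and a: "L2_bounded_operator \<nu> a" "propagation \<nu> a \<le> of_nat R"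
        "0 < L2_operator_norm \<nu> a"
      interpret discrete_measure \<nu> by fact
      obtain \<zeta> :: "'a \<Rightarrow> 'h" and x where \<zeta>: "\<zeta> \<in> L2_fun \<nu>" "0 < L2_norm \<nu> \<zeta>"
        and supp: "\<And>y. \<zeta> y \<noteq> 0 \<Longrightarrow> dist x y \<le> S"
        and big: "1 / 2 * L2_operator_norm \<nu> a * L2_norm \<nu> \<zeta> \<le> L2_norm \<nu> (a \<zeta>)"
      proof (rule ONL_vector[where \<phi> = \<phi> and p = fst and S = S and \<eta> = \<eta> and A = A, OF a fin N(2) A])
        show "dist (fst w) y \<le> S" if "\<phi> w y \<noteq> 0" for w y by (rule loc[OF that])
        show "(\<Sum>w\<in>W. (\<phi> w y)\<^sup>2) = 1" if "finite W" "A y \<subseteq> W" for W y by (rule unit[OF that])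
        show "(\<Sum>w\<in>W. (\<phi> w z - \<phi> w y)\<^sup>2) \<le> \<eta>"
          if "finite W" "A y \<subseteq> W" "A z \<subseteq> W" "dist y z \<le> real R" for W y z
          using that(4) by (intro near[OF that(1-3)]) simp
        show "0 \<le> \<eta>" "(real N)\<^sup>2 * \<eta> \<le> 1 / 100" using \<eta> by auto
      qed (rule that)
      have "bounded (L2_supp \<nu> \<zeta>)" "diameter (L2_supp \<nu> \<zeta>) \<le> 2 * S"
        using diameter_le_of_center[of "L2_supp \<nu> \<zeta>" x S] supp S by (auto simp: L2_supp_def)
      moreover have "2 * S \<le> real (nat \<lceil>2 * S\<rceil>)" using S by linarith
      ultimately show "\<exists>\<zeta>\<in>L2_fun \<nu>. 0 < L2_norm \<nu> \<zeta> \<and> bounded (L2_supp \<nu> \<zeta>) \<and>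
          diameter (L2_supp \<nu> \<zeta>) \<le> real (nat \<lceil>2 * S\<rceil>) \<and>
          1 / 2 * L2_operator_norm \<nu> a * L2_norm \<nu> \<zeta> \<le> L2_norm \<nu> (a \<zeta>)"
        using \<zeta> big by (intro bexI[of _ \<zeta>] conjI) auto
    qed
  qed
  then obtain f where f: "\<And>R. Q R (f R)" by metis
  have "ONL_relative TYPE('h) \<nu> f (1 / 2)"
    if lf: "locally_finite_borel \<nu>" and nz: "emeasure \<nu> (space \<nu>) \<noteq> 0" for \<nu> :: "'a measure"
    unfolding ONL_relative_def
  proof (intro allI impI)
    fix R and a :: "('a \<Rightarrow> 'h) \<Rightarrow> 'a \<Rightarrow> 'h"
    assume a: "L2_bounded_operator \<nu> a \<and> propagation \<nu> a \<le> of_nat R"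
    have dm: "discrete_measure \<nu>" by (rule bounded_geometry_discrete_measure[OF bg lf])
    interpret discrete_measure \<nu> by (rule dm)
    have "\<exists>\<zeta>\<in>L2_fun \<nu>. 0 < L2_norm \<nu> \<zeta> \<and> bounded (L2_supp \<nu> \<zeta>) \<and>
        diameter (L2_supp \<nu> \<zeta>) \<le> real (f R) \<and> 1 / 2 * L2_operator_norm \<nu> a * L2_norm \<nu> \<zeta> \<le> L2_norm \<nu> (a \<zeta>)"
    proof (cases "0 < L2_operator_norm \<nu> a")
      case True
      then show ?thesis using f[of R] dm a unfolding Q_def by simp
    next
      case False
      \<comment> \<open>For an operator of norm zero any localized nonzero vector will do. A nonzero
        measure has an atom, and a point mass there is one.\<close>
      have "\<not> (AE x in \<nu>. False)"
        using nz by (simp add: AE_iff_null null_sets_def)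
      then obtain x where x: "x \<in> atoms \<nu>" unfolding AE_iff_atoms by blast
      let ?\<zeta> = "\<lambda>y. if y = x then h0 else 0"
      have \<zeta>: "?\<zeta> \<in> L2_fun \<nu>" "(L2_norm \<nu> ?\<zeta>)\<^sup>2 = measure \<nu> {x}"
        using finite_support_L2[of "{x}" ?\<zeta>] h0 by auto
      have "L2_norm \<nu> ?\<zeta> \<noteq> 0" using \<zeta>(2) atom_measure_pos[OF x] by auto
      then have pos: "0 < L2_norm \<nu> ?\<zeta>" using L2_norm_nonneg[of ?\<zeta>] by (simp add: less_le)
      have "L2_supp \<nu> ?\<zeta> \<subseteq> {x}" by (auto simp: L2_supp_def)
      then have supp: "L2_supp \<nu> ?\<zeta> = {} \<or> L2_supp \<nu> ?\<zeta> = {x}" by blast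
      have "L2_operator_norm \<nu> a = 0" using False L2_operator_norm_nonneg a by force
      then show ?thesis using \<zeta>(1) pos supp by (intro bexI[of _ ?\<zeta>]) auto
    qed
    then obtain \<zeta> :: "'a \<Rightarrow> 'h" where \<zeta>: "\<zeta> \<in> L2_fun \<nu>" "0 < L2_norm \<nu> \<zeta>" "bounded (L2_supp \<nu> \<zeta>)"
        "diameter (L2_supp \<nu> \<zeta>) \<le> real (f R)" "1 / 2 * L2_operator_norm \<nu> a * L2_norm \<nu> \<zeta> \<le> L2_norm \<nu> (a \<zeta>)"
      by blast
    have "\<not> (AE x in \<nu>. \<zeta> x = 0)"
    proof
      assume "AE x in \<nu>. \<zeta> x = 0"
      then have "L2_norm \<nu> \<zeta> = L2_norm \<nu> (\<lambda>x. 0 :: 'h)" by (intro L2_norm_cong) (auto simp: AE_iff_atoms)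
      then show False using \<zeta>(2) by (simp add: L2_norm_def)
    qed
    then show "\<exists>\<zeta>\<in>L2_fun \<nu>. \<not> (AE x in \<nu>. \<zeta> x = 0) \<and> bounded (L2_supp \<nu> \<zeta>) \<and>
        diameter (L2_supp \<nu> \<zeta>) \<le> real (f R) \<and> 1 / 2 * L2_operator_norm \<nu> a * L2_norm \<nu> \<zeta> \<le> L2_norm \<nu> (a \<zeta>)"
      using \<zeta> by blast
  qed
  then show ?thesis
    unfolding has_ONL_def by (intro exI[of _ "1/2 :: real"] exI[of _ f]) auto
qed

section \<open>Matrices on finite sets\<close>

text \<open>A real matrix acting diagonally on the Hilbert-space coordinate. The value 0 outside
  \<open>F\<close> keeps the images inside \<open>F\<close>.\<close>

definition mat_app :: "'a set \<Rightarrow> ('a \<Rightarrow> 'a \<Rightarrow> real) \<Rightarrow> ('a \<Rightarrow> 'h::real_inner) \<Rightarrow> 'a \<Rightarrow> 'h" where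
  "mat_app F a \<zeta> y = (if y \<in> F then \<Sum>z\<in>F. a y z *\<^sub>R \<zeta> z else 0)"

definition mat_form :: "'a set \<Rightarrow> ('a \<Rightarrow> 'a \<Rightarrow> real) \<Rightarrow> ('a \<Rightarrow> 'h::real_inner) \<Rightarrow> ('a \<Rightarrow> 'h) \<Rightarrow> real" where
  "mat_form F a \<zeta> \<eta> = (\<Sum>y\<in>F. \<Sum>z\<in>F. a y z * inner (\<zeta> y) (\<eta> z))"

definition ip_on :: "'a set \<Rightarrow> ('a \<Rightarrow> 'h::real_inner) \<Rightarrow> ('a \<Rightarrow> 'h) \<Rightarrow> real" where
  "ip_on F \<zeta> \<eta> = (\<Sum>y\<in>F. inner (\<zeta> y) (\<eta> y))"

definition norm_on :: "'a set \<Rightarrow> ('a \<Rightarrow> 'h::real_inner) \<Rightarrow> real" where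
  "norm_on F \<zeta> = L2_set (\<lambda>y. norm (\<zeta> y)) F"

lemma norm_on_nonneg [simp]: "0 \<le> norm_on F \<zeta>"
  by (simp add: norm_on_def)

lemma norm_on_power2: "(norm_on F \<zeta>)\<^sup>2 = ip_on F \<zeta> \<zeta>"
  by (simp add: norm_on_def ip_on_def L2_set_def sum_nonneg dot_square_norm)

lemma ip_on_le_norm_on: "ip_on F \<zeta> \<eta> \<le> norm_on F \<zeta> * norm_on F \<eta>"
proof -
  have "ip_on F \<zeta> \<eta> \<le> (\<Sum>y\<in>F. \<bar>norm (\<zeta> y)\<bar> * \<bar>norm (\<eta> y)\<bar>)"
    unfolding ip_on_def by (intro sum_mono) (simp add: norm_cauchy_schwarz)
  also have "\<dots> \<le> norm_on F \<zeta> * norm_on F \<eta>"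
    unfolding norm_on_def by (rule L2_set_mult_ineq)
  finally show ?thesis .
qed

lemma ip_on_mat_app: "ip_on F \<zeta> (mat_app F a \<eta>) = mat_form F a \<zeta> \<eta>"
  by (simp add: ip_on_def mat_form_def mat_app_def inner_sum_right)

lemma mat_form_commute:
  assumes "\<And>y z. y \<in> F \<Longrightarrow> z \<in> F \<Longrightarrow> a y z = a z y"
  shows "mat_form F a \<zeta> \<eta> = mat_form F a \<eta> \<zeta>"
  unfolding mat_form_def
  by (subst sum.swap) (auto intro!: sum.cong simp: assms inner_commute)

lemma mat_form_Cauchy_Schwarz:
  fixes \<zeta> \<eta> :: "'a \<Rightarrow> 'h::real_inner"
  assumes sym: "\<And>y z. y \<in> F \<Longrightarrow> z \<in> F \<Longrightarrow> a y z = a z y"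
    and psd: "\<And>\<zeta> :: 'a \<Rightarrow> 'h. 0 \<le> mat_form F a \<zeta> \<zeta>"
  shows "(mat_form F a \<zeta> \<eta>)\<^sup>2 \<le> mat_form F a \<zeta> \<zeta> * mat_form F a \<eta> \<eta>"
proof (rule nonneg_quadratic_discriminant)
  fix t :: real
  have "0 \<le> mat_form F a (\<lambda>y. \<zeta> y + t *\<^sub>R \<eta> y) (\<lambda>y. \<zeta> y + t *\<^sub>R \<eta> y)" by (rule psd)
  also have "\<dots> = mat_form F a \<zeta> \<zeta> + t * mat_form F a \<zeta> \<eta> + t * mat_form F a \<eta> \<zeta> + t\<^sup>2 * mat_form F a \<eta> \<eta>"
    by (simp add: mat_form_def inner_add_left inner_add_right sum.distrib sum_distrib_left
        algebra_simps power2_eq_square)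
  also have "mat_form F a \<eta> \<zeta> = mat_form F a \<zeta> \<eta>" by (rule mat_form_commute[OF sym])
  finally show "0 \<le> mat_form F a \<zeta> \<zeta> + 2 * t * mat_form F a \<zeta> \<eta> + t\<^sup>2 * mat_form F a \<eta> \<eta>"
    by simp
qed (rule psd)

lemma mat_app_support:
  fixes x :: "'a::metric_space"
  assumes band: "\<And>y z. a y z \<noteq> 0 \<Longrightarrow> dist y z \<le> R"
    and supp: "\<And>y. \<zeta> y \<noteq> 0 \<Longrightarrow> y \<in> F \<inter> cball x r"
    and "mat_app F a \<zeta> y \<noteq> 0"
  shows "y \<in> F \<inter> cball x (r + R)"
proof -
  have "y \<in> F" using assms(3) by (auto simp: mat_app_def split: if_splits)
  moreover obtain z where "a y z *\<^sub>R \<zeta> z \<noteq> 0"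
    using assms(3) unfolding mat_app_def by (metis sum.neutral)
  then have "dist y z \<le> R" "dist x z \<le> r" using band supp by auto
  ultimately show ?thesis using dist_triangle2[of x y z] by auto
qed

lemma mat_app_funpow_support:
  fixes x :: "'a::metric_space"
  assumes band: "\<And>y z. a y z \<noteq> 0 \<Longrightarrow> dist y z \<le> R"
    and supp: "\<And>y. \<zeta> y \<noteq> 0 \<Longrightarrow> y \<in> F \<inter> cball x r"
    and "(mat_app F a ^^ k) \<zeta> y \<noteq> 0"
  shows "y \<in> F \<inter> cball x (r + real k * R)"
  using assms(3)
proof (induction k arbitrary: y)
  case 0
  then show ?case using supp by simp
next
  case (Suc k)
  have "y \<in> F \<inter> cball x (r + real k * R + R)"
    by (rule mat_app_support[OF band Suc.IH]) (use Suc.prems in auto)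
  then show ?case by (simp add: algebra_simps)
qed

text \<open>Since \<open>\<parallel>A\<^sup>k\<^sup>+\<^sup>1 v\<parallel>\<^sup>2 = \<langle>A\<^sup>k v, A\<^sup>k\<^sup>+\<^sup>2 v\<rangle>\<close>, the ratios of consecutive norms do not decrease.\<close>

lemma norm_on_funpow_mat_app_ge:
  fixes v :: "'a \<Rightarrow> 'h::real_inner"
  assumes sym: "\<And>y z. y \<in> F \<Longrightarrow> z \<in> F \<Longrightarrow> a y z = a z y"
    and v: "0 < norm_on F v" and "0 < l" and l: "l * (norm_on F v)\<^sup>2 \<le> mat_form F a v v"
  shows "l ^ n * norm_on F v \<le> norm_on F ((mat_app F a ^^ n) v)"
proof -
  let ?A = "mat_app F a" and ?s = "\<lambda>k. norm_on F ((mat_app F a ^^ k) v)"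
  have step: "0 < ?s k \<and> l * ?s k \<le> ?s (Suc k)" for k
  proof (induction k)
    case 0
    have "l * (norm_on F v)\<^sup>2 \<le> norm_on F v * norm_on F (?A v)"
      using l ip_on_le_norm_on[of F v "?A v"] by (simp add: ip_on_mat_app)
    then show ?case using v by (simp add: power2_eq_square)
  next
    case (Suc k)
    let ?u = "(?A ^^ k) v"
    have pos: "0 < ?s (Suc k)" using Suc.IH \<open>0 < l\<close> by (metis less_le_trans mult_pos_pos)
    have "?s (Suc k) * ?s (Suc k) = ip_on F (?A ?u) (?A ?u)"
      using norm_on_power2[of F "?A ?u"] by (simp add: power2_eq_square)
    also have "\<dots> = mat_form F a (?A ?u) ?u" by (rule ip_on_mat_app)
    also have "\<dots> = mat_form F a ?u (?A ?u)" by (rule mat_form_commute[OF sym])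
    also have "\<dots> = ip_on F ?u (?A (?A ?u))" by (rule ip_on_mat_app[symmetric])
    also have "\<dots> \<le> ?s k * ?s (Suc (Suc k))" using ip_on_le_norm_on by fastforce
    finally have 1: "?s (Suc k) * ?s (Suc k) \<le> ?s k * ?s (Suc (Suc k))" .
    have "?s k * (l * ?s (Suc k)) \<le> ?s (Suc k) * ?s (Suc k)"
      using Suc.IH pos mult_right_mono[of "l * ?s k" "?s (Suc k)" "?s (Suc k)"] by (simp add: mult_ac)
    with 1 have "?s k * (l * ?s (Suc k)) \<le> ?s k * ?s (Suc (Suc k))" by linarith
    then have "l * ?s (Suc k) \<le> ?s (Suc (Suc k))" using Suc.IH by (metis mult_le_cancel_left_pos)
    then show ?case using pos by blast
  qed
  show ?thesis
  proof (induction n)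
    case (Suc n)
    have "l ^ Suc n * norm_on F v \<le> l * ?s n" using Suc \<open>0 < l\<close> by (simp add: mult_ac)
    also have "\<dots> \<le> ?s (Suc n)" using step by blast
    finally show ?case .
  qed simp
qed

text \<open>The Cauchy--Schwarz inequality for the form of \<open>a\<close>, applied to \<open>\<eta>\<close> and \<open>a \<eta>\<close>, turns a bound
  on the form at these two vectors into a bound on the norm.\<close>

lemma norm_on_mat_app_le:
  fixes \<eta> :: "'a \<Rightarrow> 'h::real_inner"
  assumes sym: "\<And>y z. y \<in> F \<Longrightarrow> z \<in> F \<Longrightarrow> a y z = a z y"
    and psd: "\<And>\<zeta> :: 'a \<Rightarrow> 'h. 0 \<le> mat_form F a \<zeta> \<zeta>"
    and "0 \<le> b" and 1: "mat_form F a \<eta> \<eta> \<le> b * (norm_on F \<eta>)\<^sup>2"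
    and 2: "mat_form F a (mat_app F a \<eta>) (mat_app F a \<eta>) \<le> b * (norm_on F (mat_app F a \<eta>))\<^sup>2"
  shows "norm_on F (mat_app F a \<eta>) \<le> b * norm_on F \<eta>"
proof (cases "norm_on F (mat_app F a \<eta>) = 0")
  case True
  then show ?thesis using \<open>0 \<le> b\<close> by simp
next
  case False
  let ?u = "mat_app F a \<eta>"
  have pos: "0 < (norm_on F ?u)\<^sup>2" using False by simp
  have "((norm_on F ?u)\<^sup>2)\<^sup>2 = (mat_form F a ?u \<eta>)\<^sup>2"
    by (simp add: norm_on_power2 ip_on_mat_app)
  also have "\<dots> \<le> mat_form F a ?u ?u * mat_form F a \<eta> \<eta>"
    by (rule mat_form_Cauchy_Schwarz[OF sym psd])
  also have "\<dots> \<le> (b * (norm_on F ?u)\<^sup>2) * (b * (norm_on F \<eta>)\<^sup>2)"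
    using 1 2 psd \<open>0 \<le> b\<close> by (intro mult_mono) auto
  finally have "(norm_on F ?u)\<^sup>2 * (norm_on F ?u)\<^sup>2 \<le> (norm_on F ?u)\<^sup>2 * (b * norm_on F \<eta>)\<^sup>2"
    by (simp add: power2_eq_square mult_ac)
  then have "(norm_on F ?u)\<^sup>2 \<le> (b * norm_on F \<eta>)\<^sup>2"
    using pos by (metis mult_le_cancel_left_pos)
  then show ?thesis using \<open>0 \<le> b\<close> by (simp add: abs_le_square_iff[symmetric])
qed

text \<open>The Schur test: each inner product is split into two half squares, and every point has
  at most \<open>N\<close> partners in the band.\<close>

lemma mat_form_le_band:
  fixes \<eta> :: "'a::metric_space \<Rightarrow> 'h::real_inner"
  assumes "finite F" and sym: "\<And>y z. y \<in> F \<Longrightarrow> z \<in> F \<Longrightarrow> a y z = a z y"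
    and band: "\<And>y z. a y z \<noteq> 0 \<Longrightarrow> dist y z \<le> R"
    and a1: "\<And>y z. y \<in> F \<Longrightarrow> z \<in> F \<Longrightarrow> \<bar>a y z\<bar> \<le> 1"
    and N: "\<And>y. y \<in> F \<Longrightarrow> card {z \<in> F. dist y z \<le> R} \<le> N"
  shows "mat_form F a \<eta> \<eta> \<le> real N * (norm_on F \<eta>)\<^sup>2"
proof -
  let ?e = "\<lambda>y z. if dist y z \<le> R then (norm (\<eta> y))\<^sup>2 / 2 else 0"
  have "a y z * inner (\<eta> y) (\<eta> z) \<le> ?e y z + ?e z y" if yz: "y \<in> F" "z \<in> F" for y z
  proof (cases "dist y z \<le> R")
    case True
    have "a y z * inner (\<eta> y) (\<eta> z) \<le> \<bar>a y z\<bar> * \<bar>inner (\<eta> y) (\<eta> z)\<bar>"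
      by (metis abs_ge_self abs_mult)
    also have "\<dots> \<le> 1 * (norm (\<eta> y) * norm (\<eta> z))"
      using a1[OF yz] by (intro mult_mono Cauchy_Schwarz_ineq2) auto
    also have "\<dots> \<le> (norm (\<eta> y))\<^sup>2 / 2 + (norm (\<eta> z))\<^sup>2 / 2"
      using sum_squares_bound[of "norm (\<eta> y)" "norm (\<eta> z)"] by simp
    finally show ?thesis using True by (simp add: dist_commute)
  next
    case False
    then have "a y z = 0" using band by blast
    then show ?thesis by simp
  qed
  then have "mat_form F a \<eta> \<eta> \<le> (\<Sum>y\<in>F. \<Sum>z\<in>F. ?e y z + ?e z y)"
    unfolding mat_form_def by (intro sum_mono) auto
  also have "\<dots> = (\<Sum>y\<in>F. \<Sum>z\<in>F. ?e y z) + (\<Sum>y\<in>F. \<Sum>z\<in>F. ?e z y)"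
    by (simp only: sum.distrib)
  also have "(\<Sum>y\<in>F. \<Sum>z\<in>F. ?e z y) = (\<Sum>y\<in>F. \<Sum>z\<in>F. ?e y z)"
    by (rule sum.swap)
  also have "(\<Sum>y\<in>F. \<Sum>z\<in>F. ?e y z) \<le> (\<Sum>y\<in>F. real N * ((norm (\<eta> y))\<^sup>2 / 2))"
  proof (rule sum_mono)
    fix y assume "y \<in> F"
    have "(\<Sum>z\<in>F. ?e y z) = real (card {z \<in> F. dist y z \<le> R}) * ((norm (\<eta> y))\<^sup>2 / 2)"
      using \<open>finite F\<close> by (simp flip: sum.inter_filter)
    also have "\<dots> \<le> real N * ((norm (\<eta> y))\<^sup>2 / 2)"
      using N[OF \<open>y \<in> F\<close>] by (intro mult_right_mono) auto
    finally show "(\<Sum>z\<in>F. ?e y z) \<le> real N * ((norm (\<eta> y))\<^sup>2 / 2)" .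
  qed
  finally have "mat_form F a \<eta> \<eta> \<le> 2 * (\<Sum>y\<in>F. real N * ((norm (\<eta> y))\<^sup>2 / 2))" by simp
  also have "\<dots> = real N * (norm_on F \<eta>)\<^sup>2"
    by (simp add: norm_on_power2 ip_on_def dot_square_norm sum_distrib_left)
  finally show ?thesis .
qed

section \<open>Powers of a positive matrix against norm localization\<close>

lemma psd_on_entry_bound:
  assumes psd: "psd_on {y, z} m" and "m y y = (g y)\<^sup>2" "m z z = (g z)\<^sup>2" and "0 \<le> g y" "0 \<le> g z"
  shows "\<bar>m y z\<bar> \<le> g y * g z"
proof -
  have "(m y z)\<^sup>2 \<le> (g y * g z)\<^sup>2"
    using psd_on_Cauchy_Schwarz[OF psd, of y z] assms by (simp add: power_mult_distrib)
  then show ?thesis using assms by (simp add: abs_le_square_iff[symmetric])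
qed

text \<open>A vector supported on two points at distance at most \<open>S\<close> is localized, so
  positivity on localized vectors controls the 2 x 2 minors. This bounds the off-diagonal entries by
  the diagonal.\<close>

lemma localized_psd_imp_psd_on_pairs:
  fixes m :: "'a::metric_space \<Rightarrow> 'a \<Rightarrow> real"
  assumes "finite F" and sym: "\<And>y z. m y z = m z y"
    and loc: "\<And>x (\<zeta> :: 'a \<Rightarrow> 'h::real_inner).
      (\<And>y. \<zeta> y \<noteq> 0 \<Longrightarrow> y \<in> F \<inter> cball x S) \<Longrightarrow> 0 \<le> mat_form F m \<zeta> \<zeta>"
    and h: "norm (h :: 'h) = 1"
    and "0 \<le> S" "y \<in> F" "z \<in> F" "dist y z \<le> S"
  shows "psd_on {y, z} m"
  unfolding psd_on_def
proof (intro conjI allI ballI sym)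
  fix c :: "'a \<Rightarrow> real"
  let ?\<zeta> = "\<lambda>w. if w \<in> {y, z} then c w *\<^sub>R h else 0"
  have "0 \<le> mat_form F m ?\<zeta> ?\<zeta>"
    by (rule loc[of _ y]) (use assms in \<open>auto split: if_splits\<close>)
  also have "\<dots> = (\<Sum>u\<in>F. \<Sum>w\<in>F. if u \<in> {y, z} \<and> w \<in> {y, z} then c u * c w * m u w else 0)"
    unfolding mat_form_def using h by (intro sum.cong refl) (auto simp: dot_square_norm)
  also have "\<dots> = (\<Sum>u\<in>{y, z}. \<Sum>w\<in>F. if u \<in> {y, z} \<and> w \<in> {y, z} then c u * c w * m u w else 0)"
    using assms by (intro sum.mono_neutral_right) auto
  also have "\<dots> = (\<Sum>u\<in>{y, z}. \<Sum>w\<in>{y, z}. c u * c w * m u w)"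
    using assms by (intro sum.cong refl sum.mono_neutral_cong_right) auto
  finally show "0 \<le> (\<Sum>u\<in>{y, z}. \<Sum>w\<in>{y, z}. c u * c w * m u w)" .
qed

text \<open>The matrix \<open>m\<close> is normalised to \<open>m' = g\<inverse> m g\<inverse>\<close>, where \<open>g\<^sup>2\<close> is its diagonal, so that
  \<open>a = N - m'\<close> is positive and its form is bounded by \<open>N\<close> on localized vectors, whereas the
  vector \<open>g\<close> would witness a norm above \<open>N + \<delta>\<close> if the claim failed. Norm localization for \<open>a ^ n\<close>
  with large \<open>n\<close> excludes this for any localization constant.\<close>

lemma localized_psd_sum_ge:
  fixes m :: "'a::metric_space \<Rightarrow> 'a \<Rightarrow> real" and h :: "'h::real_inner"
  assumes "finite F" and sym: "\<And>y z. m y z = m z y"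
    and band: "\<And>y z. m y z \<noteq> 0 \<Longrightarrow> y \<in> F \<and> z \<in> F \<and> dist y z \<le> R"
    and loc: "\<And>x (\<zeta> :: 'a \<Rightarrow> 'h).
      (\<And>y. \<zeta> y \<noteq> 0 \<Longrightarrow> y \<in> F \<inter> cball x S) \<Longrightarrow> 0 \<le> mat_form F m \<zeta> \<zeta>"
    and h: "norm h = 1" and "0 \<le> R" "R \<le> S" and S: "r + real n * R \<le> S"
    and N: "1 \<le> N" "\<And>y. y \<in> F \<Longrightarrow> card {z \<in> F. dist y z \<le> R} \<le> N"
    and "0 < \<delta>" and n: "real N ^ n < c * (real N + \<delta>) ^ n"
    and onl: "\<And>a L (v :: 'a \<Rightarrow> 'h). (\<And>y z. a y z \<noteq> 0 \<Longrightarrow> dist y z \<le> R) \<Longrightarrow> 0 < norm_on F v \<Longrightarrow>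
        L * norm_on F v \<le> norm_on F ((mat_app F a ^^ n) v) \<Longrightarrow>
        \<exists>(\<zeta> :: 'a \<Rightarrow> 'h) x. (\<forall>y. \<zeta> y \<noteq> 0 \<longrightarrow> y \<in> F \<inter> cball x r) \<and> 0 < norm_on F \<zeta> \<and>
          c * L * norm_on F \<zeta> \<le> norm_on F ((mat_app F a ^^ n) \<zeta>)"
  shows "- \<delta> * (\<Sum>y\<in>F. m y y) \<le> (\<Sum>y\<in>F. \<Sum>z\<in>F. m y z)"
proof (rule ccontr)
  assume "\<not> ?thesis"
  then have neg: "(\<Sum>y\<in>F. \<Sum>z\<in>F. m y z) < - \<delta> * (\<Sum>y\<in>F. m y y)" by simp
  have "0 \<le> S" using \<open>0 \<le> R\<close> \<open>R \<le> S\<close> by simp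
  have pair: "psd_on {y, z} m" if "y \<in> F" "z \<in> F" "dist y z \<le> S" for y z
    by (rule localized_psd_imp_psd_on_pairs[OF \<open>finite F\<close> sym _ h \<open>0 \<le> S\<close> that]) (rule loc, assumption)
  have diag: "0 \<le> m y y" for y
  proof (cases "y \<in> F")
    case True
    then show ?thesis using psd_on_diag[OF pair[OF True True]] \<open>0 \<le> S\<close> by simp
  next
    case False
    then have "m y y = 0" using band[of y y] by blast
    then show ?thesis by simp
  qed
  define g where "g y = sqrt (m y y)" for y
  have g: "0 \<le> g y" "(g y)\<^sup>2 = m y y" for y using diag by (auto simp: g_def)
  have gg: "\<bar>m y z\<bar> \<le> g y * g z" for y z
  proof (cases "m y z = 0")
    case True
    then show ?thesis using g by simp
  next
    case False
    then have "psd_on {y, z} m" using band[of y z] \<open>R \<le> S\<close> by (intro pair) auto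
    then show ?thesis by (rule psd_on_entry_bound) (use g in auto)
  qed
  \<comment> \<open>Where \<open>g\<close> vanishes the quotient is 0 by convention;
    \<open>gg\<close> makes \<open>m\<close> vanish there too, so \<open>m\<close> can still be
    recovered from \<open>m'\<close>.\<close>
  define m' where "m' y z = m y z / (g y * g z)" for y z
  have m': "m y z = g y * g z * m' y z" for y z
    using gg[of y z] by (auto simp: m'_def)
  have sym': "m' y z = m' z y" for y z using sym by (simp add: m'_def mult.commute)
  have m'1: "\<bar>m' y z\<bar> \<le> 1" for y z
    using gg[of y z] mult_nonneg_nonneg[OF g(1)[of y] g(1)[of z]]
    by (simp add: m'_def abs_divide divide_le_eq_1 abs_of_nonneg del: mult_nonneg_nonneg)
      (metis less_eq_real_def mult_eq_0_iff)
  have band': "dist y z \<le> R" if "m' y z \<noteq> 0" for y z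
    using band[of y z] that by (auto simp: m'_def)
  define a where "a y z = (if y = z then real N else 0) - m' y z" for y z
  have syma: "a y z = a z y" for y z using sym' by (auto simp: a_def)
  have banda: "dist y z \<le> R" if "a y z \<noteq> 0" for y z
    using that band'[of y z] \<open>0 \<le> R\<close> by (auto simp: a_def split: if_splits)
  have form: "mat_form F a \<zeta> \<zeta> = real N * (norm_on F \<zeta>)\<^sup>2 - mat_form F m' \<zeta> \<zeta>" for \<zeta> :: "'a \<Rightarrow> 'h"
  proof -
    have "mat_form F a \<zeta> \<zeta> = (\<Sum>y\<in>F. \<Sum>z\<in>F. (if y = z then real N * inner (\<zeta> y) (\<zeta> z) else 0)
        - m' y z * inner (\<zeta> y) (\<zeta> z))"
      unfolding mat_form_def a_def by (intro sum.cong refl) (simp add: left_diff_distrib)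
    also have "\<dots> = real N * (norm_on F \<zeta>)\<^sup>2 - mat_form F m' \<zeta> \<zeta>"
      using \<open>finite F\<close>
      by (simp add: sum_subtractf mat_form_def norm_on_power2 ip_on_def sum_distrib_left)
    finally show ?thesis .
  qed
  have psda: "0 \<le> mat_form F a \<zeta> \<zeta>" for \<zeta> :: "'a \<Rightarrow> 'h"
    using mat_form_le_band[where a = m' and R = R and \<eta> = \<zeta>, OF \<open>finite F\<close> sym' band' m'1 N(2)]
    by (simp add: form)
  have loca: "mat_form F a \<zeta> \<zeta> \<le> real N * (norm_on F \<zeta>)\<^sup>2"
    if "\<And>y. \<zeta> y \<noteq> 0 \<Longrightarrow> y \<in> F \<inter> cball x S" for \<zeta> :: "'a \<Rightarrow> 'h" and x
  proof -
    \<comment> \<open>Rescaling by \<open>g\<close> at each point does not enlarge the support, so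
      \<open>m'\<close> inherits positivity on localized vectors.\<close>
    have "mat_form F m' \<zeta> \<zeta> = mat_form F m (\<lambda>y. \<zeta> y /\<^sub>R g y) (\<lambda>y. \<zeta> y /\<^sub>R g y)"
      unfolding mat_form_def by (intro sum.cong refl) (simp add: m'_def divide_inverse mult_ac)
    moreover have "0 \<le> \<dots>" by (rule loc[of _ x]) (use that in auto)
    ultimately show ?thesis by (simp add: form)
  qed
  \<comment> \<open>On this vector the form of \<open>m'\<close> is the sum of all entries of
    \<open>m\<close>, and the squared norm is the trace: the assumed failure says that
    \<open>v\<close> has Rayleigh quotient above N + \<delta>.\<close>
  define v where "v y = g y *\<^sub>R h" for y
  have v2: "(norm_on F v)\<^sup>2 = (\<Sum>y\<in>F. m y y)"
    using h by (simp add: norm_on_power2 ip_on_def v_def dot_square_norm flip: g(2) power2_eq_square)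
  have "mat_form F m' v v = (\<Sum>y\<in>F. \<Sum>z\<in>F. m y z)"
    unfolding mat_form_def using h
    by (intro sum.cong refl) (simp add: m' v_def dot_square_norm mult_ac)
  then have form_v: "(real N + \<delta>) * (norm_on F v)\<^sup>2 < mat_form F a v v"
    using neg by (simp add: form v2 algebra_simps)
  have "norm_on F v \<noteq> 0"
  proof
    assume 0: "norm_on F v = 0"
    have "mat_form F a v v \<le> norm_on F v * norm_on F (mat_app F a v)"
      using ip_on_le_norm_on[of F v "mat_app F a v"] by (simp add: ip_on_mat_app)
    then show False using form_v 0 by simp
  qed
  then have v0: "0 < norm_on F v" using norm_on_nonneg[of F v] by linarith
  have "(real N + \<delta>) ^ n * norm_on F v \<le> norm_on F ((mat_app F a ^^ n) v)"
    by (rule norm_on_funpow_mat_app_ge[OF syma v0]) (use form_v \<open>0 < \<delta>\<close> in auto)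
  from onl[OF banda v0 this] obtain \<zeta> :: "'a \<Rightarrow> 'h" and x where
    supp: "\<And>y. \<zeta> y \<noteq> 0 \<Longrightarrow> y \<in> F \<inter> cball x r" and \<zeta>0: "0 < norm_on F \<zeta>"
    and big: "c * (real N + \<delta>) ^ n * norm_on F \<zeta> \<le> norm_on F ((mat_app F a ^^ n) \<zeta>)"
    by blast
  \<comment> \<open>Passing from \<open>k\<close> to \<open>k + 1\<close> tests the form at both
    iterates, so the localized bound must last up to \<open>k = n\<close>; the radius r + k R stays
    within \<open>S\<close> that long.\<close>
  have loc_k: "mat_form F a ((mat_app F a ^^ k) \<zeta>) ((mat_app F a ^^ k) \<zeta>)
      \<le> real N * (norm_on F ((mat_app F a ^^ k) \<zeta>))\<^sup>2" if "k \<le> n" for k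
  proof (rule loca[of _ x])
    fix y assume "(mat_app F a ^^ k) \<zeta> y \<noteq> 0"
    then have "y \<in> F \<inter> cball x (r + real k * R)"
      by (intro mat_app_funpow_support[where a = a and \<zeta> = \<zeta> and k = k]) (use banda supp in auto)
    moreover have "real k * R \<le> real n * R" using that \<open>0 \<le> R\<close> by (intro mult_right_mono) auto
    ultimately show "y \<in> F \<inter> cball x S" using S by auto
  qed
  have "norm_on F ((mat_app F a ^^ k) \<zeta>) \<le> real N ^ k * norm_on F \<zeta>" if "k \<le> n" for k
    using that
  proof (induction k)
    case (Suc k)
    have "norm_on F (mat_app F a ((mat_app F a ^^ k) \<zeta>)) \<le> real N * norm_on F ((mat_app F a ^^ k) \<zeta>)"
      by (rule norm_on_mat_app_le[OF syma psda])
        (use loc_k[of k] loc_k[of "Suc k"] Suc.prems in auto)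
    also have "\<dots> \<le> real N * (real N ^ k * norm_on F \<zeta>)"
      using Suc by (intro mult_left_mono) auto
    finally show ?case by (simp add: mult_ac)
  qed simp
  from this[of n] have "c * (real N + \<delta>) ^ n * norm_on F \<zeta> \<le> real N ^ n * norm_on F \<zeta>"
    using big by simp
  then show False using n \<zeta>0 by (simp add: mult_le_cancel_right)
qed

section \<open>Finite matrices as operators for a counting measure\<close>

lemma mat_app_add: "mat_app F a (\<lambda>x. \<zeta> x + \<xi> x) = (\<lambda>x. mat_app F a \<zeta> x + mat_app F a \<xi> x)"
  by (auto simp: mat_app_def fun_eq_iff scaleR_right_distrib sum.distrib)

lemma mat_app_scaleC:
  fixes \<zeta> :: "'a \<Rightarrow> 'h::complex_hilbert_space"
  shows "mat_app F a (\<lambda>x. c *\<^sub>C \<zeta> x) = (\<lambda>x. c *\<^sub>C mat_app F a \<zeta> x)"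
proof -
  have "r *\<^sub>R (c *\<^sub>C h) = c *\<^sub>C (r *\<^sub>R h)" for r and h :: 'h
    by (simp add: scaleC_scaleC mult.commute flip: scaleC_of_real)
  then show ?thesis
    by (auto simp: mat_app_def fun_eq_iff complex_vector.scale_sum_right)
qed

lemma mat_app_bounded: "norm_on F (mat_app F a \<zeta>) \<le> (\<Sum>y\<in>F. \<Sum>z\<in>F. \<bar>a y z\<bar>) * norm_on F \<zeta>"
proof (cases "finite F")
  case True
  have "norm_on F (mat_app F a \<zeta>) \<le> (\<Sum>y\<in>F. norm (mat_app F a \<zeta> y))"
    unfolding norm_on_def by (rule L2_set_le_sum) simp
  also have "\<dots> \<le> (\<Sum>y\<in>F. \<Sum>z\<in>F. \<bar>a y z\<bar> * norm_on F \<zeta>)"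
  proof (rule sum_mono)
    fix y assume "y \<in> F"
    then have "norm (mat_app F a \<zeta> y) \<le> (\<Sum>z\<in>F. \<bar>a y z\<bar> * norm (\<zeta> z))"
      by (auto simp: mat_app_def intro!: sum_norm_le)
    also have "\<dots> \<le> (\<Sum>z\<in>F. \<bar>a y z\<bar> * norm_on F \<zeta>)"
      unfolding norm_on_def using True by (intro sum_mono mult_left_mono member_le_L2_set) auto
    finally show "norm (mat_app F a \<zeta> y) \<le> (\<Sum>z\<in>F. \<bar>a y z\<bar> * norm_on F \<zeta>)" .
  qed
  finally show ?thesis by (simp add: sum_distrib_right)
qed (simp add: norm_on_def)

lemma norm_on_cong: "(\<And>y. y \<in> F \<Longrightarrow> \<zeta> y = \<xi> y) \<Longrightarrow> norm_on F \<zeta> = norm_on F \<xi>"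
  by (simp add: norm_on_def cong: L2_set_cong)

lemma mat_app_funpow_cong:
  assumes "\<And>y. y \<in> F \<Longrightarrow> \<zeta> y = \<xi> y" and "y \<in> F"
  shows "(mat_app F a ^^ n) \<zeta> y = (mat_app F a ^^ n) \<xi> y"
  using assms(2)
proof (induction n arbitrary: y)
  case 0
  then show ?case using assms(1) by simp
next
  case (Suc n)
  then show ?case by (simp add: mat_app_def)
qed

text \<open>The measure lives on the whole type, as ONL requires, and has the points of
  \<open>F\<close> as its atoms, each of mass 1.\<close>

definition counting_on :: "'a set \<Rightarrow> 'a measure" where
  "counting_on F = density (count_space UNIV) (indicator F)"

lemma sets_counting_on: "sets (counting_on F) = UNIV"
  by (simp add: counting_on_def)

lemma emeasure_counting_on: "finite F \<Longrightarrow> emeasure (counting_on F) A = of_nat (card (F \<inter> A))"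
  by (simp add: counting_on_def emeasure_density flip: indicator_inter_arith)

text \<open>ONL is applied to the n-th power of the matrix, whose propagation is at most n R and
  whose operator norm is at least \<open>l\<close> because of \<open>v\<close>. A set of diameter at
  most f(n R) lies in the ball of that radius about any of its points.\<close>

lemma ONL_relative_finite_matrix:
  fixes F :: "'a::metric_space set" and v :: "'a \<Rightarrow> 'h::complex_hilbert_space"
  assumes bg: "bounded_geometry TYPE('a)"
    and onl: "\<And>\<nu> :: 'a measure. locally_finite_borel \<nu> \<Longrightarrow> emeasure \<nu> (space \<nu>) \<noteq> 0 \<Longrightarrow>
      ONL_relative TYPE('h) \<nu> f c"
    and "finite F" "0 < c" and band: "\<And>y z. a y z \<noteq> 0 \<Longrightarrow> dist y z \<le> real R"
    and v: "0 < norm_on F v" and L: "l * norm_on F v \<le> norm_on F ((mat_app F a ^^ n) v)"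
  shows "\<exists>(\<zeta> :: 'a \<Rightarrow> 'h) x. (\<forall>y. \<zeta> y \<noteq> 0 \<longrightarrow> y \<in> F \<inter> cball x (real (f (n * R)))) \<and>
    0 < norm_on F \<zeta> \<and> c * l * norm_on F \<zeta> \<le> norm_on F ((mat_app F a ^^ n) \<zeta>)"
proof -
  define \<nu> where "\<nu> = counting_on F"
  define T where "T = (mat_app F a ^^ n :: ('a \<Rightarrow> 'h) \<Rightarrow> 'a \<Rightarrow> 'h)"
  have emeasure: "emeasure \<nu> A = of_nat (card (F \<inter> A))" for A
    unfolding \<nu>_def by (rule emeasure_counting_on[OF \<open>finite F\<close>])
  have lf: "locally_finite_borel \<nu>"
    unfolding locally_finite_borel_def
  proof
    show "sets \<nu> = sets borel"
      by (simp add: \<nu>_def sets_counting_on bounded_geometry_sets_borel[OF bg])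
    show "\<forall>x. \<exists>U. open U \<and> x \<in> U \<and> emeasure \<nu> U < \<infinity>"
      by (intro allI exI[of _ UNIV]) (auto simp: emeasure less_top[symmetric])
  qed
  interpret discrete_measure \<nu> by (rule bounded_geometry_discrete_measure[OF bg lf])
  have "F \<noteq> {}" using v by (auto simp: norm_on_def)
  then have nz: "emeasure \<nu> (space \<nu>) \<noteq> 0" using \<open>finite F\<close> by (simp add: emeasure card_eq_0_iff)
  have atoms: "atoms \<nu> = F"
    by (auto simp: atoms_def emeasure card_gt_0_iff)
  have measure: "measure \<nu> {x} = 1" if "x \<in> F" for x
    using that by (simp add: measure_def emeasure)
  have L2: "\<zeta> \<in> L2_fun \<nu>" "L2_norm \<nu> \<zeta> = norm_on F \<zeta>" for \<zeta> :: "'a \<Rightarrow> 'h"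
  proof -
    have 0: "x \<notin> F \<Longrightarrow> \<zeta> x = 0" if "x \<in> atoms \<nu>" for x using that atoms by simp
    show "\<zeta> \<in> L2_fun \<nu>" by (rule finite_support_L2(1)[OF \<open>finite F\<close> 0])
    have "(L2_norm \<nu> \<zeta>)\<^sup>2 = (norm_on F \<zeta>)\<^sup>2"
      using finite_support_L2(2)[OF \<open>finite F\<close> 0] measure
      by (simp add: norm_on_power2 ip_on_def dot_square_norm)
    then show "L2_norm \<nu> \<zeta> = norm_on F \<zeta>"
      by (rule power2_eq_imp_eq) simp_all
  qed
  have add: "T (\<lambda>x. \<zeta> x + \<xi> x) = (\<lambda>x. T \<zeta> x + T \<xi> x)" for \<zeta> \<xi>
    unfolding T_def by (induction n) (simp_all add: mat_app_add)
  have scale: "T (\<lambda>x. c *\<^sub>C \<zeta> x) = (\<lambda>x. c *\<^sub>C T \<zeta> x)" for c \<zeta>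
    unfolding T_def by (induction n) (simp_all add: mat_app_scaleC)
  let ?C = "\<Sum>y\<in>F. \<Sum>z\<in>F. \<bar>a y z\<bar>"
  have "norm_on F ((mat_app F a ^^ k) \<zeta>) \<le> ?C ^ k * norm_on F \<zeta>" for k and \<zeta> :: "'a \<Rightarrow> 'h"
  proof (induction k)
    case (Suc k)
    have "norm_on F ((mat_app F a ^^ Suc k) \<zeta>) \<le> ?C * norm_on F ((mat_app F a ^^ k) \<zeta>)"
      using mat_app_bounded by simp
    also have "\<dots> \<le> ?C * (?C ^ k * norm_on F \<zeta>)"
      by (intro mult_left_mono Suc sum_nonneg) auto
    finally show ?case by (simp add: mult.assoc)
  qed simp
  then have bounded: "\<exists>C. \<forall>\<zeta>\<in>L2_fun \<nu>. L2_norm \<nu> (T \<zeta>) \<le> C * L2_norm \<nu> \<zeta>"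
    unfolding L2(2) T_def by blast
  have op: "L2_bounded_operator \<nu> T"
    unfolding L2_bounded_operator_def using L2(1) bounded by (auto simp: add scale)
  have propag: "propagation \<nu> T \<le> of_nat (n * R)"
    unfolding propagation_def
  proof (rule SUP_least, clarify)
    fix y z assume yz: "y \<in> atoms \<nu>" "z \<in> atoms \<nu>" and ne: "matrix_entry T y z \<noteq> (\<lambda>h. 0)"
    then obtain h where "matrix_entry T y z h \<noteq> 0" by auto
    then have "(mat_app F a ^^ n) (\<lambda>x. if x = z then h else 0) y \<noteq> 0"
      by (simp add: matrix_entry_def T_def)
    then have "y \<in> F \<inter> cball z (0 + real n * real R)"
      by (rule mat_app_funpow_support[rotated 2]) (use band yz atoms in \<open>auto split: if_splits\<close>)
    then have "dist y z \<le> real (n * R)" by (simp add: dist_commute)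
    then show "ennreal (dist y z) \<le> of_nat (n * R)"
      using ennreal_leI[of "dist y z" "real (n * R)"] by (simp only: ennreal_of_nat_eq_real_of_nat)
  qed
  from onl[OF lf nz] op propag obtain \<zeta> :: "'a \<Rightarrow> 'h" where
    ne: "\<not> (AE x in \<nu>. \<zeta> x = 0)" and bd: "bounded (L2_supp \<nu> \<zeta>)"
    and diam: "diameter (L2_supp \<nu> \<zeta>) \<le> real (f (n * R))"
    and big: "c * L2_operator_norm \<nu> T * L2_norm \<nu> \<zeta> \<le> L2_norm \<nu> (T \<zeta>)"
    unfolding ONL_relative_def by blast
  have "l * norm_on F v \<le> L2_operator_norm \<nu> T * norm_on F v"
    using L L2_norm_op_le[OF op L2(1), of v] by (simp add: L2(2) T_def)
  then have "l \<le> L2_operator_norm \<nu> T" using v by (simp add: mult_le_cancel_right)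
  then have "c * l * norm_on F \<zeta> \<le> c * L2_operator_norm \<nu> T * norm_on F \<zeta>"
    using \<open>0 < c\<close> by (intro mult_right_mono mult_left_mono) auto
  with big have big': "c * l * norm_on F \<zeta> \<le> norm_on F (T \<zeta>)" by (simp add: L2(2))
  obtain x where x: "x \<in> F" "\<zeta> x \<noteq> 0" using ne by (auto simp: AE_iff_atoms atoms)
  \<comment> \<open>The vector given by ONL is arbitrary off the atoms. Truncating it to
    \<open>F\<close> changes neither its norm nor that of its image.\<close>
  define \<xi> where "\<xi> y = (if y \<in> F then \<zeta> y else 0)" for y
  have norms: "norm_on F \<xi> = norm_on F \<zeta>" "norm_on F (T \<xi>) = norm_on F (T \<zeta>)"
    unfolding T_def by (intro norm_on_cong mat_app_funpow_cong; simp add: \<xi>_def)+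
  have "y \<in> F \<inter> cball x (real (f (n * R)))" if "\<xi> y \<noteq> 0" for y
  proof -
    have y: "y \<in> F" "\<zeta> y \<noteq> 0" using that by (auto simp: \<xi>_def split: if_splits)
    then have "dist x y \<le> diameter (L2_supp \<nu> \<zeta>)"
      using x by (intro diameter_bounded_bound bd) (auto simp: L2_supp_def atoms)
    then show ?thesis using diam y by simp
  qed
  moreover have "0 < norm_on F \<xi>"
  proof -
    have "norm (\<zeta> x) \<le> norm_on F \<zeta>"
      unfolding norm_on_def using x \<open>finite F\<close> by (intro member_le_L2_set) auto
    then show ?thesis unfolding norms using x by (metis less_le_trans zero_less_norm_iff)
  qed
  ultimately show ?thesis
    using big' norms unfolding T_def by (intro exI[of _ \<xi>] exI[of _ x]) auto
qed

section \<open>Norm localization implies property A\<close>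

text \<open>The signed distance from \<open>s\<close> to the interval [1 - \<delta>, 1 + \<delta>],
  which is half the derivative of the squared distance.\<close>

definition excess :: "real \<Rightarrow> real \<Rightarrow> real" where
  "excess \<delta> s = s - max (1 - \<delta>) (min s (1 + \<delta>))"

text \<open>The distance of s + h to the interval is at most its distance to the point of the
  interval nearest to s. This gives a one-sided quadratic expansion without differentiation.\<close>

lemma excess_add_le: "0 \<le> \<delta> \<Longrightarrow> (excess \<delta> (s + h))\<^sup>2 \<le> (excess \<delta> s + h)\<^sup>2"
  unfolding abs_le_square_iff[symmetric] by (simp add: excess_def max_def min_def abs_if)

text \<open>Where the excess is nonzero, s - 1 equals the excess plus \<delta> with the same
  sign.\<close>

lemma excess_mult: "0 \<le> \<delta> \<Longrightarrow> excess \<delta> s * (s - 1) = \<delta> * \<bar>excess \<delta> s\<bar> + (excess \<delta> s)\<^sup>2"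
  by (auto simp: excess_def max_def min_def abs_if power2_eq_square algebra_simps)

lemma excess_eq_0_iff: "0 \<le> \<delta> \<Longrightarrow> excess \<delta> s = 0 \<longleftrightarrow> \<bar>s - 1\<bar> \<le> \<delta>"
  by (auto simp: excess_def max_def min_def abs_if)

lemma le_excess: "0 \<le> \<delta> \<Longrightarrow> s \<le> 1 + \<delta> + \<bar>excess \<delta> s\<bar>"
  by (auto simp: excess_def max_def min_def abs_if)

lemma abs_excess_0: "0 \<le> \<delta> \<Longrightarrow> \<bar>excess \<delta> 0\<bar> \<le> 1"
  by (auto simp: excess_def max_def min_def abs_if)

lemma continuous_excess [continuous_intros]:
  "continuous_on A f \<Longrightarrow> continuous_on A (\<lambda>x. excess \<delta> (f x))"
  unfolding excess_def by (intro continuous_intros)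

section \<open>Cones and compact sets of localized kernels\<close>

lemma psd_on_add: "psd_on Y k \<Longrightarrow> psd_on Y l \<Longrightarrow> psd_on Y (\<lambda>y z. k y z + l y z)"
  by (simp add: psd_on_def distrib_left sum.distrib)

lemma psd_on_scale:
  assumes "psd_on Y k" "0 \<le> t"
  shows "psd_on Y (\<lambda>y z. t * k y z)"
  unfolding psd_on_def
proof (intro conjI allI)
  show "\<forall>y\<in>Y. \<forall>z\<in>Y. t * k y z = t * k z y" using assms by (auto simp: psd_on_def)
  fix c :: "'a \<Rightarrow> real"
  have "(\<Sum>y\<in>Y. \<Sum>z\<in>Y. c y * c z * (t * k y z)) = t * (\<Sum>y\<in>Y. \<Sum>z\<in>Y. c y * c z * k y z)"
    by (simp add: sum_distrib_left mult_ac)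
  then show "0 \<le> (\<Sum>y\<in>Y. \<Sum>z\<in>Y. c y * c z * (t * k y z))"
    using assms psd_on_nonneg[OF assms(1)] by simp
qed

lemma psd_on_gram: "psd_on Y (\<lambda>y z. inner (\<zeta> y) (\<zeta> z))"
  unfolding psd_on_def
proof (intro conjI allI)
  fix c
  have "(\<Sum>y\<in>Y. \<Sum>z\<in>Y. c y * c z * inner (\<zeta> y) (\<zeta> z))
      = (\<Sum>y\<in>Y. inner (c y *\<^sub>R \<zeta> y) (\<Sum>z\<in>Y. c z *\<^sub>R \<zeta> z))"
    by (simp add: inner_sum_right sum_distrib_left mult_ac)
  also have "\<dots> = inner (\<Sum>y\<in>Y. c y *\<^sub>R \<zeta> y) (\<Sum>z\<in>Y. c z *\<^sub>R \<zeta> z)"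
    by (simp only: inner_sum_left)
  finally have "(\<Sum>y\<in>Y. \<Sum>z\<in>Y. c y * c z * inner (\<zeta> y) (\<zeta> z)) = \<dots>" .
  then show "0 \<le> (\<Sum>y\<in>Y. \<Sum>z\<in>Y. c y * c z * inner (\<zeta> y) (\<zeta> z))" by simp
qed (simp add: inner_commute)

text \<open>Uncurried, so that the product topology makes these sets compact.\<close>

definition kernels :: "'a::metric_space set \<Rightarrow> real \<Rightarrow> real \<Rightarrow> ('a \<times> 'a \<times> 'a \<Rightarrow> real) set" where
  "kernels F S b = {\<kappa>. (\<forall>i. \<bar>\<kappa> i\<bar> \<le> b) \<and> (\<forall>x. psd_on (cball x S) (\<lambda>y z. \<kappa> (x, y, z))) \<and>
     (\<forall>x y z. \<kappa> (x, y, z) \<noteq> 0 \<longrightarrow> y \<in> F \<inter> cball x S \<and> z \<in> F \<inter> cball x S)}"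

lemma kernels_bounded: "\<kappa> \<in> kernels F S b \<Longrightarrow> \<bar>\<kappa> i\<bar> \<le> b"
  unfolding kernels_def by blast

abbreviation kernel_total :: "real \<Rightarrow> ('a::metric_space \<times> 'a \<times> 'a \<Rightarrow> real) \<Rightarrow> 'a \<Rightarrow> 'a \<Rightarrow> real" where
  "kernel_total S \<kappa> \<equiv> kernel_sum S (\<lambda>x y z. \<kappa> (x, y, z))"

lemma continuous_on_coordinate: "continuous_on A (\<lambda>\<kappa> :: 'i \<Rightarrow> real. \<kappa> i)"
  by (rule continuous_on_subset[OF continuous_on_product_coordinates]) simp

lemma continuous_kernel_total: "continuous_on A (\<lambda>\<kappa>. kernel_total S \<kappa> y z)"
  unfolding kernel_sum_def by (intro continuous_on_sum continuous_on_coordinate)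

text \<open>The box is compact by Tychonoff, and the constraints are an intersection of closed
  conditions on the coordinates.\<close>

lemma compact_kernels: "compact (kernels F S b)"
proof -
  have "compactin (product_topology (\<lambda>i. euclidean) UNIV) (PiE UNIV (\<lambda>i :: 'a \<times> 'a \<times> 'a. {- b..b}))"
    by (simp add: compactin_PiE)
  then have "compact (PiE UNIV (\<lambda>i :: 'a \<times> 'a \<times> 'a. {- b..b}))"
    by (simp add: euclidean_product_topology)
  moreover have "closed (kernels F S b)"
    unfolding kernels_def psd_on_def Ball_def
    by (intro closed_Collect_conj closed_Collect_all closed_Collect_imp closed_Collect_le closed_Collect_eq
        open_Collect_const open_Collect_neq closed_Collect_const continuous_intros continuous_on_coordinate)
  moreover have "kernels F S b \<subseteq> PiE UNIV (\<lambda>i. {- b..b})"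
    by (auto simp: kernels_def abs_le_iff) (metis minus_le_iff)
  ultimately show ?thesis
    by (metis compact_Int_closed inf.absorb2)
qed

lemma kernel_total_sym:
  assumes "\<kappa> \<in> kernels F S b"
  shows "kernel_total S \<kappa> y z = kernel_total S \<kappa> z y"
  unfolding kernel_sum_def
proof (rule sum.cong)
  fix x assume "x \<in> cball z S \<inter> cball y S"
  moreover have "psd_on (cball x S) (\<lambda>y z. \<kappa> (x, y, z))" using assms by (simp add: kernels_def)
  ultimately show "\<kappa> (x, y, z) = \<kappa> (x, z, y)"
    using psd_on_sym[of "cball x S" "\<lambda>y z. \<kappa> (x, y, z)" y z] by (simp add: dist_commute)
qed auto

text \<open>The diagonal summands are nonnegative, so each is bounded by the total; Cauchy-Schwarz
  handles the rest. The new bound does not involve \<open>b\<close>: it moves the minimiser off the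
  walls of its box, and finally gives a bound common to all finite sets.\<close>

lemma kernels_bound_by_diagonal:
  fixes F :: "'a::metric_space set"
  assumes fin: "\<And>x :: 'a. finite (cball x S)" and \<kappa>: "\<kappa> \<in> kernels F S b" and "0 \<le> B"
    and diag: "\<And>y. y \<in> F \<Longrightarrow> kernel_total S \<kappa> y y \<le> B"
  shows "\<kappa> \<in> kernels F S B"
proof -
  have psd: "psd_on (cball x S) (\<lambda>y z. \<kappa> (x, y, z))" for x using \<kappa> by (simp add: kernels_def)
  have le: "\<kappa> (x, y, y) \<le> B" if "y \<in> F" "x \<in> cball y S" for x y
  proof -
    have "\<kappa> (x, y, y) \<le> kernel_total S \<kappa> y y"
      unfolding kernel_sum_def
    proof (rule member_le_sum)
      show "0 \<le> \<kappa> (w, y, y)" if "w \<in> cball y S \<inter> cball y S - {x}" for w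
        using psd_on_diag[OF psd[of w] fin, of y] that by (simp add: dist_commute)
    qed (use that fin in auto)
    then show ?thesis using diag[OF that(1)] by simp
  qed
  have "\<bar>\<kappa> (x, y, z)\<bar> \<le> B" for x y z
  proof (cases "\<kappa> (x, y, z) = 0")
    case False
    then have yz: "y \<in> F" "z \<in> F" "y \<in> cball x S" "z \<in> cball x S"
      using \<kappa> unfolding kernels_def by blast+
    have "(\<kappa> (x, y, z))\<^sup>2 \<le> \<kappa> (x, y, y) * \<kappa> (x, z, z)"
      using psd_on_Cauchy_Schwarz[OF psd fin yz(3,4)] .
    also have "\<dots> \<le> B * B"
      using yz psd_on_diag[OF psd fin] le \<open>0 \<le> B\<close> by (intro mult_mono) (auto simp: dist_commute)
    finally have "(\<kappa> (x, y, z))\<^sup>2 \<le> B\<^sup>2" by (simp add: power2_eq_square)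
    then show ?thesis using \<open>0 \<le> B\<close> by (simp add: abs_le_square_iff[symmetric])
  qed (use \<open>0 \<le> B\<close> in simp)
  then show ?thesis using \<kappa> by (auto simp: kernels_def)
qed

lemma nonneg_of_quadratic_perturbation:
  fixes X Y t0 :: real
  assumes "0 < t0" "0 \<le> Y" and ge: "\<And>t. 0 < t \<Longrightarrow> t \<le> t0 \<Longrightarrow> 0 \<le> 2 * t * X + t\<^sup>2 * Y"
  shows "0 \<le> X"
proof (rule ccontr)
  assume "\<not> 0 \<le> X"
  then have X: "X < 0" by simp
  \<comment> \<open>For this step t (Y + 1) \<le> -X, so the quadratic term cannot compensate the
    negative linear one.\<close>
  define t where "t = min t0 (- X / (Y + 1))"
  have t: "0 < t" "t \<le> t0" using X assms(1,2) by (auto simp: t_def intro!: divide_neg_pos)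
  have "t * (Y + 1) \<le> - X / (Y + 1) * (Y + 1)"
    using assms(2) by (intro mult_right_mono) (auto simp: t_def)
  also have "\<dots> = - X" using assms(2) by simp
  finally have "t * Y + t \<le> - X" by (simp add: distrib_left)
  then have "2 * X + t * Y < 0" using X t(1) by linarith
  then have "t * (2 * X + t * Y) < 0" using t(1) by (simp add: mult_pos_neg)
  then show False using ge[OF t] by (simp add: algebra_simps power2_eq_square)
qed

text \<open>At a minimum of the squared excess of the total kernel over \<open>[1 - \<delta>, 1 + \<delta>]\<close>, the excess \<open>m\<close>
  itself is nonnegative on every localized positive kernel, because such a kernel is an admissible
  direction; moving towards \<open>0\<close> is admissible as well, which bounds the sum of \<open>m\<close> from above.\<close>

lemma localized_kernel_on_finite_set:
  fixes F :: "'a::metric_space set"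
  assumes fin: "\<And>x :: 'a. finite (cball x S)" and "finite F" and \<delta>: "0 < \<delta>" "\<delta> \<le> 1" and "0 \<le> R"
    and lower: "\<And>m :: 'a \<Rightarrow> 'a \<Rightarrow> real. (\<And>y z. m y z = m z y) \<Longrightarrow>
      (\<And>y z. m y z \<noteq> 0 \<Longrightarrow> y \<in> F \<and> z \<in> F \<and> dist y z \<le> R) \<Longrightarrow>
      (\<And>x l. psd_on (cball x S) l \<Longrightarrow> (\<And>y z. l y z \<noteq> 0 \<Longrightarrow> y \<in> F \<inter> cball x S \<and> z \<in> F \<inter> cball x S) \<Longrightarrow>
        0 \<le> (\<Sum>y\<in>F. \<Sum>z\<in>F. m y z * l y z)) \<Longrightarrow>
      - \<delta> * (\<Sum>y\<in>F. m y y) \<le> (\<Sum>y\<in>F. \<Sum>z\<in>F. m y z)"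
  shows "\<exists>\<kappa>\<in>kernels F S 2. \<forall>y\<in>F. \<forall>z\<in>F. dist y z \<le> R \<longrightarrow> \<bar>kernel_total S \<kappa> y z - 1\<bar> \<le> \<delta>"
proof -
  let ?k = "kernel_total S"
  define Q where "Q \<kappa> = (\<Sum>y\<in>F. \<Sum>z\<in>F. if dist y z \<le> R then (excess \<delta> (?k \<kappa> y z))\<^sup>2 else 0)" for \<kappa>
  define q where "q = (real (card F))\<^sup>2"
  \<comment> \<open>The zero kernel shows that the minimum of \<open>Q\<close> is at most
    \<open>q\<close>, so diagonal totals are at most 1 + \<delta> + (q + 1) \<le> q + 3. Minimising
    over the larger box \<open>b + 1\<close> leaves room 1 for perturbations.\<close>
  define b where "b = q + 3"
  have q: "0 \<le> q" by (simp add: q_def)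
  have zero: "(\<lambda>_. 0) \<in> kernels F S (b + 1)" using q by (simp add: kernels_def psd_on_def b_def)
  have "continuous_on A (\<lambda>\<kappa>. if dist y z \<le> R then (excess \<delta> (?k \<kappa> y z))\<^sup>2 else 0)" for A y z
    by (cases "dist y z \<le> R") (auto intro!: continuous_intros continuous_kernel_total)
  then have "continuous_on (kernels F S (b + 1)) Q"
    unfolding Q_def by (intro continuous_on_sum)
  then obtain \<kappa> where \<kappa>: "\<kappa> \<in> kernels F S (b + 1)"
    and min: "\<And>\<kappa>'. \<kappa>' \<in> kernels F S (b + 1) \<Longrightarrow> Q \<kappa> \<le> Q \<kappa>'"
    using continuous_attains_inf[OF compact_kernels] zero by (metis empty_iff)
  have "Q (\<lambda>_. 0) \<le> (\<Sum>y\<in>F. \<Sum>z\<in>F. 1)"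
    unfolding Q_def
    using abs_excess_0[of \<delta>] \<delta>(1) by (intro sum_mono) (auto simp: kernel_sum_def abs_square_le_1)
  then have Q_le: "Q \<kappa> \<le> q" using min[OF zero] by (simp add: q_def power2_eq_square)
  have entry: "(excess \<delta> (?k \<kappa> y z))\<^sup>2 \<le> Q \<kappa>" if "y \<in> F" "z \<in> F" "dist y z \<le> R" for y z
  proof -
    have "(if dist y z \<le> R then (excess \<delta> (?k \<kappa> y z))\<^sup>2 else 0)
        \<le> (\<Sum>z\<in>F. if dist y z \<le> R then (excess \<delta> (?k \<kappa> y z))\<^sup>2 else 0)"
      using that \<open>finite F\<close> by (intro member_le_sum) auto
    also have "\<dots> \<le> Q \<kappa>"
      unfolding Q_def using that \<open>finite F\<close> by (intro member_le_sum[of y]) (auto intro!: sum_nonneg)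
    finally show ?thesis using that by simp
  qed
  have "?k \<kappa> y y \<le> b" if "y \<in> F" for y
  proof -
    have "(excess \<delta> (?k \<kappa> y y))\<^sup>2 \<le> q" using entry[OF that that] \<open>0 \<le> R\<close> Q_le by simp
    also have "\<dots> \<le> (q + 1)\<^sup>2" using q by (simp add: power2_eq_square algebra_simps)
    finally have "\<bar>excess \<delta> (?k \<kappa> y y)\<bar> \<le> q + 1" using q by (simp add: abs_le_square_iff[symmetric])
    then show ?thesis using le_excess[of \<delta> "?k \<kappa> y y"] \<delta> by (simp add: b_def)
  qed
  then have \<kappa>b: "\<kappa> \<in> kernels F S b"
    using q by (intro kernels_bound_by_diagonal[OF fin \<kappa>]) (auto simp: b_def)
  define m where "m y z = (if y \<in> F \<and> z \<in> F \<and> dist y z \<le> R then excess \<delta> (?k \<kappa> y z) else 0)" for y z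
  have Qm: "Q \<kappa> = (\<Sum>y\<in>F. \<Sum>z\<in>F. (m y z)\<^sup>2)"
    unfolding Q_def by (intro sum.cong refl) (auto simp: m_def)
  \<comment> \<open>The variational inequality at the minimum, with \<open>m\<close> as gradient;
    \<open>excess_add_le\<close> bounds \<open>Q\<close> along the direction by a quadratic
    polynomial in \<open>t\<close>.\<close>
  have direction: "0 \<le> (\<Sum>y\<in>F. \<Sum>z\<in>F. m y z * ?k \<kappa>' y z)"
    if "0 < t0" and adm: "\<And>t. 0 < t \<Longrightarrow> t \<le> t0 \<Longrightarrow> (\<lambda>i. \<kappa> i + t * \<kappa>' i) \<in> kernels F S (b + 1)" for \<kappa>' t0
  proof (rule nonneg_of_quadratic_perturbation[OF \<open>0 < t0\<close>])
    show "0 \<le> (\<Sum>y\<in>F. \<Sum>z\<in>F. (?k \<kappa>' y z)\<^sup>2)" by (intro sum_nonneg) auto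
    fix t assume t: "0 < t" "t \<le> t0"
    have add: "?k (\<lambda>i. \<kappa> i + t * \<kappa>' i) y z = ?k \<kappa> y z + t * ?k \<kappa>' y z" for y z
      by (simp add: kernel_sum_def sum.distrib sum_distrib_left)
    have "Q \<kappa> \<le> Q (\<lambda>i. \<kappa> i + t * \<kappa>' i)" by (rule min[OF adm[OF t]])
    also have "\<dots> \<le> (\<Sum>y\<in>F. \<Sum>z\<in>F. (m y z)\<^sup>2 + 2 * t * (m y z * ?k \<kappa>' y z) + t\<^sup>2 * (?k \<kappa>' y z)\<^sup>2)"
      unfolding Q_def add
    proof (intro sum_mono)
      fix y z assume yz: "y \<in> F" "z \<in> F"
      have "(excess \<delta> (?k \<kappa> y z + t * ?k \<kappa>' y z))\<^sup>2 \<le> (excess \<delta> (?k \<kappa> y z) + t * ?k \<kappa>' y z)\<^sup>2"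
        using \<delta> by (intro excess_add_le) simp
      then show "(if dist y z \<le> R then (excess \<delta> (?k \<kappa> y z + t * ?k \<kappa>' y z))\<^sup>2 else 0)
          \<le> (m y z)\<^sup>2 + 2 * t * (m y z * ?k \<kappa>' y z) + t\<^sup>2 * (?k \<kappa>' y z)\<^sup>2"
        using yz by (auto simp: m_def power2_sum power_mult_distrib mult_ac)
    qed
    also have "\<dots> = Q \<kappa> + 2 * t * (\<Sum>y\<in>F. \<Sum>z\<in>F. m y z * ?k \<kappa>' y z) + t\<^sup>2 * (\<Sum>y\<in>F. \<Sum>z\<in>F. (?k \<kappa>' y z)\<^sup>2)"
      by (simp add: Qm sum.distrib sum_distrib_left)
    finally show "0 \<le> 2 * t * (\<Sum>y\<in>F. \<Sum>z\<in>F. m y z * ?k \<kappa>' y z) + t\<^sup>2 * (\<Sum>y\<in>F. \<Sum>z\<in>F. (?k \<kappa>' y z)\<^sup>2)"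
      by simp
  qed
  have "0 \<le> (\<Sum>y\<in>F. \<Sum>z\<in>F. m y z * ?k (\<lambda>i. - \<kappa> i) y z)"
  proof (rule direction[of 1])
    fix t :: real assume t: "0 < t" "t \<le> 1"
    have eq: "(\<lambda>i. \<kappa> i + t * - \<kappa> i) = (\<lambda>i. (1 - t) * \<kappa> i)" by (auto simp: algebra_simps)
    have "\<bar>(1 - t) * \<kappa> i\<bar> \<le> b + 1" for i
    proof -
      have "\<bar>(1 - t) * \<kappa> i\<bar> \<le> 1 * \<bar>\<kappa> i\<bar>" unfolding abs_mult using t by (intro mult_right_mono) auto
      also have "\<dots> \<le> b + 1" using kernels_bounded[OF \<kappa>] by simp
      finally show ?thesis .
    qed
    then show "(\<lambda>i. \<kappa> i + t * - \<kappa> i) \<in> kernels F S (b + 1)"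
      unfolding eq using \<kappa> t by (auto simp: kernels_def intro: psd_on_scale)
  qed simp
  then have towards_0: "(\<Sum>y\<in>F. \<Sum>z\<in>F. m y z * ?k \<kappa> y z) \<le> 0"
    by (simp add: kernel_sum_def sum_negf)
  have "- \<delta> * (\<Sum>y\<in>F. m y y) \<le> (\<Sum>y\<in>F. \<Sum>z\<in>F. m y z)"
  proof (rule lower)
    show "m y z = m z y" for y z
      using kernel_total_sym[OF \<kappa>, of y z] by (auto simp: m_def dist_commute)
    show "y \<in> F \<and> z \<in> F \<and> dist y z \<le> R" if "m y z \<noteq> 0" for y z
      using that by (auto simp: m_def split: if_splits)
    fix x l assume l: "psd_on (cball x S) l" and supp: "\<And>y z. l y z \<noteq> 0 \<Longrightarrow> y \<in> F \<inter> cball x S \<and> z \<in> F \<inter> cball x S"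
    \<comment> \<open>The test kernel is placed at the single centre \<open>x\<close>, so its total
      is \<open>l\<close> itself.\<close>
    define \<kappa>' where "\<kappa>' = (\<lambda>(w, y, z). if w = x then l y z else 0)"
    have k': "?k \<kappa>' y z = l y z" for y z
    proof -
      have "?k \<kappa>' y z = (if x \<in> cball y S \<inter> cball z S then l y z else 0)"
        using fin by (simp add: kernel_sum_def \<kappa>'_def)
      then show ?thesis using supp[of y z] by (auto simp: dist_commute)
    qed
    define c where "c = (\<Sum>y\<in>F. \<Sum>z\<in>F. \<bar>l y z\<bar>)"
    have c0: "0 \<le> c" by (simp add: c_def sum_nonneg)
    have lc: "\<bar>l y z\<bar> \<le> c" for y z
    proof (cases "l y z = 0")
      case False
      then have yz: "y \<in> F" "z \<in> F" using supp by auto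
      have "\<bar>l y z\<bar> \<le> (\<Sum>z\<in>F. \<bar>l y z\<bar>)" using yz \<open>finite F\<close> by (intro member_le_sum) auto
      also have "\<dots> \<le> c" unfolding c_def using yz \<open>finite F\<close> by (intro member_le_sum[of y]) (auto intro!: sum_nonneg)
      finally show ?thesis .
    qed (use c0 in simp)
    have "0 \<le> (\<Sum>y\<in>F. \<Sum>z\<in>F. m y z * ?k \<kappa>' y z)"
    proof (rule direction[of "1 / (c + 1)"])
      show "0 < 1 / (c + 1)" using c0 by simp
      fix t assume t: "0 < t" "t \<le> 1 / (c + 1)"
      have "\<bar>\<kappa> i + t * \<kappa>' i\<bar> \<le> b + 1" for i
      proof -
        have "\<bar>\<kappa>' i\<bar> \<le> c" using lc c0 by (auto simp: \<kappa>'_def split: prod.split)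
        then have "t * \<bar>\<kappa>' i\<bar> \<le> 1 / (c + 1) * c" using t c0 by (intro mult_mono) auto
        also have "\<dots> \<le> 1" using c0 by simp
        finally have "\<bar>t * \<kappa>' i\<bar> \<le> 1" using t by (simp add: abs_mult)
        moreover have "\<bar>\<kappa> i\<bar> \<le> b" by (rule kernels_bounded[OF \<kappa>b])
        ultimately show ?thesis by linarith
      qed
      moreover have "psd_on (cball w S) (\<lambda>y z. \<kappa> (w, y, z) + t * \<kappa>' (w, y, z))" for w
      proof -
        have "psd_on (cball w S) (\<lambda>y z. \<kappa> (w, y, z))" using \<kappa> by (simp add: kernels_def)
        moreover have "psd_on (cball w S) (\<lambda>y z. t * \<kappa>' (w, y, z))"
          using psd_on_scale[OF l, of t] t by (cases "w = x") (auto simp: \<kappa>'_def psd_on_def)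
        ultimately show ?thesis by (rule psd_on_add)
      qed
      moreover have "y \<in> F \<inter> cball w S \<and> z \<in> F \<inter> cball w S" if "\<kappa> (w, y, z) + t * \<kappa>' (w, y, z) \<noteq> 0" for w y z
      proof (cases "\<kappa> (w, y, z) = 0")
        case True
        then have "\<kappa>' (w, y, z) \<noteq> 0" using that by auto
        then have "w = x" "l y z \<noteq> 0" by (auto simp: \<kappa>'_def split: if_splits)
        then show ?thesis using supp by blast
      next
        case False
        then show ?thesis using \<kappa> unfolding kernels_def by blast
      qed
      ultimately show "(\<lambda>i. \<kappa> i + t * \<kappa>' i) \<in> kernels F S (b + 1)"
        unfolding kernels_def by blast
    qed
    then show "0 \<le> (\<Sum>y\<in>F. \<Sum>z\<in>F. m y z * l y z)" by (simp only: k')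
  qed
  \<comment> \<open>The right side is at most 0 by \<open>towards_0\<close>. On the left, the sum of
    absolute values dominates the trace, so the lower bound makes the first two terms together
    nonnegative, leaving \<open>Q \<kappa> \<le> 0\<close>.\<close>
  moreover have "(\<Sum>y\<in>F. \<Sum>z\<in>F. m y z) + \<delta> * (\<Sum>y\<in>F. \<Sum>z\<in>F. \<bar>m y z\<bar>) + (\<Sum>y\<in>F. \<Sum>z\<in>F. (m y z)\<^sup>2)
      = (\<Sum>y\<in>F. \<Sum>z\<in>F. m y z * ?k \<kappa> y z)"
  proof -
    have "m y z * ?k \<kappa> y z = m y z + \<delta> * \<bar>m y z\<bar> + (m y z)\<^sup>2" for y z
      using excess_mult[of \<delta> "?k \<kappa> y z"] \<delta> by (simp add: m_def algebra_simps)
    then show ?thesis by (simp add: sum.distrib sum_distrib_left)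
  qed
  moreover have "\<delta> * (\<Sum>y\<in>F. m y y) \<le> \<delta> * (\<Sum>y\<in>F. \<Sum>z\<in>F. \<bar>m y z\<bar>)"
  proof (intro mult_left_mono sum_mono)
    fix y assume "y \<in> F"
    then have "\<bar>m y y\<bar> \<le> (\<Sum>z\<in>F. \<bar>m y z\<bar>)" using \<open>finite F\<close> by (intro member_le_sum) auto
    then show "m y y \<le> (\<Sum>z\<in>F. \<bar>m y z\<bar>)" by linarith
  qed (use \<delta> in simp)
  ultimately have "Q \<kappa> \<le> 0" unfolding Qm using towards_0 by linarith
  then have close: "\<bar>?k \<kappa> y z - 1\<bar> \<le> \<delta>" if "y \<in> F" "z \<in> F" "dist y z \<le> R" for y z
  proof -
    have "(excess \<delta> (?k \<kappa> y z))\<^sup>2 \<le> 0" using entry[OF that] \<open>Q \<kappa> \<le> 0\<close> by linarith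
    then show ?thesis using \<delta> by (simp add: excess_eq_0_iff)
  qed
  then have "?k \<kappa> y y \<le> 2" if "y \<in> F" for y
    using close[OF that that] \<open>0 \<le> R\<close> \<delta> by simp
  then have "\<kappa> \<in> kernels F S 2" by (intro kernels_bound_by_diagonal[OF fin \<kappa>]) auto
  then show ?thesis using close by blast
qed

lemma kernels_mono: "F \<subseteq> G \<Longrightarrow> kernels F S b \<subseteq> kernels G S b"
  unfolding kernels_def by blast

text \<open>The finite intersection property: finitely many pairs involve only a finite set of
  points, and kernels supported there already lie in the compact set for the whole space. The bound
  \<open>b\<close> is common to all finite sets.\<close>

lemma localized_kernel_compactness:
  assumes finite_sets: "\<And>F :: 'a::metric_space set. finite F \<Longrightarrow>
    \<exists>\<kappa>\<in>kernels F S b. \<forall>y\<in>F. \<forall>z\<in>F. dist y z \<le> R \<longrightarrow> \<bar>kernel_total S \<kappa> y z - 1\<bar> \<le> \<delta>"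
  shows "\<exists>\<kappa>\<in>kernels (UNIV :: 'a set) S b. \<forall>y z. dist y z \<le> R \<longrightarrow> \<bar>kernel_total S \<kappa> y z - 1\<bar> \<le> \<delta>"
proof -
  define C where "C = (\<lambda>(y :: 'a, z). {\<kappa>. \<bar>kernel_total S \<kappa> y z - 1\<bar> \<le> \<delta>})"
  let ?band = "{(y :: 'a, z). dist y z \<le> R}"
  have "kernels UNIV S b \<inter> \<Inter>(C ` ?band) \<noteq> {}"
  proof (rule compact_imp_fip[OF compact_kernels])
    fix T assume "T \<in> C ` ?band"
    then obtain y z where "T = {\<kappa>. \<bar>kernel_total S \<kappa> y z - 1\<bar> \<le> \<delta>}" by (auto simp: C_def)
    then show "closed T"
      by (auto intro!: closed_Collect_le continuous_intros continuous_kernel_total)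
  next
    fix \<F> assume "finite \<F>" "\<F> \<subseteq> C ` ?band"
    then obtain P where P: "P \<subseteq> ?band" "finite P" "\<F> = C ` P"
      by (meson finite_subset_image)
    define F where "F = fst ` P \<union> snd ` P"
    have "finite F" using P by (simp add: F_def)
    from finite_sets[OF this] obtain \<kappa> where \<kappa>: "\<kappa> \<in> kernels F S b"
      and close: "\<And>y z. y \<in> F \<Longrightarrow> z \<in> F \<Longrightarrow> dist y z \<le> R \<Longrightarrow> \<bar>kernel_total S \<kappa> y z - 1\<bar> \<le> \<delta>"
      by blast
    have "\<kappa> \<in> kernels UNIV S b" using \<kappa> kernels_mono[of F UNIV] by blast
    moreover have "\<kappa> \<in> C p" if "p \<in> P" for p
    proof (cases p)
      case (Pair y z)
      then have "y \<in> F" "z \<in> F" "dist y z \<le> R" using that P(1) by (force simp: F_def)+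
      then show ?thesis using close Pair by (simp add: C_def)
    qed
    ultimately show "kernels UNIV S b \<inter> \<Inter>\<F> \<noteq> {}" using P(3) by blast
  qed
  then show ?thesis by (auto simp: C_def)
qed

proposition ONL_imp_property_A:
  assumes "infinite_dimensional TYPE('h::complex_hilbert_space)"
    and bg: "bounded_geometry TYPE('a::metric_space)" and onl: "has_ONL TYPE('h) TYPE('a)"
  shows "property_A TYPE('a)"
proof (rule property_A_if_kernels[OF bg])
  fix R' \<delta>' :: real
  assume "0 < R'" "0 < \<delta>'"
  define \<delta> where "\<delta> = min \<delta>' 1"
  have \<delta>: "0 < \<delta>" "\<delta> \<le> 1" "\<delta> \<le> \<delta>'" using \<open>0 < \<delta>'\<close> by (auto simp: \<delta>_def)
  define R where "R = nat \<lceil>R'\<rceil>"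
  have R: "R' \<le> real R" by (simp add: R_def) linarith
  obtain h :: 'h where h: "norm h = 1" using infinite_dimensional_unit_vector[OF assms(1)] .
  obtain c f where c: "0 < c" and onl: "\<And>\<nu> :: 'a measure. locally_finite_borel \<nu> \<Longrightarrow>
      emeasure \<nu> (space \<nu>) \<noteq> 0 \<Longrightarrow> ONL_relative TYPE('h) \<nu> f c"
    using onl unfolding has_ONL_def by blast
  note fin = bounded_geometry_finite_cball[OF bg]
  obtain N where N: "1 \<le> N" "\<And>x::'a. card (cball x (real R)) \<le> N"
    using bounded_geometry_card_cball[OF bg] by blast
  have "1 < (real N + \<delta>) / real N" using N(1) \<delta>(1) by simp
  \<comment> \<open>This power makes the gain (1 + \<delta>/N)^n outweigh the loss 1 / c.\<close>
  then obtain n where n: "1 / c < ((real N + \<delta>) / real N) ^ n"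
    using real_arch_pow by blast
  have "real N ^ n < c * (real N + \<delta>) ^ n"
    using n N(1) c by (simp add: power_divide field_simps)
  note n = this
  define r where "r = real (f (n * R))"
  \<comment> \<open>The summand r + n R leaves room for the iterates of a localized vector,
    \<open>R\<close> makes neighbouring pairs localized, and 1 ensures positivity.\<close>
  define S where "S = r + real n * real R + real R + 1"
  have S: "0 < S" "real R \<le> S" "r + real n * real R \<le> S"
    by (simp_all add: S_def r_def add_nonneg_pos)
  have finite_sets: "\<exists>\<kappa>\<in>kernels F S 2. \<forall>y\<in>F. \<forall>z\<in>F. dist y z \<le> real R \<longrightarrow> \<bar>kernel_total S \<kappa> y z - 1\<bar> \<le> \<delta>"
    if "finite F" for F :: "'a set"
  proof (rule localized_kernel_on_finite_set[OF fin that \<delta>(1,2)])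
    fix m :: "'a \<Rightarrow> 'a \<Rightarrow> real"
    assume sym: "\<And>y z. m y z = m z y"
      and band: "\<And>y z. m y z \<noteq> 0 \<Longrightarrow> y \<in> F \<and> z \<in> F \<and> dist y z \<le> real R"
      and loc: "\<And>x l. psd_on (cball x S) l \<Longrightarrow> (\<And>y z. l y z \<noteq> 0 \<Longrightarrow> y \<in> F \<inter> cball x S \<and> z \<in> F \<inter> cball x S) \<Longrightarrow>
        0 \<le> (\<Sum>y\<in>F. \<Sum>z\<in>F. m y z * l y z)"
    show "- \<delta> * (\<Sum>y\<in>F. m y y) \<le> (\<Sum>y\<in>F. \<Sum>z\<in>F. m y z)"
    proof (rule localized_psd_sum_ge[where h = h and R = "real R" and S = S and n = n and r = r and c = c and N = N])
      fix x and \<zeta> :: "'a \<Rightarrow> 'h"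
      assume supp: "\<And>y. \<zeta> y \<noteq> 0 \<Longrightarrow> y \<in> F \<inter> cball x S"
      show "0 \<le> mat_form F m \<zeta> \<zeta>"
        unfolding mat_form_def
      \<comment> \<open>The form of \<open>m\<close> at \<zeta> is the pairing of \<open>m\<close>
        with the Gram kernel of \<zeta>, which is positive and localized in the same ball.\<close>
      proof (rule loc[OF psd_on_gram])
        fix y z assume "inner (\<zeta> y) (\<zeta> z) \<noteq> 0"
        then have "\<zeta> y \<noteq> 0" "\<zeta> z \<noteq> 0" by auto
        then show "y \<in> F \<inter> cball x S \<and> z \<in> F \<inter> cball x S" using supp by blast
      qed
    next
      fix y assume "y \<in> F"
      have "card {z \<in> F. dist y z \<le> real R} \<le> card (cball y (real R))"
        by (rule card_mono[OF fin]) auto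
      then show "card {z \<in> F. dist y z \<le> real R} \<le> N" using N(2)[of y] by simp
    next
      fix a l and v :: "'a \<Rightarrow> 'h"
      assume "\<And>y z. a y z \<noteq> 0 \<Longrightarrow> dist y z \<le> real R" "0 < norm_on F v"
        "l * norm_on F v \<le> norm_on F ((mat_app F a ^^ n) v)"
      then show "\<exists>(\<zeta> :: 'a \<Rightarrow> 'h) x. (\<forall>y. \<zeta> y \<noteq> 0 \<longrightarrow> y \<in> F \<inter> cball x r) \<and> 0 < norm_on F \<zeta> \<and>
          c * l * norm_on F \<zeta> \<le> norm_on F ((mat_app F a ^^ n) \<zeta>)"
        unfolding r_def by (intro ONL_relative_finite_matrix[OF bg onl that c])
    next
      show "y \<in> F \<and> z \<in> F \<and> dist y z \<le> real R" if "m y z \<noteq> 0" for y z by (rule band[OF that])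
    qed (fact \<open>finite F\<close> sym h S N(1) \<delta>(1) n of_nat_0_le_iff)+
  qed simp
  obtain \<kappa> where \<kappa>: "\<kappa> \<in> kernels (UNIV :: 'a set) S 2"
    and close: "\<And>y z. dist y z \<le> real R \<Longrightarrow> \<bar>kernel_total S \<kappa> y z - 1\<bar> \<le> \<delta>"
    using localized_kernel_compactness[OF finite_sets] by blast
  show "\<exists>S>0. \<exists>\<kappa> :: 'a \<Rightarrow> 'a \<Rightarrow> 'a \<Rightarrow> real. (\<forall>x. psd_on (cball x S) (\<kappa> x)) \<and>
      (\<forall>y z. dist y z \<le> R' \<longrightarrow> \<bar>kernel_sum S \<kappa> y z - 1\<bar> \<le> \<delta>')"
  proof (intro exI[of _ S] exI[of _ "\<lambda>x y z. \<kappa> (x, y, z)"] conjI allI impI S(1))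
    show "psd_on (cball x S) (\<lambda>y z. \<kappa> (x, y, z))" for x using \<kappa> by (simp add: kernels_def)
    show "\<bar>kernel_total S \<kappa> y z - 1\<bar> \<le> \<delta>'" if "dist y z \<le> R'" for y z
      using close[of y z] that R \<delta>(3) by simp
  qed
qed

theorem theorem4p1:
  assumes "separable_space (euclidean :: 'h::complex_hilbert_space topology)"
    and "infinite_dimensional TYPE('h)"
    and "bounded_geometry TYPE('a::metric_space)"
  shows "property_A TYPE('a) \<longleftrightarrow> has_ONL TYPE('h) TYPE('a)"
  using property_A_imp_ONL[OF assms(2,3)] ONL_imp_property_A[OF assms(2,3)] by blast

end
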